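(* Suppose that $f \in C^2(\mathbb{R}^d)$ (real-valued) has a unique global minimizer, and that there is a constant $L > 0$ such that $\Delta f(x) \le L\,(1+\|\nabla f(x)\|^2)$ for all $x\in\mathbb{R}^d$. For each $t > 0$, let $\mu_t = \frac{1}{Z_t}\, e^{-f/t}$ be a probability measure (that is, $Z_t = \int_{\mathbb{R}^d} e^{-f/t} < \infty$ for every $t>0$). Then the limit $$C_{\mathsf{bLS}}(f) := \lim_{t\to 0^+} \frac{C_{\mathsf{LS}}(\mu_t)}{t}$$ exists (as a finite number) if and only if $C_{\mathsf{PL}}(f) < \infty$, and in this case $$C_{\mathsf{bLS}}(f) = C_{\mathsf{PL}}(f).$$
   Context: Probability measures with a Lebesgue density are identified with their densities. For a probability measure $\mu$ on $\mathbb{R}^d$ and a probability measure $\nu \ll \mu$ such that $(\frac{d\nu}{d\mu})^{1/2}$ is compactly supported and smooth, define the Kullback--Leibler divergence and Fisher information $$\mathsf{KL}(\nu\,\|\,\mu) = \int \log\frac{d\nu}{d\mu}\,d\nu, \qquad \mathsf{FI}(\nu\,\|\,\mu) = \int \Bigl\|\nabla\log\frac{d\nu}{d\mu}\Bigr\|^2 d\nu ,$$ where the latter is understood as $4\int \|\nabla (\frac{d\nu}{d\mu})^{1/2}\|^2\,d\mu$. The log-Sobolev constant $C_{\mathsf{LS}}(\mu)$ is the smallest constant $C>0$ such that $\mathsf{KL}(\nu\,\|\,\mu) \le \frac{C}{2}\,\mathsf{FI}(\nu\,\|\,\mu)$ for all such $\nu$ (and $+\infty$ if there is no such constant). For $f$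 bounded below and differentiable, with $f_\star = \inf_{x\in\mathbb{R}^d} f(x)$, the Polyak--Łojasiewicz (PL) constant $C_{\mathsf{PL}}(f)$ is the least constant $C>0$ such that $f(x) - f_\star \le \frac{C}{2}\,\|\nabla f(x)\|^2$ for all $x\in\mathbb{R}^d$, or $+\infty$ if no such constant exists. *)

theory Defs
  imports "HOL-Probability.Probability"
begin

definition partial_deriv :: "'a::euclidean_space \<Rightarrow> ('a \<Rightarrow> real) \<Rightarrow> 'a \<Rightarrow> real" where
  "partial_deriv v g x = frechet_derivative g (at x) v"

definition gradient :: "('a::euclidean_space \<Rightarrow> real) \<Rightarrow> 'a \<Rightarrow> 'a" where
  "gradient g x = (THE D. GDERIV g x :> D)"

definition laplacian :: "('a::euclidean_space \<Rightarrow> real) \<Rightarrow> 'a \<Rightarrow> real" where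
  "laplacian g x = (\<Sum>b\<in>Basis. partial_deriv b (partial_deriv b g) x)"

primrec C_k :: "nat \<Rightarrow> ('a::euclidean_space \<Rightarrow> real) \<Rightarrow> bool" where
  "C_k 0 g \<longleftrightarrow> continuous_on UNIV g"
| "C_k (Suc k) g \<longleftrightarrow>
     (\<forall>x. g differentiable (at x)) \<and> (\<forall>b\<in>Basis. C_k k (partial_deriv b g))"

definition smooth :: "('a::euclidean_space \<Rightarrow> real) \<Rightarrow> bool" where
  "smooth g \<longleftrightarrow> (\<forall>k. C_k k g)"

definition compactly_supported :: "('a::euclidean_space \<Rightarrow> real) \<Rightarrow> bool" where
  "compactly_supported g \<longleftrightarrow> compact (closure {x. g x \<noteq> 0})"

(* g is a version of the square root of the Radon-Nikodym derivative of nu with respect to mu;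
   the latter is determined only up to a mu-null set. *)
definition is_sqrt_RN_deriv ::
    "'a::euclidean_space measure \<Rightarrow> 'a measure \<Rightarrow> ('a \<Rightarrow> real) \<Rightarrow> bool" where
  "is_sqrt_RN_deriv \<mu> \<nu> g \<longleftrightarrow>
     (\<forall>x. 0 \<le> g x) \<and> (AE x in \<mu>. RN_deriv \<mu> \<nu> x = ennreal ((g x)\<^sup>2))"

definition KL :: "'a measure \<Rightarrow> 'a measure \<Rightarrow> real" where
  "KL \<nu> \<mu> = KL_divergence (exp 1) \<mu> \<nu>"

(* The Fisher information FI(nu || mu), where g is the smooth version of the square root of
   the density of nu with respect to mu. *)
definition fisher_info :: "('a::euclidean_space \<Rightarrow> real) \<Rightarrow> 'a measure \<Rightarrow> real" where
  "fisher_info g \<mu> = 4 * (\<integral>x. (norm (gradient g x))\<^sup>2 \<partial>\<mu>)"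

definition log_Sobolev :: "'a::euclidean_space measure \<Rightarrow> real \<Rightarrow> bool" where
  "log_Sobolev \<mu> C \<longleftrightarrow>
     (\<forall>\<nu> g. prob_space \<nu> \<and> sets \<nu> = sets \<mu> \<and> absolutely_continuous \<mu> \<nu> \<and>
            is_sqrt_RN_deriv \<mu> \<nu> g \<and> smooth g \<and> compactly_supported g
        \<longrightarrow> KL \<nu> \<mu> \<le> C / 2 * fisher_info g \<mu>)"

(* In ereal the infimum of the empty set is \<infinity>. Both constraints below are closed
   conditions on C, so a positive finite infimum is attained and is the least constant. *)
definition C_LS :: "'a::euclidean_space measure \<Rightarrow> ereal" where
  "C_LS \<mu> = (INF C \<in> {C. 0 < C \<and> log_Sobolev \<mu> C}. ereal C)"

definition PL_inequality :: "('a::euclidean_space \<Rightarrow> real) \<Rightarrow> real \<Rightarrow> bool" where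
  "PL_inequality f C \<longleftrightarrow> (\<forall>x. f x - (INF y. f y) \<le> C / 2 * (norm (gradient f x))\<^sup>2)"

definition C_PL :: "('a::euclidean_space \<Rightarrow> real) \<Rightarrow> ereal" where
  "C_PL f = (INF C \<in> {C. 0 < C \<and> PL_inequality f C}. ereal C)"

definition gibbs :: "('a::euclidean_space \<Rightarrow> real) \<Rightarrow> real \<Rightarrow> 'a measure" where
  "gibbs f t = density lborel (\<lambda>x. ennreal (exp (- f x / t) / (\<integral>y. exp (- f y / t) \<partial>lborel)))"

(* Lim carries no information unless the limit exists, so existence has to be stated separately. *)
definition C_bLS :: "('a::euclidean_space \<Rightarrow> real) \<Rightarrow> ereal" where
  "C_bLS f = Lim (at_right 0) (\<lambda>t. C_LS (gibbs f t) / ereal t)"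

end

theory Submission
  imports Defs
begin

text \<open>
  Write $F = f - f_\star$, let $a$ be the minimizer and $C$ a PL constant.

  Upper bound.  PL forces $F(x) \ge \|x-a\|^2/(2C)$, so the Hessian at $a$ is at least $1/C$ and $f$ is
  $k$-strongly convex near $a$ for every $k < 1/C$.  Hence $\mu_t$, weighted by a log-concave cutoff
  $1-\eta^2$ supported near $a$, satisfies a log-Sobolev inequality with constant $t/k$, by the
  Bobkov--Ledoux argument from the Prekopa--Leindler inequality.  Away from $a$, put
  $\psi = v e^{-f/2t}/\sqrt{Z_t}$ for a function $v$ vanishing near $a$; integrating by parts and using
  the bound on $\Delta f$,
  $4t^2\int\|\nabla v\|^2 d\mu_t \ge 4t^2\int\|\nabla\psi\|^2 - 2tL\int\psi^2 + (1-2tL)\int\psi^2\|\nabla f\|^2$,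
  while $\log(1+v^2) \le F/t + \log(1+K\psi^2)$.  The first term is controlled by PL, the second one by
  the Euclidean log-Sobolev inequality, at the price of $O(t\log(1/t))$, which is negligible since
  $\|\nabla f\|$ is bounded below on the support of $v$.  The two estimates are glued by the variational
  formula $\mathrm{Ent}_\mu(g^2) = \inf_c \int (g^2\log(g^2/c) - g^2 + c)\,d\mu$, applied with
  $c = 1 + \int\eta^2(g-1)^2 d\mu_t$ after normalizing $g^2$ to have mean $1$ near $a$: the errors produced
  by the cutoff are integrals of $(g-1)^2$ away from $a$, and these are $O(t^2)\int\|\nabla g\|^2 d\mu_t$.

  Lower bound.  If the PL inequality with constant $c$ fails at $x$, the test function
  $g(y) = \beta((y-x)/\sqrt t)\, e^{\nabla f(x)\cdot(y-x)/2t}$ with a smooth bump $\beta$ has, after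
  normalization, $t\,\mathsf{KL} \to F(x)$ and $t^2\,\mathsf{FI} \to \|\nabla f(x)\|^2$, and so
  violates the log-Sobolev inequality with constant $ct$ for small $t$.
\<close>

section \<open>The Prekopa--Leindler inequality\<close>

text \<open>The limit is sharp, so neither region may lose a constant factor and the gluing may cost
  only o(t) times the Fisher integral. This shapes the upper bound. The weights 1 - eta^2 and eta^2
  add up to 1, so the Fisher integral splits exactly. The inner weight is log-concave, so
  multiplying the strongly log-concave density by it neither worsens the constant nor creates
  boundary terms. Cutoff errors sit where the gradient of f is bounded below, and there the mass of
  v^2 gains a factor t^2 over the Fisher integral, one order better than near the minimizer. The
  outer constant is again C because the Euclidean inequality is used with parameter Ct/2: its Fisher
  term then matches the term with the gradient of psi, just as PL matches the term with the gradient
  of f. In the lower bound the scale sqrt t keeps the second-order remainder of f/t bounded while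
  the tilt cancels its first-order part, so every integral is that of a rescaled bump up to bounded
  factors.\<close>

lemma emeasure_add_le_sumset:
  fixes A B C :: "real set"
  assumes A: "A \<in> sets lborel" "bounded A" "A \<noteq> {}" and B: "B \<in> sets lborel" "bounded B" "B \<noteq> {}"
    and C: "C \<in> sets lborel" and sub: "\<And>a b. a \<in> A \<Longrightarrow> b \<in> B \<Longrightarrow> a + b \<in> C"
  shows "emeasure lborel A + emeasure lborel B \<le> emeasure lborel C"
proof -
  \<comment> \<open>One-dimensional Brunn-Minkowski for compact sets: \<open>K\<close> shifted by
    the least point of \<open>K'\<close> and \<open>K'\<close> shifted by the greatest point of
    \<open>K\<close> both lie in the sumset, and they meet in at most one point.\<close>
  have cpt: "emeasure lborel K + emeasure lborel K' \<le> emeasure lborel C"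
    if K: "compact K" "K \<noteq> {}" "K \<subseteq> A" and K': "compact K'" "K' \<noteq> {}" "K' \<subseteq> B" for K K'
  proof -
    obtain m where m: "m \<in> K'" "\<forall>y\<in>K'. m \<le> y" using compact_attains_inf[OF K'(1,2)] by auto
    obtain n where n: "n \<in> K" "\<forall>y\<in>K. y \<le> n" using compact_attains_sup[OF K(1,2)] by auto
    have c1: "compact ((+) m ` K)" and c2: "compact ((+) n ` K')"
      using K(1) K'(1) compact_translation by auto
    have shift: "emeasure lborel ((+) c ` S) = emeasure lborel S" if "compact S" for c and S :: "real set"
    proof -
      have S: "(+) c ` S \<in> sets borel"
        using compact_translation[OF that, of c] by (auto intro: borel_compact)
      have "emeasure lborel ((+) c ` S) = emeasure (distr lborel borel ((+) c)) ((+) c ` S)"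
        by (simp add: lborel_distr_plus)
      also have "\<dots> = emeasure lborel ((+) c -` (+) c ` S)" using S by (subst emeasure_distr) auto
      also have "(+) c -` (+) c ` S = S" by (simp add: inj_vimage_image_eq)
      finally show ?thesis .
    qed
    have e1: "emeasure lborel ((+) m ` K) = emeasure lborel K"
      and e2: "emeasure lborel ((+) n ` K') = emeasure lborel K'"
      using shift[OF K(1)] shift[OF K'(1)] by auto
    have sets1: "(+) m ` K \<in> sets lborel" "(+) n ` K' \<in> sets lborel"
      using c1 c2 by (auto intro: borel_compact)
    have "(+) m ` K \<inter> (+) n ` K' \<subseteq> {m+n}" using m n by fastforce
    then have z: "(+) m ` K \<inter> (+) n ` K' \<in> null_sets lborel"
      by (metis Int_commute countable_finite countable_imp_null_set_lborel countable_subset finite.emptyI finite.insertI)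
    have "emeasure lborel K + emeasure lborel K' = emeasure lborel ((+) m ` K \<union> (+) n ` K')"
      using emeasure_Un'[OF sets1 z] e1 e2 by simp
    also have "\<dots> \<le> emeasure lborel C"
    proof (intro emeasure_mono C)
      have "m + x \<in> C" if "x \<in> K" for x using sub[of x m] that K K' m by (auto simp: add.commute)
      moreover have "n + x \<in> C" if "x \<in> K'" for x using sub[of n x] that K K' n by auto
      ultimately show "(+) m ` K \<union> (+) n ` K' \<subseteq> C" by auto
    qed
    finally show ?thesis .
  qed
  \<comment> \<open>Inner regularity reduces to compact sets. A point of \<open>S\<close> is added
    to the closed set \<open>T\<close> so that \<open>K\<close> is nonempty and has extremal
    points.\<close>
  have approx: "\<exists>K. compact K \<and> K \<noteq> {} \<and> K \<subseteq> S \<and> emeasure lborel S \<le> emeasure lborel K + ennreal e"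
    if S: "S \<in> sets lborel" "bounded S" "S \<noteq> {}" and e: "0 < e" for S :: "real set" and e :: real
  proof -
    obtain T where T: "closed T" "T \<subseteq> S" "S-T \<in> lmeasurable" "emeasure lebesgue (S - T) < ennreal e"
      using sets_lebesgue_inner_closed[of S e] S e by auto
    obtain a where a: "a \<in> S" using S by auto
    let ?K = "insert a T"
    have 1: "compact ?K" using T S a by (metis bounded_subset closed_insert compact_eq_bounded_closed insert_subset)
    have 2: "?K \<in> sets lborel" using 1 by (auto intro: borel_compact)
    have "emeasure lborel S \<le> emeasure lborel (?K \<union> (S - ?K))"
      using S 2 by (intro emeasure_mono sets.Un sets.Diff) auto
    also have "\<dots> \<le> emeasure lborel ?K + emeasure lborel (S - ?K)"
      using S 2 by (intro emeasure_subadditive) auto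
    also have "emeasure lborel (S - ?K) = emeasure lebesgue (S - ?K)" using S 2 by simp
    also have "\<dots> \<le> emeasure lebesgue (S - T)" using T(3) by (intro emeasure_mono) auto
    finally have "emeasure lborel S \<le> emeasure lborel ?K + ennreal e"
      using T(4) by (meson add_left_mono less_imp_le order_trans)
    then show ?thesis using 1 T a by blast
  qed
  show ?thesis
  proof (rule ennreal_le_epsilon)
    fix e :: real assume "0 < e"
    then obtain K K' where "compact K" "K \<noteq> {}" "K \<subseteq> A" "emeasure lborel A \<le> emeasure lborel K + ennreal (e/2)"
      "compact K'" "K' \<noteq> {}" "K' \<subseteq> B" "emeasure lborel B \<le> emeasure lborel K' + ennreal (e/2)"
      using approx[OF A, of "e/2"] approx[OF B, of "e/2"] by auto
    then have "emeasure lborel A + emeasure lborel B \<le> (emeasure lborel K + ennreal (e/2)) + (emeasure lborel K' + ennreal (e/2))"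
      by (intro add_mono)
    also have "\<dots> = emeasure lborel K + emeasure lborel K' + ennreal e"
      using \<open>0 < e\<close> by (simp add: algebra_simps flip: ennreal_plus)
    also have "\<dots> \<le> emeasure lborel C + ennreal e"
      using cpt \<open>compact K\<close> \<open>K \<noteq> {}\<close> \<open>K \<subseteq> A\<close> \<open>compact K'\<close> \<open>K' \<noteq> {}\<close> \<open>K' \<subseteq> B\<close> by (intro add_mono) auto
    finally show "emeasure lborel A + emeasure lborel B \<le> emeasure lborel C + ennreal e" .
  qed
qed

text \<open>Levels are measured as fractions \<open>l\<close> of the bound \<open>a\<close>. Two
  functions with different suprema can then be compared at the same relative height, over a common
  range of levels.\<close>

lemma nn_integral_layer_cake:
  fixes u :: "real \<Rightarrow> real"
  assumes [measurable]: "u \<in> borel_measurable borel" and u: "\<And>x. 0 \<le> u x" "\<And>x. u x \<le> a" and a: "0 < a"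
  shows "(\<integral>\<^sup>+x. ennreal (u x) \<partial>lborel) = ennreal a * (\<integral>\<^sup>+l. indicator {0<..<1} l * emeasure lborel {x. l * a < u x} \<partial>lborel)"
proof -
  have "ennreal (u x) = ennreal a * (\<integral>\<^sup>+l. indicator {l. 0 < l \<and> l < 1 \<and> l * a < u x} l \<partial>lborel)" for x
  proof -
    have "(\<integral>\<^sup>+l. indicator {l. 0 < l \<and> l < 1 \<and> l * a < u x} l \<partial>lborel) = emeasure lborel {l. 0 < l \<and> l < 1 \<and> l * a < u x}"
      by (subst nn_integral_indicator) auto
    moreover have "{l. 0 < l \<and> l < 1 \<and> l * a < u x} = {0<..<u x / a}"
    proof -
      have "l < 1" if "l < u x / a" for l using that u[of x] a by (smt (verit) divide_le_eq_1_pos)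
      then show ?thesis using a by (auto simp: field_simps)
    qed
    moreover have "emeasure lborel {0<..<u x / a} = ennreal (u x / a)" using u a by simp
    ultimately have *: "(\<integral>\<^sup>+l. indicator {l. 0 < l \<and> l < 1 \<and> l * a < u x} l \<partial>lborel) = ennreal (u x / a)" by simp
    show ?thesis unfolding * using a u by (simp flip: ennreal_mult')
  qed
  then have "(\<integral>\<^sup>+x. ennreal (u x) \<partial>lborel) = ennreal a * (\<integral>\<^sup>+x. (\<integral>\<^sup>+l. indicator {l. 0 < l \<and> l < 1 \<and> l * a < u x} l \<partial>lborel) \<partial>lborel)"
    by (simp add: nn_integral_cmult)
  also have "(\<integral>\<^sup>+x. (\<integral>\<^sup>+l. indicator {l. 0 < l \<and> l < 1 \<and> l * a < u x} l \<partial>lborel) \<partial>lborel)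
     = (\<integral>\<^sup>+l. (\<integral>\<^sup>+x. indicator {l. 0 < l \<and> l < 1 \<and> l * a < u x} l \<partial>lborel) \<partial>lborel)"
    by (rule lborel_pair.Fubini') measurable
  also have "\<dots> = (\<integral>\<^sup>+l. indicator {0<..<1} l * emeasure lborel {x. l * a < u x} \<partial>lborel)"
  proof (intro nn_integral_cong)
    fix l :: real
    have "(\<integral>\<^sup>+x. indicator {l. 0 < l \<and> l < 1 \<and> l * a < u x} l \<partial>lborel) = (\<integral>\<^sup>+x. indicator {0<..<1} l * indicator {x. l * a < u x} x \<partial>lborel)"
      by (intro nn_integral_cong) (auto simp: indicator_def)
    also have "\<dots> = indicator {0<..<1} l * emeasure lborel {x. l * a < u x}"
      by (subst nn_integral_cmult) auto
    finally show "(\<integral>\<^sup>+x. indicator {l. 0 < l \<and> l < 1 \<and> l * a < u x} l \<partial>lborel) = indicator {0<..<1} l * emeasure lborel {x. l * a < u x}" .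
  qed
  finally show ?thesis .
qed

text \<open>\<open>w\<close> may exceed \<open>a\<close> or be infinite. Truncating it at
  \<open>a\<close> keeps all levels below \<open>a\<close> and can only lower the integral.\<close>

lemma nn_integral_layer_cake_le:
  fixes w :: "real \<Rightarrow> ennreal"
  assumes [measurable]: "w \<in> borel_measurable borel" and a: "0 < a"
  shows "ennreal a * (\<integral>\<^sup>+l. indicator {0<..<1} l * emeasure lborel {x. ennreal (l * a) < w x} \<partial>lborel) \<le> (\<integral>\<^sup>+x. w x \<partial>lborel)"
proof -
  define u where "u x = enn2real (min (w x) (ennreal a))" for x
  have [measurable]: "u \<in> borel_measurable borel" unfolding u_def by measurable
  have le: "ennreal (u x) = min (w x) (ennreal a)" for x
    unfolding u_def by (simp add: min_less_iff_disj)
  have ua: "u x \<le> a" for x unfolding u_def using a by (metis enn2real_ennreal enn2real_mono ennreal_less_top less_imp_le min.cobounded2)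
  have eq: "{x. ennreal (l * a) < w x} = {x. l * a < u x}" if "0 < l" "l < 1" for l
  proof -
    have "l * a < u x \<longleftrightarrow> ennreal (l * a) < ennreal (u x)" for x
      using a that by (subst ennreal_less_iff) auto
    then show ?thesis using that a by (auto simp: le ennreal_less_iff)
  qed
  have "ennreal a * (\<integral>\<^sup>+l. indicator {0<..<1} l * emeasure lborel {x. ennreal (l * a) < w x} \<partial>lborel)
    = ennreal a * (\<integral>\<^sup>+l. indicator {0<..<1} l * emeasure lborel {x. l * a < u x} \<partial>lborel)"
    by (intro arg_cong[where f="(*) (ennreal a)"] nn_integral_cong) (auto simp: eq split: split_indicator)
  also have "\<dots> = (\<integral>\<^sup>+x. ennreal (u x) \<partial>lborel)"
    using nn_integral_layer_cake[of u a] ua a by (simp add: u_def)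
  also have "\<dots> \<le> (\<integral>\<^sup>+x. w x \<partial>lborel)" by (intro nn_integral_mono) (simp add: le)
  finally show ?thesis .
qed


lemma weighted_arith_geom:
  fixes a b :: real
  assumes "0 < s" "0 < r" "s + r = 1" "0 \<le> a" "0 \<le> b"
  shows "a powr s * b powr r \<le> s * a + r * b"
  using Youngs_inequality_0[of s r a b] assms by (cases "a = 0 \<or> b = 0") auto

lemma emeasure_lborel_scale_real:
  fixes A :: "real set"
  assumes [measurable]: "A \<in> sets borel" and s: "0 < s"
  shows "emeasure lborel {z. z / s \<in> A} = ennreal s * emeasure lborel A"
proof -
  have [measurable]: "{z. z / s \<in> A} \<in> sets borel" by measurable
  have "emeasure lborel {z. z / s \<in> A} = (\<integral>\<^sup>+z. indicator {z. z / s \<in> A} z \<partial>lborel)" by simp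
  also have "\<dots> = \<bar>s\<bar> * (\<integral>\<^sup>+z. indicator {z. z / s \<in> A} (0 + s * z) \<partial>lborel)"
    using s by (intro nn_integral_real_affine) auto
  also have "(\<integral>\<^sup>+z. indicator {z. z / s \<in> A} (0 + s * z) \<partial>lborel) = (\<integral>\<^sup>+z. indicator A z \<partial>lborel)"
    using s by (intro nn_integral_cong) (auto simp: indicator_def)
  finally show ?thesis using s by simp
qed

lemma nn_integral_bounded_support_finite:
  fixes u :: "real \<Rightarrow> real"
  assumes [measurable]: "u \<in> borel_measurable borel" and u: "\<And>x. u x \<le> K" "\<And>x. R < \<bar>x\<bar> \<Longrightarrow> u x = 0"
  shows "(\<integral>\<^sup>+x. ennreal (u x) \<partial>lborel) < \<infinity>"
proof -
  have "(\<integral>\<^sup>+x. ennreal (u x) \<partial>lborel) \<le> (\<integral>\<^sup>+x. ennreal K * indicator {-R..R} x \<partial>lborel)"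
  proof (intro nn_integral_mono)
    fix x show "ennreal (u x) \<le> ennreal K * indicator {-R..R} x"
      using u[of x] by (cases "R < \<bar>x\<bar>") (auto simp: indicator_def ennreal_leI)
  qed
  also have "\<dots> = ennreal K * emeasure lborel {-R..R}" by (simp add: nn_integral_cmult)
  also have "\<dots> < \<infinity>" by (simp add: ennreal_mult_less_top emeasure_lborel_Icc_eq)
  finally show ?thesis .
qed

text \<open>At relative height \<open>l\<close> in (0,1) both superlevel sets are nonempty, because
  heights are fractions of the suprema \<open>a\<close> and \<open>b\<close>. One-dimensional
  Brunn-Minkowski then bounds the measure of the superlevel set of \<open>w\<close> at height
  \<open>l * k\<close>, with \<open>k = a powr s * b powr r\<close>, from below by the weighted sum
  of the other two measures. Integrating over \<open>l\<close> gives an arithmetic mean, which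
  dominates the geometric mean. Extended values of \<open>w\<close> allow its marginals to be used
  in the induction on the dimension.\<close>

lemma prekopa_leindler_real:
  fixes u v :: "real \<Rightarrow> real" and w :: "real \<Rightarrow> ennreal"
  assumes [measurable]: "u \<in> borel_measurable borel" "v \<in> borel_measurable borel" "w \<in> borel_measurable borel"
    and u: "\<And>x. 0 \<le> u x" "\<And>x. u x \<le> K" "\<And>x. R < \<bar>x\<bar> \<Longrightarrow> u x = 0"
    and v: "\<And>x. 0 \<le> v x" "\<And>x. v x \<le> K" "\<And>x. R < \<bar>x\<bar> \<Longrightarrow> v x = 0"
    and s: "0 < s" "0 < r" "s + r = 1"
    and w: "\<And>x y. ennreal (u x powr s * v y powr r) \<le> w (s * x + r * y)"
  shows "ennreal (enn2real (\<integral>\<^sup>+x. ennreal (u x) \<partial>lborel) powr s * enn2real (\<integral>\<^sup>+x. ennreal (v x) \<partial>lborel) powr r)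
     \<le> (\<integral>\<^sup>+x. w x \<partial>lborel)"
proof -
  define a where "a = (SUP x. u x)"
  define b where "b = (SUP x. v x)"
  have bd: "bdd_above (range u)" "bdd_above (range v)" using u v by (auto intro!: bdd_aboveI2)
  have ua: "u x \<le> a" and vb: "v x \<le> b" for x
    using bd by (auto simp: a_def b_def intro!: cSUP_upper)
  have lta: "\<exists>x. l < u x" if "l < a" for l using that bd(1) by (auto simp: a_def less_cSUP_iff)
  have ltb: "\<exists>x. l < v x" if "l < b" for l using that bd(2) by (auto simp: b_def less_cSUP_iff)
  show ?thesis
  proof (cases "a \<le> 0 \<or> b \<le> 0")
    case True
    then have "(\<forall>x. u x = 0) \<or> (\<forall>x. v x = 0)" using ua vb u(1) v(1) by (meson antisym order_trans)
    then show ?thesis by auto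
  next
    case False
    then have a: "0 < a" and b: "0 < b" by auto
    define k where "k = a powr s * b powr r"
    have k: "0 < k" using a b by (simp add: k_def)
    define mu mv mw where "mu l = emeasure lborel {x. l * a < u x}" and "mv l = emeasure lborel {x. l * b < v x}"
      and "mw l = emeasure lborel {x. ennreal (l * k) < w x}" for l
    have [measurable]: "mu \<in> borel_measurable borel" "mv \<in> borel_measurable borel"
      unfolding mu_def mv_def by measurable
    have ineq: "ennreal s * mu l + ennreal r * mv l \<le> mw l" if l: "0 < l" "l < 1" for l
    proof -
      have nea: "\<exists>x. l * a < u x" using l a by (intro lta) simp
      have neb: "\<exists>x. l * b < v x" using l b by (intro ltb) simp
      let ?A = "{z. z / s \<in> {x. l * a < u x}}" and ?B = "{z. z / r \<in> {x. l * b < v x}}"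
      have "emeasure lborel ?A + emeasure lborel ?B \<le> emeasure lborel {x. ennreal (l * k) < w x}"
      proof (rule emeasure_add_le_sumset)
        show "?A \<in> sets lborel" "?B \<in> sets lborel" "{x. ennreal (l * k) < w x} \<in> sets lborel" by auto
        have ab: "l * a \<ge> 0" "l * b \<ge> 0" using l a b by auto
        have "\<bar>z\<bar> \<le> s * R" if "z \<in> ?A" for z
          using u(3)[of "z / s"] that ab(1) s by (force simp: field_simps abs_if split: if_splits)
        then show "bounded ?A" by (intro boundedI) auto
        have "\<bar>z\<bar> \<le> r * R" if "z \<in> ?B" for z
          using v(3)[of "z / r"] that ab(2) s by (force simp: field_simps abs_if split: if_splits)
        then show "bounded ?B" by (intro boundedI) auto
        obtain x y where "l * a < u x" "l * b < v y" using nea neb by auto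
        then have "s * x \<in> ?A" "r * y \<in> ?B" using s by auto
        then show "?A \<noteq> {}" "?B \<noteq> {}" by blast+
        fix x y assume x: "x \<in> ?A" and y: "y \<in> ?B"
        have lk: "l * k = (l * a) powr s * (l * b) powr r"
        proof -
          have "(l * a) powr s * (l * b) powr r = (l powr s * l powr r) * k"
            using l a b by (simp add: powr_mult k_def)
          also have "l powr s * l powr r = l" using s l by (simp flip: powr_add)
          finally show ?thesis by simp
        qed
        have "(l * a) powr s < u (x / s) powr s" "(l * b) powr r < v (y / r) powr r"
          using x y l a b s by (auto intro!: powr_less_mono2)
        then have "l * k < u (x / s) powr s * v (y / r) powr r"
          unfolding lk by (intro mult_strict_mono) (auto intro: le_less_trans[OF powr_ge_zero])
        then have "ennreal (l * k) < ennreal (u (x / s) powr s * v (y / r) powr r)"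
          using l k by (subst ennreal_less_iff) auto
        also have "\<dots> \<le> w (s * (x / s) + r * (y / r))" by (rule w)
        finally show "x + y \<in> {x. ennreal (l * k) < w x}" using s by simp
      qed
      moreover have "emeasure lborel ?A = ennreal s * emeasure lborel {x. l * a < u x}"
        "emeasure lborel ?B = ennreal r * emeasure lborel {x. l * b < v x}"
        by (rule emeasure_lborel_scale_real; use s in simp)+
      ultimately show ?thesis by (simp add: mu_def mv_def mw_def)
    qed
    define Lu Lv Lw where "Lu = (\<integral>\<^sup>+l. indicator {0<..<1} l * mu l \<partial>lborel)"
      and "Lv = (\<integral>\<^sup>+l. indicator {0<..<1} l * mv l \<partial>lborel)"
      and "Lw = (\<integral>\<^sup>+l. indicator {0<..<1} l * mw l \<partial>lborel)"
    have Iu: "(\<integral>\<^sup>+x. ennreal (u x) \<partial>lborel) = ennreal a * Lu"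
      unfolding Lu_def mu_def by (rule nn_integral_layer_cake) (use u ua a in auto)
    have Iv: "(\<integral>\<^sup>+x. ennreal (v x) \<partial>lborel) = ennreal b * Lv"
      unfolding Lv_def mv_def by (rule nn_integral_layer_cake) (use v vb b in auto)
    have Iw: "ennreal k * Lw \<le> (\<integral>\<^sup>+x. w x \<partial>lborel)"
      unfolding Lw_def mw_def by (rule nn_integral_layer_cake_le) (use k in auto)
    have fin: "ennreal a * Lu < \<infinity>" "ennreal b * Lv < \<infinity>"
      unfolding Iu[symmetric] Iv[symmetric]
      using nn_integral_bounded_support_finite[of u K R] nn_integral_bounded_support_finite[of v K R] u v by auto
    then obtain lu lv where lu: "Lu = ennreal lu" "0 \<le> lu" and lv: "Lv = ennreal lv" "0 \<le> lv"
      using a b by (cases Lu; cases Lv) (auto simp: ennreal_mult_top)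
    have "ennreal s * Lu + ennreal r * Lv = (\<integral>\<^sup>+l. indicator {0<..<1} l * (ennreal s * mu l + ennreal r * mv l) \<partial>lborel)"
      unfolding Lu_def Lv_def
      by (subst (1 2) nn_integral_cmult[symmetric]; (measurable)?) 
         (subst nn_integral_add[symmetric]; (measurable)?; auto simp: algebra_simps intro!: nn_integral_cong)
    also have "\<dots> \<le> Lw"
      unfolding Lw_def using ineq by (intro nn_integral_mono) (auto split: split_indicator)
    finally have L: "ennreal (s * lu + r * lv) \<le> Lw" using lu lv s by (simp add: ennreal_mult)
    have "(a * lu) powr s * (b * lv) powr r = k * (lu powr s * lv powr r)"
      using a b lu lv by (simp add: powr_mult k_def)
    also have "\<dots> \<le> k * (s * lu + r * lv)"
      using k lu lv s by (intro mult_left_mono weighted_arith_geom) auto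
    finally have "ennreal ((a * lu) powr s * (b * lv) powr r) \<le> ennreal k * ennreal (s * lu + r * lv)"
      using k lu lv s by (subst ennreal_mult[symmetric]) (auto intro: ennreal_leI)
    also have "\<dots> \<le> ennreal k * Lw" using L by (intro mult_left_mono) auto
    also note Iw
    finally show ?thesis unfolding Iu Iv using a b lu lv by (simp add: ennreal_mult[symmetric])
  qed
qed

text \<open>Induction on the number of coordinates. For fixed values of the new coordinate the
  induction hypothesis, applied to slices, says that the marginals \<open>u1\<close>,
  \<open>v1\<close>, \<open>w1\<close> satisfy the hypothesis of the one-dimensional inequality, and
  Fubini identifies their integrals. Points of the product space are extensional functions, hence
  the restricted convex combination. Boundedness and bounded support keep the marginals of
  \<open>u\<close> and \<open>v\<close> finite, so that \<open>enn2real\<close> loses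
  nothing.\<close>

lemma prekopa_leindler_PiM:
  fixes u v :: "('i \<Rightarrow> real) \<Rightarrow> real" and w :: "('i \<Rightarrow> real) \<Rightarrow> ennreal"
  assumes "finite I"
    and "u \<in> borel_measurable (\<Pi>\<^sub>M i\<in>I. lborel)" "v \<in> borel_measurable (\<Pi>\<^sub>M i\<in>I. lborel)"
       "w \<in> borel_measurable (\<Pi>\<^sub>M i\<in>I. lborel)"
    and "\<And>x. 0 \<le> u x" "\<And>x. u x \<le> K" "\<And>x i. i \<in> I \<Longrightarrow> R < \<bar>x i\<bar> \<Longrightarrow> u x = 0"
    and "\<And>x. 0 \<le> v x" "\<And>x. v x \<le> K" "\<And>x i. i \<in> I \<Longrightarrow> R < \<bar>x i\<bar> \<Longrightarrow> v x = 0"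
    and s: "0 < s" "0 < r" "s + r = 1"
    and "\<And>x y. x \<in> extensional I \<Longrightarrow> y \<in> extensional I \<Longrightarrow>
       ennreal (u x powr s * v y powr r) \<le> w (\<lambda>i\<in>I. s * x i + r * y i)"
  shows "ennreal (enn2real (\<integral>\<^sup>+x. ennreal (u x) \<partial>(\<Pi>\<^sub>M i\<in>I. lborel)) powr s * enn2real (\<integral>\<^sup>+x. ennreal (v x) \<partial>(\<Pi>\<^sub>M i\<in>I. lborel)) powr r)
     \<le> (\<integral>\<^sup>+x. w x \<partial>(\<Pi>\<^sub>M i\<in>I. lborel))"
  using assms(1-10,14)
proof (induction I arbitrary: u v w rule: finite_induct)
  case empty
  have e: "x \<in> space (\<Pi>\<^sub>M i\<in>{}. lborel) \<longleftrightarrow> x = (\<lambda>i. undefined)" for x :: "'i \<Rightarrow> real" by (simp add: space_PiM)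
  interpret product_sigma_finite "\<lambda>i::'i. lborel::real measure" ..
  show ?case
    using empty.prems by (auto simp: PiM_empty nn_integral_count_space_finite restrict_def)
next
  case (insert i I)
  interpret product_sigma_finite "\<lambda>i::'i. lborel::real measure" ..
  let ?P = "\<Pi>\<^sub>M i\<in>I. (lborel::real measure)"
  note [measurable] = insert.prems(1-3)
  \<comment> \<open>Volume of the box that carries the slices; \<open>ennreal K * B\<close> bounds
    all marginals of \<open>u\<close> and \<open>v\<close>.\<close>
  define B where "B = emeasure ?P (\<Pi>\<^sub>E i\<in>I. {-R..R})"
  have Bfin: "B < \<infinity>"
    unfolding B_def using insert(1) by (subst emeasure_PiM) (auto simp: emeasure_lborel_Icc_eq power_less_top_ennreal)
  have [measurable]: "(\<Pi>\<^sub>E i\<in>I. {-R..R}) \<in> sets ?P" using insert(1) by (auto intro!: sets_PiM_I_finite)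
  have marg: "(\<integral>\<^sup>+x. ennreal (f (x(i:=y))) \<partial>?P) \<le> ennreal K * B"
    if f: "\<And>x. f x \<le> K" "\<And>x j. j \<in> insert i I \<Longrightarrow> R < \<bar>x j\<bar> \<Longrightarrow> f x = 0" for f :: "('i \<Rightarrow> real) \<Rightarrow> real" and y
  proof -
    have "(\<integral>\<^sup>+x. ennreal (f (x(i:=y))) \<partial>?P) \<le> (\<integral>\<^sup>+x. ennreal K * indicator (\<Pi>\<^sub>E i\<in>I. {-R..R}) x \<partial>?P)"
    proof (intro nn_integral_mono)
      fix x assume x: "x \<in> space ?P"
      show "ennreal (f (x(i:=y))) \<le> ennreal K * indicator (\<Pi>\<^sub>E i\<in>I. {-R..R}) x"
      proof (cases "x \<in> (\<Pi>\<^sub>E i\<in>I. {-R..R})")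
        case False
        then obtain j where "j \<in> I" "R < \<bar>x j\<bar>" using x by (auto simp: space_PiM PiE_def Pi_def abs_le_iff not_le) 
        then have "f (x(i:=y)) = 0" using insert(2) by (intro f(2)[of j]) auto
        then show ?thesis by simp
      qed (use f(1) in \<open>auto intro: ennreal_leI\<close>)
    qed
    also have "\<dots> = ennreal K * B" by (simp add: nn_integral_cmult B_def)
    finally show ?thesis .
  qed
  define u1 v1 where "u1 y = enn2real (\<integral>\<^sup>+x. ennreal (u (x(i:=y))) \<partial>?P)"
    and "v1 y = enn2real (\<integral>\<^sup>+x. ennreal (v (x(i:=y))) \<partial>?P)" for y
  define w1 where "w1 y = (\<integral>\<^sup>+x. w (x(i:=y)) \<partial>?P)" for y
  have KB: "ennreal K * B < \<infinity>" using Bfin by (simp add: ennreal_mult_less_top)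
  have eu: "ennreal (u1 y) = (\<integral>\<^sup>+x. ennreal (u (x(i:=y))) \<partial>?P)" 
    and ev: "ennreal (v1 y) = (\<integral>\<^sup>+x. ennreal (v (x(i:=y))) \<partial>?P)" for y
    unfolding u1_def v1_def
    using marg[of u y] marg[of v y] insert.prems KB by (auto intro!: ennreal_enn2real le_less_trans)
  interpret P: sigma_finite_measure ?P using insert(1) by (rule sigma_finite)
  have margm: "(\<lambda>y. \<integral>\<^sup>+x. f (x(i:=y)) \<partial>?P) \<in> borel_measurable borel"
    if f: "f \<in> borel_measurable (\<Pi>\<^sub>M i\<in>insert i I. lborel)" for f :: "('i \<Rightarrow> real) \<Rightarrow> ennreal"
  proof -
    have "(\<lambda>(y, x). (x, y)) \<in> measurable (borel \<Otimes>\<^sub>M ?P) (?P \<Otimes>\<^sub>M (lborel::real measure))" by measurable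
    from measurable_compose[OF measurable_compose[OF this measurable_add_dim[of i I "\<lambda>_. lborel"]] f]
    have "(\<lambda>(y, x). f (x(i:=y))) \<in> borel_measurable (borel \<Otimes>\<^sub>M ?P)" by (simp add: case_prod_beta)
    then show ?thesis by (rule P.borel_measurable_nn_integral)
  qed
  have [measurable]: "(\<lambda>y. \<integral>\<^sup>+x. ennreal (u (x(i:=y))) \<partial>?P) \<in> borel_measurable borel"
    "(\<lambda>y. \<integral>\<^sup>+x. ennreal (v (x(i:=y))) \<partial>?P) \<in> borel_measurable borel"
    "(\<lambda>y. \<integral>\<^sup>+x. w (x(i:=y)) \<partial>?P) \<in> borel_measurable borel"
    by (rule margm; measurable)+
  have m: "u1 \<in> borel_measurable borel" "v1 \<in> borel_measurable borel" "w1 \<in> borel_measurable borel"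
    unfolding u1_def v1_def w1_def by measurable
  have "ennreal (enn2real (\<integral>\<^sup>+y. ennreal (u1 y) \<partial>lborel) powr s * enn2real (\<integral>\<^sup>+y. ennreal (v1 y) \<partial>lborel) powr r)
     \<le> (\<integral>\<^sup>+y. w1 y \<partial>lborel)"
  proof (rule prekopa_leindler_real[where K="enn2real (ennreal K * B)" and R=R, OF m])
    show "0 \<le> u1 y" "0 \<le> v1 y" for y by (auto simp: u1_def v1_def)
    show "u1 y \<le> enn2real (ennreal K * B)" "v1 y \<le> enn2real (ennreal K * B)" for y
      unfolding u1_def v1_def using marg[of u y] marg[of v y] insert.prems KB by (auto intro!: enn2real_mono)
    show "u1 y = 0" if "R < \<bar>y\<bar>" for y
      using insert.prems(6)[of i] that by (simp add: u1_def)
    show "v1 y = 0" if "R < \<bar>y\<bar>" for y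
      using insert.prems(9)[of i] that by (simp add: v1_def)
    fix y z
    show "ennreal (u1 y powr s * v1 z powr r) \<le> w1 (s * y + r * z)"
      unfolding u1_def v1_def w1_def
    proof (rule insert.IH)
      have c: "(\<lambda>x. x(i := y)) \<in> measurable ?P (\<Pi>\<^sub>M i\<in>insert i I. lborel)" for y
      proof -
        have "(\<lambda>x. (x, y)) \<in> measurable ?P (?P \<Otimes>\<^sub>M (lborel::real measure))" by measurable
        from measurable_compose[OF this measurable_add_dim[of i I "\<lambda>_. lborel"]] show ?thesis by simp
      qed
      show "(\<lambda>x. u (x(i := y))) \<in> borel_measurable ?P" "(\<lambda>x. v (x(i := z))) \<in> borel_measurable ?P"
        "(\<lambda>x. w (x(i := s * y + r * z))) \<in> borel_measurable ?P"
        using insert.prems(1-3) by (auto intro: measurable_compose[OF c])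
      fix x x' :: "'i \<Rightarrow> real" assume x: "x \<in> extensional I" "x' \<in> extensional I"
      have "ennreal (u (x(i := y)) powr s * v (x'(i := z)) powr r)
        \<le> w (\<lambda>j\<in>insert i I. s * (x(i := y)) j + r * (x'(i := z)) j)"
        using x by (intro insert.prems) (auto simp: extensional_def)
      also have "(\<lambda>j\<in>insert i I. s * (x(i := y)) j + r * (x'(i := z)) j) = (\<lambda>j\<in>I. s * x j + r * x' j)(i := s * y + r * z)"
        using insert(2) by (auto simp: restrict_def fun_eq_iff)
      finally show "ennreal (u (x(i := y)) powr s * v (x'(i := z)) powr r) \<le> w ((\<lambda>j\<in>I. s * x j + r * x' j)(i := s * y + r * z))" .
    qed (use insert.prems insert(2) in \<open>auto intro: insert.prems(6,9)\<close>)
  qed (use s in auto)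
  then show ?case
    unfolding eu ev w1_def using insert(1,2) by (simp add: product_nn_integral_insert_rev)
qed

lemma prekopa_leindler:
  fixes u v :: "'a::euclidean_space \<Rightarrow> real" and w :: "'a \<Rightarrow> ennreal"
  assumes [measurable]: "u \<in> borel_measurable borel" "v \<in> borel_measurable borel" "w \<in> borel_measurable borel"
    and u: "\<And>x. 0 \<le> u x" "\<And>x. u x \<le> K" "\<And>x. R < norm x \<Longrightarrow> u x = 0"
    and v: "\<And>x. 0 \<le> v x" "\<And>x. v x \<le> K" "\<And>x. R < norm x \<Longrightarrow> v x = 0"
    and s: "0 < s" "0 < r" "s + r = 1"
    and w: "\<And>x y. ennreal (u x powr s * v y powr r) \<le> w (s *\<^sub>R x + r *\<^sub>R y)"
  shows "ennreal ((\<integral>x. u x \<partial>lborel) powr s * (\<integral>x. v x \<partial>lborel) powr r) \<le> (\<integral>\<^sup>+x. w x \<partial>lborel)"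
proof -
  define T :: "('a \<Rightarrow> real) \<Rightarrow> 'a" where "T f = (\<Sum>b\<in>Basis. f b *\<^sub>R b)" for f
  have T[measurable]: "T \<in> measurable (\<Pi>\<^sub>M b\<in>Basis. lborel) borel" unfolding T_def by measurable
  have eq: "(\<integral>\<^sup>+x. f x \<partial>lborel) = (\<integral>\<^sup>+x. f (T x) \<partial>(\<Pi>\<^sub>M b\<in>Basis. lborel))" 
    if "f \<in> borel_measurable borel" for f :: "'a \<Rightarrow> ennreal"
    using that T unfolding T_def by (subst lborel_eq) (simp add: nn_integral_distr)
  have Tb: "T x \<bullet> b = x b" if "b \<in> Basis" for x b
    unfolding T_def using that by simp
  have Tn: "R < norm (T x)" if "b \<in> Basis" "R < \<bar>x b\<bar>" for x b
    using Basis_le_norm[OF that(1), of "T x"] that by (simp add: Tb)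
  have "ennreal (enn2real (\<integral>\<^sup>+x. ennreal (u (T x)) \<partial>(\<Pi>\<^sub>M i\<in>Basis. lborel)) powr s * enn2real (\<integral>\<^sup>+x. ennreal (v (T x)) \<partial>(\<Pi>\<^sub>M i\<in>Basis. lborel)) powr r)
     \<le> (\<integral>\<^sup>+x. w (T x) \<partial>(\<Pi>\<^sub>M i\<in>Basis. lborel))"
  proof (rule prekopa_leindler_PiM[where K=K and R=R])
    fix x y :: "'a \<Rightarrow> real"
    have "T (\<lambda>i\<in>Basis. s * x i + r * y i) = s *\<^sub>R T x + r *\<^sub>R T y"
      by (rule euclidean_eqI) (simp add: Tb inner_add_left)
    then show "ennreal (u (T x) powr s * v (T y) powr r) \<le> w (T (\<lambda>i\<in>Basis. s * x i + r * y i))"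
      using w[of "T x" "T y"] by simp
  qed (use u v s Tn in auto)
  then show ?thesis using u v by (simp add: eq integral_eq_nn_integral)
qed

section \<open>Log-Sobolev inequalities for strongly log-concave weights\<close>

lemma integrable_bounded_support:
  fixes f :: "'a::euclidean_space \<Rightarrow> real"
  assumes [measurable]: "f \<in> borel_measurable borel" and f: "\<And>x. \<bar>f x\<bar> \<le> K" "\<And>x. R < norm x \<Longrightarrow> f x = 0"
  shows "integrable lborel f"
proof (rule integrableI_bounded_set[where A="cball 0 R" and B=K])
  show "emeasure lborel (cball (0::'a) R) < \<infinity>" by (intro emeasure_lborel_cball_finite)
qed (use f in \<open>auto simp: dist_norm\<close>)

text \<open>Mean value inequality for \<open>q\<close> minus the linear function with slope
  \<open>w\<close>. The slope \<open>Q z\<close> gives a first-order Taylor estimate, the slope 0 a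
  Lipschitz estimate.\<close>

lemma GDERIV_mvt_le:
  fixes q :: "'a::euclidean_space \<Rightarrow> real"
  assumes q: "\<And>x. GDERIV q x :> Q x" and B: "\<And>u. u \<in> closed_segment z x \<Longrightarrow> norm (Q u - w) \<le> B"
  shows "\<bar>q x - q z - w \<bullet> (x - z)\<bar> \<le> B * norm (x - z)"
proof -
  have "norm ((q x - w \<bullet> x) - (q z - w \<bullet> z)) \<le> B * norm (x - z)"
  proof (rule differentiable_bound[where S="closed_segment z x" and f'="\<lambda>u h. h \<bullet> Q u - w \<bullet> h"])
    fix u assume u: "u \<in> closed_segment z x"
    have "((\<lambda>u. q u - w \<bullet> u) has_derivative (\<lambda>h. h \<bullet> Q u - w \<bullet> h)) (at u)"
      using q[of u] unfolding gderiv_def by (auto intro!: derivative_eq_intros)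
    then show "((\<lambda>u. q u - w \<bullet> u) has_derivative (\<lambda>h. h \<bullet> Q u - w \<bullet> h)) (at u within closed_segment z x)"
      by (rule has_derivative_at_withinI)
    show "onorm (\<lambda>h. h \<bullet> Q u - w \<bullet> h) \<le> B"
    proof (rule onorm_le)
      fix h
      have "norm (h \<bullet> Q u - w \<bullet> h) = \<bar>(Q u - w) \<bullet> h\<bar>" by (simp add: inner_diff_left inner_diff_right inner_commute)
      also have "\<dots> \<le> norm (Q u - w) * norm h" by (rule Cauchy_Schwarz_ineq2)
      also have "\<dots> \<le> B * norm h" using B[OF u] by (intro mult_right_mono) auto
      finally show "norm (h \<bullet> Q u - w \<bullet> h) \<le> B * norm h" .
    qed
  qed auto
  then show ?thesis by (simp add: inner_diff_right algebra_simps)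
qed

lemma GDERIV_imp_continuous: "(\<And>x. GDERIV q x :> Q x) \<Longrightarrow> continuous_on UNIV (q :: 'a::euclidean_space \<Rightarrow> real)"
  unfolding gderiv_def
  by (intro continuous_at_imp_continuous_on ballI) (blast intro: has_derivative_continuous)

text \<open>If \<open>x\<close> is within \<open>d\<close> of \<open>z\<close>, expanding at
  \<open>z\<close> leaves p D - (1-r) k D^2 / 2 with p = |Q z| + e and D = |x - y|, up to the factor
  r; its maximum over D is the last term. If \<open>x\<close> is farther away, the quadratic
  penalty, which stems from strong log-concavity, outweighs the Lipschitz bound because
  \<open>4 * B * r \<le> k * d\<close>.\<close>

lemma sup_convolution_bound:
  fixes q :: "'a::euclidean_space \<Rightarrow> real" and x y :: 'a
  assumes q: "\<And>x. GDERIV q x :> Q x" and B: "\<And>x. norm (Q x) \<le> B"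
    and d: "0 < d" "\<And>x y. dist x y < d \<Longrightarrow> dist (Q x) (Q y) < e"
    and k: "0 < k" and r: "0 < r" "r \<le> 1/2" "4 * B * r \<le> k * d"
  defines "z \<equiv> (1 - r) *\<^sub>R x + r *\<^sub>R y"
  shows "q x - (1 - r) * r * k / 2 * (norm (x - y))\<^sup>2 \<le> q z + r * ((norm (Q z) + e)\<^sup>2 / (2 * (1 - r) * k))"
proof -
  define D where "D = norm (x - y)"
  have D0: "0 \<le> D" by (simp add: D_def)
  have B0: "0 \<le> B" using B[of 0] norm_ge_zero order_trans by blast
  have s: "1/2 \<le> 1 - r" "0 < 1 - r" using r by auto
  have xz: "x - z = r *\<^sub>R (x - y)" by (simp add: z_def algebra_simps)
  have nxz: "norm (x - z) = r * D" using r by (simp add: xz D_def)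
  have Epos: "0 \<le> r * ((norm (Q z) + e)\<^sup>2 / (2 * (1 - r) * k))" using r k s by auto
  show ?thesis
  proof (cases "r * D < d")
    case True
    have "\<bar>q x - q z - Q z \<bullet> (x - z)\<bar> \<le> e * norm (x - z)"
    proof (rule GDERIV_mvt_le[OF q])
      fix u assume "u \<in> closed_segment z x"
      then have "dist u z \<le> norm (x - z)"
        by (metis dist_commute dist_norm segment_bound1 norm_minus_commute)
      then have "dist u z < d" using True nxz by simp
      then show "norm (Q u - Q z) \<le> e" using d(2)[of u z] by (simp add: dist_norm)
    qed
    then have "q x - q z \<le> Q z \<bullet> (x - z) + e * norm (x - z)" by linarith
    also have "Q z \<bullet> (x - z) \<le> norm (Q z) * norm (x - z)" by (rule norm_cauchy_schwarz)
    finally have 1: "q x - q z \<le> r * ((norm (Q z) + e) * D)" by (simp add: nxz algebra_simps)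
    have "(norm (Q z) + e) * D - (1 - r) * k / 2 * D\<^sup>2 \<le> (norm (Q z) + e)\<^sup>2 / (2 * (1 - r) * k)"
    proof -
      have "0 \<le> ((norm (Q z) + e) - (1 - r) * k * D)\<^sup>2 / (2 * (1 - r) * k)" using k s by auto
      also have "\<dots> = (norm (Q z) + e)\<^sup>2 / (2 * (1 - r) * k) - (norm (Q z) + e) * D + (1 - r) * k / 2 * D\<^sup>2"
        using k s by (simp add: power2_eq_square field_simps)
      finally show ?thesis by linarith
    qed
    from mult_left_mono[OF this, of r] r
    have "r * ((norm (Q z) + e) * D) - (1 - r) * r * k / 2 * D\<^sup>2 \<le> r * ((norm (Q z) + e)\<^sup>2 / (2 * (1 - r) * k))"
      by (simp only: right_diff_distrib mult_ac times_divide_eq_right)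
    with 1 show ?thesis unfolding D_def by linarith
  next
    case False
    have "\<bar>q x - q z - 0 \<bullet> (x - z)\<bar> \<le> B * norm (x - z)"
      by (rule GDERIV_mvt_le[OF q]) (use B in auto)
    then have 1: "q x - q z \<le> B * (r * D)" by (simp add: nxz)
    have "4 * B * r \<le> k * (r * D)" using r(3) False k by (meson mult_left_mono not_less less_imp_le order_trans)
    then have "4 * B \<le> k * D" using r by (simp add: mult.commute mult.left_commute)
    then have "4 * B * D \<le> k * D\<^sup>2" using D0 by (metis mult.assoc mult_right_mono power2_eq_square)
    moreover have "1/2 * (k * D\<^sup>2) \<le> (1 - r) * (k * D\<^sup>2)" using s k by (intro mult_right_mono) auto
    ultimately have "B * D \<le> (1 - r) * k / 2 * D\<^sup>2" by (simp add: algebra_simps)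
    from mult_left_mono[OF this, of r] r
    have "B * (r * D) \<le> (1 - r) * r * k / 2 * D\<^sup>2" by (simp add: mult_ac)
    with 1 Epos show ?thesis unfolding D_def by linarith
  qed
qed

text \<open>Prekopa--Leindler with $u = e^{q/s}\rho$, $v = \rho$ and the sup-convolution of $q$, differentiated at $s = 1$.\<close>

lemma log_Sobolev_log_concave_aux:
  fixes rho q :: "'a::euclidean_space \<Rightarrow> real"
  assumes rho_m[measurable]: "rho \<in> borel_measurable borel"
    and rho: "\<And>x. 0 \<le> rho x" "\<And>x. rho x \<le> K" "\<And>x. R < norm x \<Longrightarrow> rho x = 0"
    and Z: "0 < (\<integral>x. rho x \<partial>lborel)"
    and k: "0 < k"
    and conc: "\<And>x y s r. 0 < s \<Longrightarrow> 0 < r \<Longrightarrow> s + r = 1 \<Longrightarrow>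
       rho x powr s * rho y powr r * exp (s * r * k / 2 * (norm (x - y))\<^sup>2) \<le> rho (s *\<^sub>R x + r *\<^sub>R y)"
    and q: "\<And>x. GDERIV q x :> Q x" and Bq: "\<And>x. \<bar>q x\<bar> \<le> Bq" and B: "\<And>x. norm (Q x) \<le> B"
    and Qm[measurable]: "Q \<in> borel_measurable borel"
    and d: "0 < d" "\<And>x y. dist x y < d \<Longrightarrow> dist (Q x) (Q y) < e" and e: "0 < e"
  defines "N \<equiv> (\<integral>x. exp (q x) * rho x \<partial>lborel)"
  shows "(\<integral>x. q x * exp (q x) * rho x \<partial>lborel) - N * ln (N / (\<integral>x. rho x \<partial>lborel))
    \<le> 1 / (2 * k) * (\<integral>x. (norm (Q x) + e)\<^sup>2 * exp (q x) * rho x \<partial>lborel)"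
proof -
  have [measurable]: "q \<in> borel_measurable borel"
    using GDERIV_imp_continuous[OF q] by (rule borel_measurable_continuous_onI)
  have B0: "0 \<le> B" using B[of 0] norm_ge_zero order_trans by blast
  have Bq0: "0 \<le> Bq" using Bq[of 0] by linarith
  define Zr where "Zr = (\<integral>x. rho x \<partial>lborel)"
  define A where "A = (\<integral>x. q x * exp (q x) * rho x \<partial>lborel)"
  define I where "I = (\<integral>x. (norm (Q x) + e)\<^sup>2 * exp (q x) * rho x \<partial>lborel)"
  have int: "integrable lborel (\<lambda>x. f x * rho x)" if [measurable]: "f \<in> borel_measurable borel" and f: "\<And>x. \<bar>f x\<bar> \<le> C" for f C
  proof (rule integrable_bounded_support[where R=R and K="C * K"])
    fix x
    have "\<bar>f x\<bar> * rho x \<le> C * K" by (intro mult_mono f) (use rho f[of x] in \<open>auto intro: order_trans[OF abs_ge_zero]\<close>)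
    then show "\<bar>f x * rho x\<bar> \<le> C * K" using rho(1)[of x] by (simp add: abs_mult)
  qed (use rho in auto)
  have expq: "exp (c * q x) \<le> exp (c * Bq)" if "0 \<le> c" for c x
    using Bq[of x] that by (auto intro: mult_left_mono)
  have iN: "integrable lborel (\<lambda>x. exp (q x) * rho x)"
    by (rule int[where C="exp Bq"]) (use expq[of 1] in auto)
  have iA: "integrable lborel (\<lambda>x. q x * exp (q x) * rho x)"
    by (rule int[where C="Bq * exp Bq"]) (use expq[of 1] Bq Bq0 in \<open>auto simp: abs_mult intro!: mult_mono\<close>)
  have iI: "integrable lborel (\<lambda>x. (norm (Q x) + e)\<^sup>2 * exp (q x) * rho x)"
    by (rule int[where C="(B + e)\<^sup>2 * exp Bq"]) (use expq[of 1] B e B0 in \<open>auto simp: abs_mult intro!: mult_mono power_mono\<close>)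
  have iZ: "integrable lborel rho" using int[of "\<lambda>_. 1" 1] by simp
  have N: "0 < N"
  proof -
    have "exp (-Bq) * Zr \<le> N"
      unfolding N_def Zr_def integral_mult_right_zero[symmetric]
      using Bq by (intro integral_mono iN) (auto intro!: mult_right_mono rho iZ simp: abs_le_iff minus_le_iff)
    moreover have "0 < exp (-Bq) * Zr" using Z by (simp add: Zr_def)
    ultimately show ?thesis by linarith
  qed
  have Zr: "0 < Zr" using Z by (simp add: Zr_def)
  define Em where "Em = (B + e)\<^sup>2 / k"
  \<comment> \<open>The consequence of Prekopa-Leindler for a fixed \<open>r\<close>, already
    divided by \<open>r\<close>; the claim is its limit as \<open>r\<close> tends to 0.\<close>
  have main: "A - N * ln (N / Zr) \<le> exp (r * Em) / (1 - r) * (1 / (2 * k) * I)"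
    if r: "0 < r" "r \<le> 1/2" "4 * B * r \<le> k * d" for r
  proof -
    define s where "s = 1 - r"
    have s: "0 < s" "s + r = 1" "1/2 \<le> s" using r by (auto simp: s_def)
    define E where "E z = (norm (Q z) + e)\<^sup>2 / (2 * s * k)" for z
    have E: "0 \<le> E z" "E z \<le> Em" for z
    proof -
      show "0 \<le> E z" using s k by (auto simp: E_def)
      have "E z \<le> (B + e)\<^sup>2 / (2 * s * k)" unfolding E_def
        using s k B[of z] e by (intro divide_right_mono power_mono) auto
      also have "\<dots> \<le> Em" unfolding Em_def using s k by (intro divide_left_mono) auto
      finally show "E z \<le> Em" .
    qed
    have [measurable]: "E \<in> borel_measurable borel" unfolding E_def by measurable
    have Em0: "0 \<le> Em" using E order_trans by blast
    \<comment> \<open>The exponential of the bound for the sup-convolution of \<open>q\<close>,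
      times \<open>rho\<close>. It dominates the geometric means of
      \<open>exp (q x / s) * rho x\<close> and \<open>rho y\<close>.\<close>
    define w where "w z = exp (q z + r * E z) * rho z" for z
    have w0: "0 \<le> w z" for z by (simp add: w_def rho)
    have iw: "integrable lborel w" unfolding w_def
      by (rule int[where C="exp (Bq + r * Em)"]) (use E r Bq in \<open>auto intro!: add_mono mult_left_mono simp: abs_le_iff\<close>)
    define U where "U = (\<integral>x. exp (q x / s) * rho x \<partial>lborel)"
    have iU: "integrable lborel (\<lambda>x. exp (q x / s) * rho x)"
      by (rule int[where C="exp (1/s * Bq)"]) (use expq[of "1/s"] s in auto)
    have "ennreal (U powr s * Zr powr r) \<le> (\<integral>\<^sup>+z. ennreal (w z) \<partial>lborel)"
      unfolding U_def Zr_def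
    proof (rule prekopa_leindler[where K="max K (exp (1/s * Bq) * K)" and R=R])
      show "exp (q x / s) * rho x \<le> max K (exp (1 / s * Bq) * K)" for x
        using expq[of "1/s" x] s rho by (intro max.coboundedI2 mult_mono) auto
      fix x y :: 'a
      let ?z = "s *\<^sub>R x + r *\<^sub>R y"
      have sc: "q x - s * r * k / 2 * (norm (x - y))\<^sup>2 \<le> q ?z + r * E ?z"
        unfolding s_def E_def by (rule sup_convolution_bound[OF q B d k r])
      have "(exp (q x / s) * rho x) powr s * rho y powr r = exp (q x) * (rho x powr s * rho y powr r)"
        using rho s by (simp add: powr_mult powr_def[of "exp _"])
      also have "\<dots> = exp (q x - s * r * k / 2 * (norm (x - y))\<^sup>2) * (rho x powr s * rho y powr r * exp (s * r * k / 2 * (norm (x - y))\<^sup>2))"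
        by (simp add: exp_diff)
      also have "\<dots> \<le> exp (q ?z + r * E ?z) * rho ?z"
        using sc conc[OF s(1) r(1) s(2)] rho by (intro mult_mono) auto
      finally show "ennreal ((exp (q x / s) * rho x) powr s * rho y powr r) \<le> ennreal (w ?z)"
        unfolding w_def by (rule ennreal_leI)
    qed (use rho s r in \<open>auto simp: w_def intro: max.coboundedI1\<close>)
    also have "\<dots> = ennreal (\<integral>z. w z \<partial>lborel)" by (rule nn_integral_eq_integral[OF iw]) (simp add: w0)
    finally have PL: "U powr s * Zr powr r \<le> (\<integral>z. w z \<partial>lborel)"
      by (subst (asm) ennreal_le_iff) (auto intro: integral_nonneg_AE w0)
    \<comment> \<open>\<open>m\<close> is the mean of \<open>r / s * q\<close> under the probability
      density proportional to \<open>exp q * rho\<close>. Integrating the tangent of exp at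
      \<open>m\<close> is Jensen's inequality for \<open>U\<close>; note 1/s = 1 + r/s.\<close>
    define m where "m = r / s * (A / N)"
    have UJ: "exp m * N \<le> U"
    proof -
      have "exp m * N = exp m * ((1 - m) * N + r / s * A)" using N s by (simp add: m_def field_simps)
      also have "\<dots> = (\<integral>x. exp m * ((1 - m) * (exp (q x) * rho x) + r / s * (q x * exp (q x) * rho x)) \<partial>lborel)"
        unfolding N_def A_def using iN iA by (simp add: N_def[symmetric] A_def[symmetric] del: distrib_left_numeral) 
      also have "\<dots> \<le> U" unfolding U_def
      proof (intro integral_mono iU)
        fix x
        have "exp (q x / s) = exp m * exp (r / s * q x - m) * exp (q x)"
        proof -
          have "q x / s = m + (r / s * q x - m) + q x"
            using s by (simp add: s_def field_simps)
          then show ?thesis by (simp only: exp_add)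
        qed
        moreover have "1 + (r / s * q x - m) \<le> exp (r / s * q x - m)" by (rule exp_ge_add_one_self)
        ultimately have "exp m * (1 + (r / s * q x - m)) * exp (q x) \<le> exp (q x / s)"
          by (simp add: mult_left_mono mult_right_mono)
        from mult_right_mono[OF this rho(1)[of x]]
        show "exp m * ((1 - m) * (exp (q x) * rho x) + r / s * (q x * exp (q x) * rho x)) \<le> exp (q x / s) * rho x"
          by (simp add: algebra_simps)
      qed (use iN iA in auto)
      finally show ?thesis .
    qed
    have U: "0 < U" using UJ N by (smt (verit) exp_gt_zero mult_pos_pos)
    define W where "W = (\<integral>z. w z \<partial>lborel)"
    have W: "0 < W" using PL U Zr unfolding W_def by (smt (verit) mult_pos_pos powr_gt_zero)
    have "s * ln U + r * ln Zr = ln (U powr s * Zr powr r)" using U Zr by (simp add: ln_mult ln_powr)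
    also have "\<dots> \<le> ln W" using PL U Zr W unfolding W_def by (subst ln_le_cancel_iff) auto
    also have "\<dots> = ln N + ln (W / N)" using W N by (simp add: ln_div)
    also have "\<dots> \<le> ln N + (W / N - 1)" using W N by (intro add_left_mono ln_le_minus_one) auto
    finally have 1: "s * ln U + r * ln Zr \<le> ln N + (W / N - 1)" .
    have "m + ln N = ln (exp m * N)" using N by (simp add: ln_mult)
    also have "\<dots> \<le> ln U" using UJ U N by (subst ln_le_cancel_iff) auto
    finally have "s * (m + ln N) \<le> s * ln U" using s by (intro mult_left_mono) auto
    then have "r * (A / N) + s * ln N \<le> s * ln U" using s by (simp add: m_def algebra_simps)
    with 1 have "r * (A / N) + s * ln N + r * ln Zr \<le> ln N + (W / N - 1)" by linarith
    then have "r * (A / N - ln (N / Zr)) \<le> W / N - 1"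
      using s N Zr by (simp add: s_def ln_div algebra_simps)
    then have "N * (r * (A / N - ln (N / Zr))) \<le> N * (W / N - 1)" using N by (intro mult_left_mono) auto
    then have 2: "r * (A - N * ln (N / Zr)) \<le> W - N" using N by (simp add: algebra_simps)
    have "W - N = (\<integral>x. w x - exp (q x) * rho x \<partial>lborel)" unfolding W_def N_def using iw iN by simp
    also have "\<dots> \<le> (\<integral>x. r * exp (r * Em) / (2 * s * k) * ((norm (Q x) + e)\<^sup>2 * exp (q x) * rho x) \<partial>lborel)"
    proof (intro integral_mono)
      fix x
      have "1 + (- (r * E x)) \<le> exp (- (r * E x))" by (rule exp_ge_add_one_self)
      from mult_left_mono[OF this, of "exp (r * E x)"]
      have "exp (r * E x) - 1 \<le> r * E x * exp (r * E x)" by (simp add: algebra_simps exp_minus)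
      also have "\<dots> \<le> r * E x * exp (r * Em)" using E r by (auto intro!: mult_left_mono)
      finally have "(exp (r * E x) - 1) * (exp (q x) * rho x) \<le> (r * E x * exp (r * Em)) * (exp (q x) * rho x)"
        using rho by (intro mult_right_mono) auto
      then show "w x - exp (q x) * rho x \<le> r * exp (r * Em) / (2 * s * k) * ((norm (Q x) + e)\<^sup>2 * exp (q x) * rho x)"
        by (simp add: w_def E_def exp_add algebra_simps)
    qed (use iw iN iI in auto)
    also have "\<dots> = r * exp (r * Em) / (2 * s * k) * I" by (simp add: I_def)
    finally have "r * (A - N * ln (N / Zr)) \<le> r * (exp (r * Em) / (2 * s * k) * I)" using 2 by simp
    then have "A - N * ln (N / Zr) \<le> exp (r * Em) / (2 * s * k) * I" using r(1) by (rule mult_left_le_imp_le)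
    then show ?thesis by (simp add: s_def mult_ac)
  qed
  have "A - N * ln (N / Zr) \<le> exp (0 * Em) / (1 - 0) * (1 / (2 * k) * I)"
  proof (rule tendsto_lowerbound)
    show "((\<lambda>r. exp (r * Em) / (1 - r) * (1 / (2 * k) * I)) \<longlongrightarrow> exp (0 * Em) / (1 - 0) * (1 / (2 * k) * I)) (at_right 0)"
      using k by (auto intro!: tendsto_eq_intros)
    \<comment> \<open>The 1 in the denominator covers \<open>B = 0\<close>.\<close>
    define r0 where "r0 = min (1/2) (k * d / (4 * B + 1))"
    have r0: "0 < r0" using k d B0 by (auto simp: r0_def)
    have "A - N * ln (N / Zr) \<le> exp (r * Em) / (1 - r) * (1 / (2 * k) * I)" if "0 < r" "r < r0" for r
    proof (rule main)
      have "4 * B * r \<le> (4 * B + 1) * (k * d / (4 * B + 1))"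
        using that B0 by (intro mult_mono) (auto simp: r0_def)
      then show "4 * B * r \<le> k * d" using B0 by simp
    qed (use that in \<open>auto simp: r0_def\<close>)
    then show "\<forall>\<^sub>F r in at_right 0. A - N * ln (N / Zr) \<le> exp (r * Em) / (1 - r) * (1 / (2 * k) * I)"
      using r0 unfolding eventually_at_right_field by blast
  qed simp
  then show ?thesis by (simp add: A_def I_def Zr_def)
qed

text \<open>Uniform continuity of the gradient supplies a modulus \<open>d\<close> for every slack
  \<open>e\<close>. For \<open>e \<le> 1\<close> the slack costs at most
  \<open>e * (2 * B + 1)\<close> in the squared gradient, so it can be sent to 0.\<close>

lemma log_Sobolev_log_concave:
  fixes rho q :: "'a::euclidean_space \<Rightarrow> real"
  assumes rho_m[measurable]: "rho \<in> borel_measurable borel"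
    and rho: "\<And>x. 0 \<le> rho x" "\<And>x. rho x \<le> K" "\<And>x. R < norm x \<Longrightarrow> rho x = 0"
    and Z: "0 < (\<integral>x. rho x \<partial>lborel)"
    and k: "0 < k"
    and conc: "\<And>x y s r. 0 < s \<Longrightarrow> 0 < r \<Longrightarrow> s + r = 1 \<Longrightarrow>
       rho x powr s * rho y powr r * exp (s * r * k / 2 * (norm (x - y))\<^sup>2) \<le> rho (s *\<^sub>R x + r *\<^sub>R y)"
    and q: "\<And>x. GDERIV q x :> Q x" and Bq: "\<And>x. \<bar>q x\<bar> \<le> Bq" and B: "\<And>x. norm (Q x) \<le> B"
    and Q: "uniformly_continuous_on UNIV Q"
  defines "N \<equiv> (\<integral>x. exp (q x) * rho x \<partial>lborel)"
  shows "(\<integral>x. q x * exp (q x) * rho x \<partial>lborel) - N * ln (N / (\<integral>x. rho x \<partial>lborel))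
    \<le> 1 / (2 * k) * (\<integral>x. (norm (Q x))\<^sup>2 * exp (q x) * rho x \<partial>lborel)"
proof (rule field_le_epsilon)
  have Qm[measurable]: "Q \<in> borel_measurable borel"
    using uniformly_continuous_imp_continuous[OF Q] by (rule borel_measurable_continuous_onI)
  have [measurable]: "q \<in> borel_measurable borel"
    using GDERIV_imp_continuous[OF q] by (rule borel_measurable_continuous_onI)
  have B0: "0 \<le> B" using B[of 0] norm_ge_zero order_trans by blast
  define I where "I = (\<integral>x. (norm (Q x))\<^sup>2 * exp (q x) * rho x \<partial>lborel)"
  let ?L = "(\<integral>x. q x * exp (q x) * rho x \<partial>lborel) - N * ln (N / (\<integral>x. rho x \<partial>lborel))"
  have ie: "exp (q x) * rho x \<le> exp Bq * K" for x
    using Bq[of x] rho[of x] by (intro mult_mono) auto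
  have iN: "integrable lborel (\<lambda>x. exp (q x) * rho x)"
    by (rule integrable_bounded_support[where R=R and K="exp Bq * K"]) (use rho ie in auto)
  have iI: "integrable lborel (\<lambda>x. (norm (Q x))\<^sup>2 * exp (q x) * rho x)"
  proof (rule integrable_bounded_support[where R=R and K="B\<^sup>2 * (exp Bq * K)"])
    show "\<bar>(norm (Q x))\<^sup>2 * exp (q x) * rho x\<bar> \<le> B\<^sup>2 * (exp Bq * K)" for x
      using mult_mono[OF power_mono[OF B[of x], of 2] ie[of x]] rho(1)[of x] by (simp add: abs_mult mult.assoc)
  qed (use rho in auto)
  have N0: "0 \<le> N" unfolding N_def by (intro integral_nonneg_AE) (simp add: rho)
  have step: "?L \<le> 1 / (2 * k) * I + e * (1 / (2 * k) * (2 * B + 1) * N)" if e: "0 < e" "e \<le> 1" for e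
  proof -
    obtain d where d: "0 < d" "\<And>x y. dist x y < d \<Longrightarrow> dist (Q x) (Q y) < e"
      using Q e unfolding uniformly_continuous_on_def by (metis UNIV_I dist_commute)
    have h1: "?L \<le> 1 / (2 * k) * (\<integral>x. (norm (Q x) + e)\<^sup>2 * exp (q x) * rho x \<partial>lborel)"
      unfolding N_def
      by (rule log_Sobolev_log_concave_aux[OF rho_m rho Z k conc q Bq B Qm d e(1)])
    have "(\<integral>x. (norm (Q x) + e)\<^sup>2 * exp (q x) * rho x \<partial>lborel)
      \<le> (\<integral>x. (norm (Q x))\<^sup>2 * exp (q x) * rho x + e * (2 * B + 1) * (exp (q x) * rho x) \<partial>lborel)"
    proof (rule integral_mono')
      fix x
      have "(norm (Q x) + e)\<^sup>2 \<le> (norm (Q x))\<^sup>2 + e * (2 * B + 1)"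
      proof -
        have "e * (2 * norm (Q x) + e) \<le> e * (2 * B + 1)" using e B[of x] by (intro mult_left_mono) auto
        then show ?thesis by (simp add: power2_eq_square algebra_simps)
      qed
      from mult_right_mono[OF this, of "exp (q x) * rho x"]
      show "(norm (Q x) + e)\<^sup>2 * exp (q x) * rho x \<le> (norm (Q x))\<^sup>2 * exp (q x) * rho x + e * (2 * B + 1) * (exp (q x) * rho x)"
        using rho(1)[of x] by (simp add: algebra_simps)
    qed (use iN iI rho e B0 in auto)
    also have "\<dots> = I + e * (2 * B + 1) * N" using iN iI by (simp add: I_def N_def)
    finally have "1 / (2 * k) * (\<integral>x. (norm (Q x) + e)\<^sup>2 * exp (q x) * rho x \<partial>lborel) \<le> 1 / (2 * k) * (I + e * (2 * B + 1) * N)"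
      using k by (intro mult_left_mono) auto
    also have "\<dots> = 1 / (2 * k) * I + e * (1 / (2 * k) * (2 * B + 1) * N)" by (simp add: ring_distribs add_divide_distrib)
    finally show ?thesis using h1 by linarith
  qed
  fix e :: real assume e: "0 < e"
  define c where "c = 1 / (2 * k) * (2 * B + 1) * N"
  have c0: "0 \<le> c" using k B0 N0 by (auto simp: c_def)
  define e' where "e' = min 1 (e / (c + 1))"
  have e': "0 < e'" "e' \<le> 1" using e c0 by (auto simp: e'_def)
  have "e' * c \<le> e / (c + 1) * (c + 1)" using e c0 by (intro mult_mono) (auto simp: e'_def)
  then have "e' * c \<le> e" using c0 by simp
  then show "?L \<le> 1 / (2 * k) * (\<integral>x. (norm (Q x))\<^sup>2 * exp (q x) * rho x \<partial>lborel) + e"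
    using step[OF e'] by (simp add: c_def I_def)
qed

section \<open>Functions of class $C^1$ and $C^2$\<close>

text \<open>The gradient is an explicit argument instead of \<open>gradient f\<close>, so that the
  rules below compute it for sums, products and compositions without touching a definite
  description.\<close>

definition C1_gradient :: "('a::euclidean_space \<Rightarrow> real) \<Rightarrow> ('a \<Rightarrow> 'a) \<Rightarrow> bool" where
  "C1_gradient f G \<longleftrightarrow> (\<forall>x. GDERIV f x :> G x) \<and> continuous_on UNIV G"

lemma C1_gradientD:
  assumes "C1_gradient f G"
  shows "GDERIV f x :> G x" "continuous_on UNIV G" "continuous_on UNIV f"
  using assms GDERIV_imp_continuous[of f G] by (auto simp: C1_gradient_def)

lemma C1_gradient_measurable:
  assumes "C1_gradient f G"
  shows "f \<in> borel_measurable borel" "G \<in> borel_measurable borel"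
  using C1_gradientD[OF assms] by (auto intro: borel_measurable_continuous_onI)

lemma C1_gradient_const: "C1_gradient (\<lambda>x. c) (\<lambda>x. 0)"
  by (auto simp: C1_gradient_def intro: GDERIV_const)

lemma C1_gradient_add:
  "C1_gradient f F \<Longrightarrow> C1_gradient g G \<Longrightarrow> C1_gradient (\<lambda>x. f x + g x) (\<lambda>x. F x + G x)"
  by (auto simp: C1_gradient_def intro!: GDERIV_add continuous_intros)

lemma C1_gradient_mult:
  "C1_gradient f F \<Longrightarrow> C1_gradient g G \<Longrightarrow> C1_gradient (\<lambda>x. f x * g x) (\<lambda>x. f x *\<^sub>R G x + g x *\<^sub>R F x)"
  using C1_gradientD(3)[of f F] C1_gradientD(3)[of g G]
  by (auto simp: C1_gradient_def intro!: GDERIV_mult continuous_intros)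

lemma C1_gradient_compose:
  assumes "C1_gradient f F" and h: "\<And>x. (h has_real_derivative h' (f x)) (at (f x))" and c: "continuous_on (range f) h'"
  shows "C1_gradient (\<lambda>x. h (f x)) (\<lambda>x. h' (f x) *\<^sub>R F x)"
proof -
  have "continuous_on UNIV (\<lambda>x. h' (f x))"
    using continuous_on_compose2[OF c C1_gradientD(3)[OF assms(1)]] by auto
  then show ?thesis
    using assms(1) h by (auto simp: C1_gradient_def intro!: GDERIV_DERIV_compose[where g=h] continuous_intros)
qed

lemma GDERIV_unique: "GDERIV f x :> D \<Longrightarrow> GDERIV f x :> E \<Longrightarrow> D = E" for D E :: "'a::euclidean_space"
  unfolding gderiv_def by (drule (1) has_derivative_unique) (metis inner_commute vector_eq_ldot)

lemma gradient_eq: "GDERIV f x :> D \<Longrightarrow> gradient f x = D" for D :: "'a::euclidean_space"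
  unfolding gradient_def by (rule the_equality) (auto intro: GDERIV_unique)

lemma partial_deriv_eq: "GDERIV f x :> D \<Longrightarrow> partial_deriv b f x = b \<bullet> D" for D :: "'a::euclidean_space"
  unfolding gderiv_def partial_deriv_def using frechet_derivative_at by metis

lemma differentiable_GDERIV:
  fixes g :: "'a::euclidean_space \<Rightarrow> real"
  assumes "g differentiable (at x)"
  shows "GDERIV g x :> (\<Sum>b\<in>Basis. partial_deriv b g x *\<^sub>R b)"
proof -
  have d: "(g has_derivative frechet_derivative g (at x)) (at x)"
    using assms frechet_derivative_works by blast
  then interpret bounded_linear "frechet_derivative g (at x)" by (rule has_derivative_bounded_linear)
  have "frechet_derivative g (at x) h = h \<bullet> (\<Sum>b\<in>Basis. partial_deriv b g x *\<^sub>R b)" for h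
  proof -
    have "frechet_derivative g (at x) h = frechet_derivative g (at x) (\<Sum>b\<in>Basis. (h \<bullet> b) *\<^sub>R b)"
      by (simp add: euclidean_representation)
    also have "\<dots> = (\<Sum>b\<in>Basis. (h \<bullet> b) * partial_deriv b g x)"
      by (simp add: sum scaleR partial_deriv_def)
    finally show ?thesis by (simp add: inner_sum_right mult.commute)
  qed
  then have "frechet_derivative g (at x) = (\<lambda>h. h \<bullet> (\<Sum>b\<in>Basis. partial_deriv b g x *\<^sub>R b))" by blast
  with d show ?thesis by (simp add: gderiv_def)
qed

lemma C_k_Suc_0_gradient:
  assumes "C_k (Suc 0) g"
  shows "C1_gradient g (gradient g)"
proof -
  have G: "GDERIV g x :> (\<Sum>b\<in>Basis. partial_deriv b g x *\<^sub>R b)" for x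
    using assms by (intro differentiable_GDERIV) auto
  then have "gradient g = (\<lambda>x. \<Sum>b\<in>Basis. partial_deriv b g x *\<^sub>R b)" using gradient_eq by blast
  moreover have "continuous_on UNIV (\<lambda>x. \<Sum>b\<in>Basis. partial_deriv b g x *\<^sub>R b)"
    using assms by (intro continuous_intros) auto
  ultimately show ?thesis using G by (simp add: C1_gradient_def)
qed

lemma C_k_Suc_imp: "C_k (Suc k) g \<Longrightarrow> C_k k g"
proof (induction k arbitrary: g)
  case 0
  then show ?case by (auto simp: continuous_on_eq_continuous_at differentiable_imp_continuous_within)
qed simp

lemma C_k_2_gradient:
  assumes "C_k 2 f"
  shows "C1_gradient f (gradient f)"
    and "b \<in> Basis \<Longrightarrow> C1_gradient (partial_deriv b f) (gradient (partial_deriv b f))"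
    and "gradient f x = (\<Sum>b\<in>Basis. partial_deriv b f x *\<^sub>R b)"
    and "laplacian f x = (\<Sum>b\<in>Basis. b \<bullet> gradient (partial_deriv b f) x)"
proof -
  have 2: "C_k (Suc (Suc 0)) f" using assms by (simp add: numeral_2_eq_2)
  show "C1_gradient f (gradient f)" using C_k_Suc_imp[OF 2] by (rule C_k_Suc_0_gradient)
  show g2: "C1_gradient (partial_deriv b f) (gradient (partial_deriv b f))" if "b \<in> Basis" for b
    using 2 that by (intro C_k_Suc_0_gradient) auto
  show "gradient f x = (\<Sum>b\<in>Basis. partial_deriv b f x *\<^sub>R b)"
    using 2 by (intro gradient_eq differentiable_GDERIV) auto
  show "laplacian f x = (\<Sum>b\<in>Basis. b \<bullet> gradient (partial_deriv b f) x)"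
    unfolding laplacian_def using C1_gradientD(1)[OF g2] by (intro sum.cong refl partial_deriv_eq) auto
qed

lemma C1_gradient_zero_outside:
  assumes "C1_gradient w W" and w: "\<And>x. R < norm x \<Longrightarrow> w x = c" and x: "R < norm x"
  shows "W x = 0"
proof -
  have "open {x::'a. R < norm x}" by (intro open_Collect_less continuous_intros)
  moreover have "(w has_derivative (\<lambda>h. h \<bullet> W x)) (at x)" using C1_gradientD(1)[OF assms(1)] unfolding gderiv_def .
  ultimately have "((\<lambda>_. c) has_derivative (\<lambda>h. h \<bullet> W x)) (at x)"
    using has_derivative_transform_within_open[of w _ x UNIV "{x. R < norm x}" "\<lambda>_. c"] w x by auto
  then have "GDERIV (\<lambda>_. c) x :> W x" by (simp add: gderiv_def)
  then show ?thesis using GDERIV_const GDERIV_unique by blast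
qed

lemma continuous_bounded_support_bound:
  fixes W :: "'a::euclidean_space \<Rightarrow> 'b::real_normed_vector"
  assumes "continuous_on UNIV W" "\<And>x. R < norm x \<Longrightarrow> W x = 0"
  obtains B where "0 \<le> B" "\<And>x. norm (W x) \<le> B"
proof -
  have "bounded (W ` cball 0 R)"
    using assms(1) by (intro compact_imp_bounded compact_continuous_image) (auto intro: continuous_on_subset)
  then obtain B where B: "\<And>x. norm x \<le> R \<Longrightarrow> norm (W x) \<le> B" unfolding bounded_iff by (metis imageI mem_cball_0)
  have "norm (W x) \<le> max B 0" for x using B[of x] assms(2)[of x] by (cases "norm x \<le> R") auto
  then show ?thesis by (intro that[of "max B 0"]) auto
qed

lemma continuous_bounded_support_integrable:
  fixes w :: "'a::euclidean_space \<Rightarrow> real"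
  assumes "continuous_on UNIV w" "\<And>x. R < norm x \<Longrightarrow> w x = 0"
  shows "integrable lborel w"
  using continuous_bounded_support_bound[OF assms]
  by (metis assms borel_measurable_continuous_onI integrable_bounded_support real_norm_def)

lemma DERIV_along_segment:
  fixes f :: "'a::euclidean_space \<Rightarrow> real"
  assumes "\<And>x. GDERIV f x :> G x"
  shows "((\<lambda>t. f (z + t *\<^sub>R u)) has_real_derivative (u \<bullet> G (z + t *\<^sub>R u))) (at t)"
proof -
  have "((\<lambda>t. f (z + t *\<^sub>R u)) has_derivative (\<lambda>h. (h *\<^sub>R u) \<bullet> G (z + t *\<^sub>R u))) (at t)"
    using assms[of "z + t *\<^sub>R u"] unfolding gderiv_def
    by (intro has_derivative_compose[where g=f and f="\<lambda>t. z + t *\<^sub>R u"]) (auto intro!: derivative_eq_intros)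
  then show ?thesis by (simp add: has_field_derivative_def mult.commute[of _ "u \<bullet> _"])
qed

text \<open>By translation invariance of Lebesgue measure every difference quotient of
  \<open>w\<close> has integral 0. The mean value bound and the bounded support dominate the
  quotients in the limit.\<close>

lemma integral_directional_derivative_zero:
  fixes w :: "'a::euclidean_space \<Rightarrow> real"
  assumes w: "C1_gradient w W" and R: "\<And>x. R < norm x \<Longrightarrow> w x = 0"
  shows "(\<integral>x. b \<bullet> W x \<partial>lborel) = 0"
proof -
  note C = C1_gradientD[OF w]
  have [measurable]: "w \<in> borel_measurable borel" "W \<in> borel_measurable borel"
    using C1_gradient_measurable[OF w] by auto
  have RW: "\<And>x. R < norm x \<Longrightarrow> W x = 0" using C1_gradient_zero_outside[OF w R] .
  obtain B where B: "0 \<le> B" "\<And>x. norm (W x) \<le> B" using continuous_bounded_support_bound[OF C(2) RW] by blast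
  define D where "D n x = (w (x + (1 / real (Suc n)) *\<^sub>R b) - w x) * real (Suc n)" for n x
  have int: "integrable lborel w" using C(3) R by (rule continuous_bounded_support_integrable)
  have intsh: "integrable lborel (\<lambda>x. w (x + c))" "(\<integral>x. w (x + c) \<partial>lborel) = (\<integral>x. w x \<partial>lborel)" for c
  proof -
    have m: "(+) c \<in> borel \<rightarrow>\<^sub>M borel" by measurable
    show "integrable lborel (\<lambda>x. w (x + c))"
      using int integrable_distr_eq[of "(+) c" lborel borel w] by (simp add: lborel_distr_plus add.commute)
    show "(\<integral>x. w (x + c) \<partial>lborel) = (\<integral>x. w x \<partial>lborel)"
      using integral_distr[of "(+) c" lborel borel w] by (simp add: lborel_distr_plus add.commute)
  qed
  have D0: "(\<integral>x. D n x \<partial>lborel) = 0" for n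
    unfolding D_def using int intsh by simp
  have "(\<lambda>n. \<integral>x. D n x \<partial>lborel) \<longlonglongrightarrow> (\<integral>x. b \<bullet> W x \<partial>lborel)"
  proof (rule integral_dominated_convergence[where w="\<lambda>x. indicator (cball 0 (R + norm b)) x * (B * norm b)"])
    show "integrable lborel (\<lambda>x::'a. indicator (cball 0 (R + norm b)) x * (B * norm b) :: real)"
      using emeasure_lborel_cball_finite[of "0::'a" "R + norm b"]
      by (intro integrable_mult_left integrable_real_indicator) auto
    show "AE x in lborel. (\<lambda>n. D n x) \<longlonglongrightarrow> b \<bullet> W x"
    proof (rule AE_I2)
      fix x
      have "((\<lambda>t. w (x + t *\<^sub>R b)) has_real_derivative (b \<bullet> W x)) (at 0)"
        using DERIV_along_segment[OF C(1), of x b 0] by simp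
      then have "((\<lambda>h. (w (x + h *\<^sub>R b) - w x) / h) \<longlongrightarrow> b \<bullet> W x) (at 0)"
        by (simp add: DERIV_def)
      moreover have "filterlim (\<lambda>n. 1 / real (Suc n)) (at 0) sequentially"
        by (rule filterlim_atI) (use LIMSEQ_Suc[OF lim_1_over_n] in auto)
      ultimately have "(\<lambda>n. (w (x + (1 / real (Suc n)) *\<^sub>R b) - w x) / (1 / real (Suc n))) \<longlonglongrightarrow> b \<bullet> W x"
        by (rule filterlim_compose)
      then show "(\<lambda>n. D n x) \<longlonglongrightarrow> b \<bullet> W x" by (simp add: D_def)
    qed
    fix n
    show "AE x in lborel. norm (D n x) \<le> indicator (cball 0 (R + norm b)) x * (B * norm b)"
    proof (rule AE_I2)
      fix x
      show "norm (D n x) \<le> indicator (cball 0 (R + norm b)) x * (B * norm b)"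
      proof (cases "norm x \<le> R + norm b")
        case True
        have "\<bar>w (x + (1 / real (Suc n)) *\<^sub>R b) - w x - 0 \<bullet> ((x + (1 / real (Suc n)) *\<^sub>R b) - x)\<bar> \<le> B * norm ((x + (1 / real (Suc n)) *\<^sub>R b) - x)"
          by (rule GDERIV_mvt_le[OF C(1)]) (use B in auto)
        then have "\<bar>w (x + (1 / real (Suc n)) *\<^sub>R b) - w x\<bar> \<le> B * norm b / real (Suc n)" by simp
        from mult_right_mono[OF this, of "real (Suc n)"] have "norm (D n x) \<le> B * norm b" by (simp add: D_def abs_mult)
        then show ?thesis using True by simp
      next
        case False
        have "norm ((1 / real (Suc n)) *\<^sub>R b) \<le> norm b" by (simp add: field_simps)
        then have "R < norm (x + (1 / real (Suc n)) *\<^sub>R b)"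
          using False norm_triangle_ineq4[of "x + (1 / real (Suc n)) *\<^sub>R b" "(1 / real (Suc n)) *\<^sub>R b"] by auto
        moreover have "R < norm x" using False norm_ge_zero[of b] by linarith
        ultimately have "R < norm (x + (1 / real (Suc n)) *\<^sub>R b)" "R < norm x" by auto
        then show ?thesis using R by (simp add: D_def indicator_def B(1))
      qed
    qed
  qed (simp_all add: D_def[abs_def])
  then show ?thesis by (simp add: D0 LIMSEQ_const_iff)
qed

text \<open>For each \<open>b\<close> the derivative of \<open>p * partial_deriv b f\<close> in
  direction \<open>b\<close> integrates to 0. The bounded support of \<open>p\<close> removes
  boundary terms, whatever the growth of \<open>f\<close>.\<close>

lemma integral_mult_laplacian:
  fixes f p :: "'a::euclidean_space \<Rightarrow> real"
  assumes f: "C_k 2 f" and p: "C1_gradient p P" and R: "\<And>x. R < norm x \<Longrightarrow> p x = 0"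
  shows "(\<integral>x. p x * laplacian f x \<partial>lborel) = - (\<integral>x. P x \<bullet> gradient f x \<partial>lborel)"
proof -
  note g = C_k_2_gradient[OF f]
  have RP: "\<And>x. R < norm x \<Longrightarrow> P x = 0" using C1_gradient_zero_outside[OF p R] .
  have cg: "continuous_on UNIV (gradient (partial_deriv b f))" "continuous_on UNIV (partial_deriv b f)" if "b \<in> Basis" for b
    using C1_gradientD[OF g(2)[OF that]] by auto
  have 1: "integrable lborel (\<lambda>x. p x * (b \<bullet> gradient (partial_deriv b f) x))" if "b \<in> Basis" for b
    using C1_gradientD(3)[OF p] cg[OF that] R
    by (intro continuous_bounded_support_integrable[of _ R] continuous_intros) auto
  have 2: "integrable lborel (\<lambda>x. partial_deriv b f x * (b \<bullet> P x))" if "b \<in> Basis" for b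
    using C1_gradientD(2)[OF p] cg[OF that] RP
    by (intro continuous_bounded_support_integrable[of _ R] continuous_intros) auto
  have 3: "(\<integral>x. p x * (b \<bullet> gradient (partial_deriv b f) x) \<partial>lborel) = - (\<integral>x. partial_deriv b f x * (b \<bullet> P x) \<partial>lborel)" if b: "b \<in> Basis" for b
  proof -
    have "(\<integral>x. b \<bullet> (p x *\<^sub>R gradient (partial_deriv b f) x + partial_deriv b f x *\<^sub>R P x) \<partial>lborel) = 0"
      by (rule integral_directional_derivative_zero[OF C1_gradient_mult[OF p g(2)[OF b]], where R=R]) (simp add: R)
    also have "(\<integral>x. b \<bullet> (p x *\<^sub>R gradient (partial_deriv b f) x + partial_deriv b f x *\<^sub>R P x) \<partial>lborel)
      = (\<integral>x. p x * (b \<bullet> gradient (partial_deriv b f) x) \<partial>lborel) + (\<integral>x. partial_deriv b f x * (b \<bullet> P x) \<partial>lborel)"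
      using 1[OF b] 2[OF b] by (simp add: inner_add_right)
    finally show ?thesis by simp
  qed
  have "(\<integral>x. p x * laplacian f x \<partial>lborel) = (\<Sum>b\<in>Basis. \<integral>x. p x * (b \<bullet> gradient (partial_deriv b f) x) \<partial>lborel)"
    using 1 by (simp add: g(4) sum_distrib_left)
  also have "\<dots> = - (\<Sum>b\<in>Basis. \<integral>x. partial_deriv b f x * (b \<bullet> P x) \<partial>lborel)"
    using 3 by (simp add: sum_negf)
  also have "\<dots> = - (\<integral>x. P x \<bullet> gradient f x \<partial>lborel)"
    using 2 by (simp add: g(3) inner_sum_right inner_commute[of "P _"])
  finally show ?thesis .
qed

lemma gradient_lipschitz_on_ball:
  fixes f :: "'a::euclidean_space \<Rightarrow> real"
  assumes f: "C_k 2 f"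
  obtains K where "0 \<le> K" "\<And>x y. norm x \<le> R \<Longrightarrow> norm y \<le> R \<Longrightarrow> norm (gradient f x - gradient f y) \<le> K * norm (x - y)"
proof -
  note g = C_k_2_gradient[OF f]
  have "\<exists>K. \<forall>x\<in>cball 0 R. norm (gradient (partial_deriv b f) x) \<le> K" if "b \<in> Basis" for b
  proof -
    have "bounded (gradient (partial_deriv b f) ` cball 0 R)"
      using C1_gradientD(2)[OF g(2)[OF that]] by (intro compact_imp_bounded compact_continuous_image) (auto intro: continuous_on_subset)
    then show ?thesis unfolding bounded_iff by auto
  qed
  then obtain K where K: "\<And>b x. b \<in> Basis \<Longrightarrow> x \<in> cball 0 R \<Longrightarrow> norm (gradient (partial_deriv b f) x) \<le> K b" by metis
  show ?thesis
  proof (rule that[of "\<Sum>b\<in>Basis. \<bar>K b\<bar>"])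
    fix x y :: 'a assume xy: "norm x \<le> R" "norm y \<le> R"
    have "norm (gradient f x - gradient f y) = norm (\<Sum>b\<in>Basis. (partial_deriv b f x - partial_deriv b f y) *\<^sub>R b)"
      by (simp add: g(3) sum_subtractf scaleR_diff_left)
    also have "\<dots> \<le> (\<Sum>b\<in>Basis. \<bar>partial_deriv b f x - partial_deriv b f y\<bar>)"
      by (rule order_trans[OF norm_sum]) (auto intro!: sum_mono)
    also have "\<dots> \<le> (\<Sum>b\<in>Basis. \<bar>K b\<bar> * norm (x - y))"
    proof (rule sum_mono)
      fix b :: 'a assume b: "b \<in> Basis"
      have "\<bar>partial_deriv b f x - partial_deriv b f y - 0 \<bullet> (x - y)\<bar> \<le> \<bar>K b\<bar> * norm (x - y)"
      proof (rule GDERIV_mvt_le[OF C1_gradientD(1)[OF g(2)[OF b]]])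
        fix u assume u: "u \<in> closed_segment y x"
        have "closed_segment y x \<subseteq> cball 0 R" using xy by (intro closed_segment_subset) auto
        then show "norm (gradient (partial_deriv b f) u - 0) \<le> \<bar>K b\<bar>" using K[OF b] u by fastforce
      qed
      then show "\<bar>partial_deriv b f x - partial_deriv b f y\<bar> \<le> \<bar>K b\<bar> * norm (x - y)" by simp
    qed
    finally show "norm (gradient f x - gradient f y) \<le> (\<Sum>b\<in>Basis. \<bar>K b\<bar>) * norm (x - y)"
      by (simp add: sum_distrib_right)
  qed (simp add: sum_nonneg)
qed


text \<open>The sum is the Hessian form at \<open>a\<close>, evaluated at \<open>x - y\<close>. With
  \<open>u = x - y\<close> frozen, the mean value inequality is applied to the scalar function that
  sums \<open>(u \<bullet> b) * partial_deriv b f z\<close> over \<open>b\<close>; its gradient is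
  close to the one at \<open>a\<close> by continuity of the second derivatives.\<close>

lemma gradient_inner_increment:
  fixes f :: "'a::euclidean_space \<Rightarrow> real"
  assumes f: "C_k 2 f" and e: "0 < e"
  obtains r where "0 < r"
    "\<And>x y. x \<in> ball a r \<Longrightarrow> y \<in> ball a r \<Longrightarrow>
       \<bar>(gradient f x - gradient f y) \<bullet> (x - y) - (\<Sum>b\<in>Basis. ((x - y) \<bullet> b) * (gradient (partial_deriv b f) a \<bullet> (x - y)))\<bar>
        \<le> e * (norm (x - y))\<^sup>2"
proof -
  note g = C_k_2_gradient[OF f]
  define e' where "e' = e / DIM('a)"
  have e': "0 < e'" using e by (simp add: e'_def)
  define P where "P b = gradient (partial_deriv b f)" for b
  have "\<exists>r>0. \<forall>z\<in>ball a r. norm (P b z - P b a) < e'" if "b \<in> Basis" for b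
    using C1_gradientD(2)[OF g(2)[OF that]] e' unfolding continuous_on_iff P_def
    by (metis UNIV_I dist_commute dist_norm mem_ball)
  then obtain rb where rb: "\<And>b. b \<in> Basis \<Longrightarrow> 0 < rb b" "\<And>b z. b \<in> Basis \<Longrightarrow> z \<in> ball a (rb b) \<Longrightarrow> norm (P b z - P b a) < e'"
    by metis
  define r where "r = Min (rb ` Basis)"
  have r: "0 < r" using rb(1) by (auto simp: r_def)
  have rP: "norm (P b z - P b a) < e'" if "b \<in> Basis" "z \<in> ball a r" for b z
  proof -
    have "r \<le> rb b" using that by (simp add: r_def)
    then show ?thesis using rb(2)[of b z] that by auto
  qed
  show ?thesis
  proof (rule that[OF r])
    fix x y assume xy: "x \<in> ball a r" "y \<in> ball a r"
    define u where "u = x - y"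
    define w where "w = (\<Sum>b\<in>Basis. (u \<bullet> b) *\<^sub>R P b a)"
    have "\<bar>(\<Sum>b\<in>Basis. (u \<bullet> b) * partial_deriv b f x) - (\<Sum>b\<in>Basis. (u \<bullet> b) * partial_deriv b f y) - w \<bullet> (x - y)\<bar> \<le> (e * norm u) * norm (x - y)"
    proof (rule GDERIV_mvt_le[where Q="\<lambda>z. \<Sum>b\<in>Basis. (u \<bullet> b) *\<^sub>R P b z"])
      show "GDERIV (\<lambda>z. \<Sum>b\<in>Basis. (u \<bullet> b) * partial_deriv b f z) z :> (\<Sum>b\<in>Basis. (u \<bullet> b) *\<^sub>R P b z)" for z
      proof -
        have "((\<lambda>z. \<Sum>b\<in>Basis. (u \<bullet> b) * partial_deriv b f z) has_derivative (\<lambda>h. \<Sum>b\<in>Basis. (u \<bullet> b) * (h \<bullet> P b z))) (at z)"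
          using C1_gradientD(1)[OF g(2)] unfolding P_def gderiv_def
          by (intro has_derivative_sum has_derivative_mult_right) auto
        then show ?thesis by (simp add: gderiv_def inner_sum_right)
      qed
      fix z assume "z \<in> closed_segment y x"
      then have z: "z \<in> ball a r" using xy closed_segment_subset[OF xy(2,1) convex_ball] by auto
      have "norm ((\<Sum>b\<in>Basis. (u \<bullet> b) *\<^sub>R P b z) - w) = norm (\<Sum>b\<in>Basis. (u \<bullet> b) *\<^sub>R (P b z - P b a))"
        by (simp add: w_def sum_subtractf scaleR_diff_right)
      also have "\<dots> \<le> (\<Sum>b\<in>(Basis::'a set). norm u * e')"
      proof (rule sum_norm_le)
        fix b :: 'a assume b: "b \<in> Basis"
        show "norm ((u \<bullet> b) *\<^sub>R (P b z - P b a)) \<le> norm u * e'"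
          using Basis_le_norm[OF b, of u] rP[OF b z] by (auto intro!: mult_mono)
      qed
      also have "\<dots> = e * norm u" by (simp add: e'_def)
      finally show "norm ((\<Sum>b\<in>Basis. (u \<bullet> b) *\<^sub>R P b z) - w) \<le> e * norm u" .
    qed
    moreover have "(gradient f x - gradient f y) \<bullet> u = (\<Sum>b\<in>Basis. (u \<bullet> b) * partial_deriv b f x) - (\<Sum>b\<in>Basis. (u \<bullet> b) * partial_deriv b f y)"
      by (simp add: g(3) inner_diff_left inner_sum_left inner_commute[of u] mult.commute)
    moreover have "w \<bullet> u = (\<Sum>b\<in>Basis. (u \<bullet> b) * (P b a \<bullet> u))" by (simp add: w_def inner_sum_left)
    ultimately show "\<bar>(gradient f x - gradient f y) \<bullet> (x - y) - (\<Sum>b\<in>Basis. ((x - y) \<bullet> b) * (gradient (partial_deriv b f) a \<bullet> (x - y)))\<bar>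
        \<le> e * (norm (x - y))\<^sup>2"
      by (simp add: u_def P_def power2_eq_square mult.assoc)
  qed
qed

text \<open>Otherwise $\sqrt{f - f(a)} + \beta\|\cdot - x\|$ has, for a suitable $\beta < 1/\sqrt{2C}$, a minimizer $y \ne a$ in the
  interior of a ball around $x$, although PL makes $\sqrt{f - f(a)}$ decrease at rate at least $1/\sqrt{2C}$.\<close>

lemma PL_quadratic_growth:
  fixes f :: "'a::euclidean_space \<Rightarrow> real"
  assumes f: "\<And>x. GDERIV f x :> G x" and C: "0 < C"
    and PL: "\<And>x. f x - f a \<le> C / 2 * (norm (G x))\<^sup>2" and min: "\<And>x. x \<noteq> a \<Longrightarrow> f a < f x"
  shows "(norm (x - a))\<^sup>2 / (2 * C) \<le> f x - f a"
proof (rule ccontr)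
  define F where "F x = f x - f a" for x
  define al where "al = 1 / sqrt (2 * C)"
  have al: "0 < al" using C by (simp add: al_def)
  have F0: "0 \<le> F x" for x using min[of x] by (cases "x = a") (auto simp: F_def)
  assume "\<not> ?thesis"
  then have lt: "F x < (al * norm (x - a))\<^sup>2" using C by (simp add: F_def al_def power_mult_distrib power_divide)
  define d where "d = norm (x - a)"
  have d: "0 < d" using lt F0[of x] by (cases "x = a") (auto simp: d_def)
  have "sqrt (F x) < al * d" using lt al d by (simp add: d_def real_less_lsqrt)
  \<comment> \<open>The lower bound on \<open>be\<close> makes \<open>h x\<close> smaller than
    \<open>be * d\<close>, so the minimizer of \<open>h\<close> lies in the open ball and differs
    from \<open>a\<close>. The upper bound lets the descent rate of \<open>sqrt (F y)\<close> beat
    the growth of the distance term.\<close>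
  then obtain be where be: "sqrt (F x) / d < be" "be < al" using d by (metis dense pos_divide_less_eq)
  have be0: "0 < be" using be(1) d F0[of x] by (smt (verit) divide_nonneg_pos real_sqrt_ge_zero)
  define h where "h y = sqrt (F y) + be * norm (y - x)" for y
  have contf: "continuous_on UNIV f" using GDERIV_imp_continuous[OF f] .
  have "continuous_on (cball x d) h" unfolding h_def F_def
    by (intro continuous_intros continuous_on_subset[OF contf]) auto
  then obtain y where y: "y \<in> cball x d" "\<And>z. z \<in> cball x d \<Longrightarrow> h y \<le> h z"
    using continuous_attains_inf[of "cball x d" h] d by (auto simp del: mem_cball)
  have "h y \<le> h x" using y(2)[of x] d by simp
  then have "be * norm (y - x) \<le> sqrt (F x)" using F0[of y] by (simp add: h_def) (smt (verit) real_sqrt_ge_zero)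
  also have "\<dots> < be * d" using be d by (simp add: field_simps)
  finally have yd: "norm (y - x) < d" using be0 by simp
  then have "y \<noteq> a" by (auto simp: d_def norm_minus_commute)
  then have Fy: "0 < F y" using min by (simp add: F_def)
  define g where "g = (1 / (2 * sqrt (F y))) *\<^sub>R G y"
  have ng: "al \<le> norm g"
  proof -
    have "(norm g)\<^sup>2 = (norm (G y))\<^sup>2 / (4 * F y)" using Fy by (simp add: g_def power_divide power_mult_distrib)
    also have "\<dots> \<ge> (2 / C * F y) / (4 * F y)"
      using PL[of y] C Fy by (intro divide_right_mono) (auto simp: F_def field_simps)
    finally have "al\<^sup>2 \<le> (norm g)\<^sup>2" using Fy C by (simp add: al_def power_divide)
    then show ?thesis by (rule power2_le_imp_le) simp
  qed
  have g0: "0 < norm g" using al ng by linarith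
  \<comment> \<open>\<open>h\<close> along the descent direction \<open>- g\<close>, with the
    distance to \<open>x\<close> replaced by its triangle bound. This keeps \<open>p\<close>
    differentiable at 0, and \<open>p t + be * norm (y - x)\<close> lies above
    \<open>h\<close>.\<close>
  define p where "p t = sqrt (F (y + t *\<^sub>R (- g))) + be * (t * norm g)" for t
  have "(p has_real_derivative ((- g) \<bullet> G (y + 0 *\<^sub>R (- g))) / (2 * sqrt (F (y + 0 *\<^sub>R (- g)))) + be * norm g) (at 0)"
    unfolding p_def F_def using Fy DERIV_along_segment[OF f, where z=y and u="-g" and t=0]
    by (auto intro!: derivative_eq_intros simp: F_def field_simps)
  moreover have "((- g) \<bullet> G (y + 0 *\<^sub>R (- g))) / (2 * sqrt (F (y + 0 *\<^sub>R (- g)))) = - (norm g)\<^sup>2"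
    using Fy by (simp add: g_def power2_norm_eq_inner power_divide power_mult_distrib)
  moreover have "- (norm g)\<^sup>2 + be * norm g < 0"
    using be ng g0 by (simp add: power2_eq_square)
  ultimately have "\<exists>t0>0. \<forall>t>0. t < t0 \<longrightarrow> p (0 + t) < p 0"
    by (intro DERIV_neg_dec_right[of p "- (norm g)\<^sup>2 + be * norm g"]) auto
  then obtain t0 where t0: "0 < t0" "\<And>t. 0 < t \<Longrightarrow> t < t0 \<Longrightarrow> p t < p 0" by auto
  define t where "t = min (t0 / 2) ((d - norm (y - x)) / (2 * norm g))"
  have t: "0 < t" "t < t0" using t0 yd g0 by (auto simp: t_def min_less_iff_disj)
  have "t * norm g \<le> (d - norm (y - x)) / 2"
    using g0 by (simp add: t_def min_le_iff_disj) (simp add: field_simps min_def)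
  also have "\<dots> \<le> d - norm (y - x)" using yd by simp
  finally have tg: "t * norm g \<le> d - norm (y - x)" .
  let ?z = "y + t *\<^sub>R (- g)"
  have nz: "norm (?z - x) \<le> norm (y - x) + t * norm g"
    using norm_triangle_ineq4[of "y - x" "t *\<^sub>R g"] t by (simp add: algebra_simps)
  have "h y \<le> h ?z" using tg nz by (intro y(2)) (simp add: dist_norm norm_minus_commute)
  also have "\<dots> \<le> sqrt (F ?z) + be * (norm (y - x) + t * norm g)"
    unfolding h_def using nz be0 by (intro add_left_mono mult_left_mono) auto
  also have "\<dots> = p t + be * norm (y - x)" by (simp add: p_def algebra_simps)
  also have "\<dots> < p 0 + be * norm (y - x)" using t0(2)[OF t] by simp
  also have "\<dots> = h y" by (simp add: p_def h_def)
  finally show False by simp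
qed

lemma gradient_zero_at_min:
  fixes f :: "'a::euclidean_space \<Rightarrow> real"
  assumes f: "GDERIV f a :> D" and min: "\<And>x. f a \<le> f x"
  shows "D = 0"
proof -
  have "(\<lambda>h. h \<bullet> D) = (\<lambda>h. 0)"
    using f min unfolding gderiv_def by (intro has_derivative_local_min[of f _ a]) auto
  then show ?thesis by (metis inner_eq_zero_iff)
qed

text \<open>Along a ray from \<open>a\<close> the second-order upper bound of \<open>f\<close> by
  the Hessian form is compared with quadratic growth; this bounds the form from below. Continuity of
  the second derivatives turns the bound into strong monotonicity of the gradient near
  \<open>a\<close>, integration along segments into a tangent inequality, and two tangents at the
  convex combination into strong convexity.\<close>

lemma PL_locally_strongly_convex:
  fixes f :: "'a::euclidean_space \<Rightarrow> real"
  assumes f: "C_k 2 f" and C: "0 < C"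
    and PL: "\<And>x. f x - f a \<le> C / 2 * (norm (gradient f x))\<^sup>2" and min: "\<And>x. x \<noteq> a \<Longrightarrow> f a < f x"
    and k: "k < 1 / C"
  obtains r where "0 < r"
    "\<And>x y s t. x \<in> ball a r \<Longrightarrow> y \<in> ball a r \<Longrightarrow> 0 < s \<Longrightarrow> 0 < t \<Longrightarrow> s + t = 1 \<Longrightarrow>
       f (s *\<^sub>R x + t *\<^sub>R y) + s * t * k / 2 * (norm (x - y))\<^sup>2 \<le> s * f x + t * f y"
proof -
  note G = C1_gradientD[OF C_k_2_gradient(1)[OF f]]
  define H where "H u = (\<Sum>b\<in>Basis. (u \<bullet> b) * (gradient (partial_deriv b f) a \<bullet> u))" for u
  \<comment> \<open>Half of the gap: one \<open>e\<close> is lost in the lower bound for the Hessian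
    form, the other when the gradient increment is compared with that form.\<close>
  define e where "e = (1 / C - k) / 2"
  have e: "0 < e" using k by (simp add: e_def)
  obtain r where r: "0 < r" and inc: "\<And>x y. x \<in> ball a r \<Longrightarrow> y \<in> ball a r \<Longrightarrow>
       \<bar>(gradient f x - gradient f y) \<bullet> (x - y) - H (x - y)\<bar> \<le> e * (norm (x - y))\<^sup>2"
    using gradient_inner_increment[OF f e, of a] unfolding H_def by blast
  have mini: "f a \<le> f x" for x using min[of x] by (cases "x = a") auto
  have Ga: "gradient f a = 0" using gradient_zero_at_min[OF G(1) mini] .
  have Hs: "H (c *\<^sub>R u) = c\<^sup>2 * H u" for c u
    by (simp add: H_def sum_distrib_left power2_eq_square mult_ac)
  have Hlow: "(norm u)\<^sup>2 / C - e * (norm u)\<^sup>2 \<le> H u" if u: "norm u < r" for u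
  proof -
    define p where "p t = f (a + t *\<^sub>R u) - t\<^sup>2 / 2 * (H u + e * (norm u)\<^sup>2)" for t
    have "p 1 \<le> p 0"
    proof (rule DERIV_nonpos_imp_nonincreasing[of 0 1 p])
      fix t :: real assume t: "0 \<le> t" "t \<le> 1"
      have "(p has_real_derivative (u \<bullet> gradient f (a + t *\<^sub>R u)) - t * (H u + e * (norm u)\<^sup>2)) (at t)"
        unfolding p_def by (auto intro!: derivative_eq_intros DERIV_along_segment[OF G(1)])
      moreover have "(u \<bullet> gradient f (a + t *\<^sub>R u)) - t * (H u + e * (norm u)\<^sup>2) \<le> 0"
      proof (cases "t = 0")
        case False
        have "norm (t *\<^sub>R u) < r" using u t by (auto intro: le_less_trans[OF mult_left_le_one_le])
        then have "\<bar>(gradient f (a + t *\<^sub>R u) - gradient f a) \<bullet> (t *\<^sub>R u) - H (t *\<^sub>R u)\<bar> \<le> e * (norm (t *\<^sub>R u))\<^sup>2"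
          using inc[of "a + t *\<^sub>R u" a] r by (simp add: dist_norm)
        then have "t * (u \<bullet> gradient f (a + t *\<^sub>R u)) \<le> t * (t * (H u + e * (norm u)\<^sup>2))"
          using t by (simp add: Ga Hs power_mult_distrib inner_commute power2_eq_square algebra_simps abs_le_iff)
        then show ?thesis using False t by (simp add: mult_le_cancel_left)
      qed (simp add: Ga)
      ultimately show "\<exists>y. (p has_real_derivative y) (at t) \<and> y \<le> 0" by blast
    qed simp
    then have "f (a + u) - (H u + e * (norm u)\<^sup>2) / 2 \<le> f a" by (simp add: p_def)
    moreover have "(norm u)\<^sup>2 / (2 * C) \<le> f (a + u) - f a"
      using PL_quadratic_growth[OF G(1) C PL min, of "a + u"] by simp
    ultimately have "(norm u)\<^sup>2 / (2 * C) \<le> (H u + e * (norm u)\<^sup>2) / 2" by linarith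
    then show ?thesis using C by (simp add: field_simps)
  qed
  \<comment> \<open>The radius is halved so that \<open>x - y\<close> itself is shorter than
    \<open>r\<close>, where the bound for \<open>H\<close> is available.\<close>
  have mono: "k * (norm (x - y))\<^sup>2 \<le> (gradient f x - gradient f y) \<bullet> (x - y)"
    if xy: "x \<in> ball a (r/2)" "y \<in> ball a (r/2)" for x y
  proof -
    have "norm (x - y) < r"
      using xy dist_triangle_less_add[of x a "r/2" y "r/2"] by (simp add: dist_norm norm_minus_commute)
    moreover have "x \<in> ball a r" "y \<in> ball a r" using xy r by auto
    ultimately have "(norm (x - y))\<^sup>2 / C - 2 * e * (norm (x - y))\<^sup>2 \<le> (gradient f x - gradient f y) \<bullet> (x - y)"
      using Hlow[of "x - y"] inc[of x y] by (auto simp: abs_le_iff)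
    moreover have "(norm (x - y))\<^sup>2 / C - 2 * e * (norm (x - y))\<^sup>2 = k * (norm (x - y))\<^sup>2"
    proof -
      have "2 * e = 1 / C - k" by (simp add: e_def)
      then show ?thesis by (simp add: left_diff_distrib)
    qed
    ultimately show ?thesis by simp
  qed
  have tang: "f z + gradient f z \<bullet> (x - z) + k / 2 * (norm (x - z))\<^sup>2 \<le> f x"
    if xz: "x \<in> ball a (r/2)" "z \<in> ball a (r/2)" for x z
  proof -
    define u where "u = x - z"
    define p where "p t = f (z + t *\<^sub>R u) - t * (gradient f z \<bullet> u) - k * t\<^sup>2 / 2 * (norm u)\<^sup>2" for t
    have "p 0 \<le> p 1"
    proof (rule DERIV_nonneg_imp_nondecreasing[of 0 1 p])
      fix t :: real assume t: "0 \<le> t" "t \<le> 1"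
      have "(p has_real_derivative (u \<bullet> gradient f (z + t *\<^sub>R u)) - gradient f z \<bullet> u - k * t * (norm u)\<^sup>2) (at t)"
        unfolding p_def by (auto intro!: derivative_eq_intros DERIV_along_segment[OF G(1)])
      moreover have "0 \<le> (u \<bullet> gradient f (z + t *\<^sub>R u)) - gradient f z \<bullet> u - k * t * (norm u)\<^sup>2"
      proof (cases "t = 0")
        case False
        have "z + t *\<^sub>R u = (1 - t) *\<^sub>R z + t *\<^sub>R x" by (simp add: u_def algebra_simps)
        then have "z + t *\<^sub>R u \<in> ball a (r/2)"
          using xz t convexD_alt[OF convex_ball[of a "r/2"] xz(2,1), of t] by simp
        from mono[OF this xz(2)] have "t * (k * t * (norm u)\<^sup>2) \<le> t * ((gradient f (z + t *\<^sub>R u) - gradient f z) \<bullet> u)"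
          by (simp add: power_mult_distrib power2_eq_square mult_ac)
        then show ?thesis using False t by (simp add: mult_le_cancel_left inner_diff_left inner_diff_right inner_commute)
      qed (simp add: inner_commute)
      ultimately show "\<exists>y. (p has_real_derivative y) (at t) \<and> 0 \<le> y" by blast
    qed simp
    then show ?thesis by (simp add: p_def u_def)
  qed
  show ?thesis
  proof (rule that[of "r/2"])
    fix x y s t assume xy: "x \<in> ball a (r/2)" "y \<in> ball a (r/2)" and st: "0 < s" "0 < t" "s + t = (1::real)"
    define z where "z = s *\<^sub>R x + t *\<^sub>R y"
    have z: "z \<in> ball a (r/2)" using convexD[OF convex_ball xy, of s t] st by (simp add: z_def)
    have s: "s = 1 - t" using st by simp
    have e1: "x - z = t *\<^sub>R (x - y)" "y - z = - (s *\<^sub>R (x - y))" by (simp_all add: z_def s algebra_simps)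
    have "s * (f z + gradient f z \<bullet> (x - z) + k / 2 * (norm (x - z))\<^sup>2) + t * (f z + gradient f z \<bullet> (y - z) + k / 2 * (norm (y - z))\<^sup>2) \<le> s * f x + t * f y"
      using tang[OF xy(1) z] tang[OF xy(2) z] st by (intro add_mono mult_left_mono) auto
    moreover have "s * (f z + gradient f z \<bullet> (x - z) + k / 2 * (norm (x - z))\<^sup>2) + t * (f z + gradient f z \<bullet> (y - z) + k / 2 * (norm (y - z))\<^sup>2)
      = f z + s * t * k / 2 * (norm (x - y))\<^sup>2"
    proof -
      have alg: "s * (A + t * D + h * (t\<^sup>2 * n)) + t * (A - s * D + h * (s\<^sup>2 * n)) = A + s * t * h * n" for A D h n :: real
        unfolding s by (simp add: power2_eq_square algebra_simps)
      show ?thesis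
        unfolding e1 using st alg[of "f z" "gradient f z \<bullet> (x - y)" "k / 2" "(norm (x - y))\<^sup>2"]
        by (simp add: power_mult_distrib)
    qed
    ultimately show "f (s *\<^sub>R x + t *\<^sub>R y) + s * t * k / 2 * (norm (x - y))\<^sup>2 \<le> s * f x + t * f y"
      by (simp add: z_def)
  qed (use r in simp)
qed

section \<open>Entropy and Fisher information with respect to Lebesgue measure\<close>

text \<open>The tangent bound of ln at 1 / sqrt x. With the square root in place of x ln x, the
  regularizations below pass to the limit by continuity.\<close>

lemma mult_ln_ge: "- 2 * sqrt x \<le> x * ln x" if "0 < x" "x \<le> 1" for x :: real
proof -
  have "ln (1 / sqrt x) \<le> 1 / sqrt x - 1" using that by (intro ln_le_minus_one) auto
  then have "- ln x / 2 \<le> 1 / sqrt x" using that by (simp add: ln_div ln_sqrt)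
  from mult_left_mono[OF this, of "2 * x"] that show ?thesis
    by (simp add: real_div_sqrt) (metis (no_types, opaque_lifting) mult.commute mult_minus_left minus_le_iff real_div_sqrt less_imp_le times_divide_eq_right mult.right_neutral)
qed

lemma abs_mult_ln_le: "\<bar>u * ln u\<bar> \<le> 2 + b * b" if "0 \<le> u" "u \<le> b" for u b :: real
proof (cases "u = 0")
  case False
  then have u0: "0 < u" using that by simp
  have nn: "0 \<le> b * b" by simp
  show ?thesis
  proof (cases "u \<le> 1")
    case True
    have "- 2 * sqrt u \<le> u * ln u" using mult_ln_ge[OF u0 True] .
    moreover have "sqrt u \<le> 1" using True real_sqrt_le_1_iff by blast
    moreover have "u * ln u \<le> 0" using u0 True by (simp add: mult_nonneg_nonpos)
    ultimately show ?thesis using nn by linarith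
  next
    case False
    then have "0 \<le> ln u" "ln u \<le> b" using that ln_le_minus_one[OF u0] by auto
    then have "u * ln u \<le> b * b" "0 \<le> u * ln u" using that by (auto intro!: mult_mono)
    then show ?thesis by linarith
  qed
qed simp

text \<open>With \<open>q x = ln ((p x)\<^sup>2 + e)\<close> the exponential form of the inequality
  applies even where \<open>p\<close> vanishes; the bounded support of \<open>P\<close> makes
  \<open>Q\<close> bounded and uniformly continuous. The Fisher density of \<open>q\<close> is 4 p^2
  / (p^2 + e) times |P|^2, hence at most 4 |P|^2, and \<open>e\<close> tends to 0.\<close>

lemma log_Sobolev_log_concave_square:
  fixes rho p :: "'a::euclidean_space \<Rightarrow> real"
  assumes rho_m[measurable]: "rho \<in> borel_measurable borel"
    and rho: "\<And>x. 0 \<le> rho x" "\<And>x. rho x \<le> K" "\<And>x. R < norm x \<Longrightarrow> rho x = 0"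
    and Z: "0 < (\<integral>x. rho x \<partial>lborel)"
    and k: "0 < k"
    and conc: "\<And>x y s r. 0 < s \<Longrightarrow> 0 < r \<Longrightarrow> s + r = 1 \<Longrightarrow>
       rho x powr s * rho y powr r * exp (s * r * k / 2 * (norm (x - y))\<^sup>2) \<le> rho (s *\<^sub>R x + r *\<^sub>R y)"
    and p: "C1_gradient p P" and Bp: "\<And>x. \<bar>p x\<bar> \<le> Bp" and P: "\<And>x. R' < norm x \<Longrightarrow> P x = 0"
  defines "N \<equiv> (\<integral>x. (p x)\<^sup>2 * rho x \<partial>lborel)"
  shows "(\<integral>x. (p x)\<^sup>2 * ln ((p x)\<^sup>2) * rho x \<partial>lborel) - N * ln (N / (\<integral>x. rho x \<partial>lborel))
    \<le> 2 / k * (\<integral>x. (norm (P x))\<^sup>2 * rho x \<partial>lborel)"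
proof -
  note pC = C1_gradientD[OF p]
  have [measurable]: "p \<in> borel_measurable borel" "P \<in> borel_measurable borel"
    using C1_gradient_measurable[OF p] by auto
  obtain B where B: "0 \<le> B" "\<And>x. norm (P x) \<le> B" using continuous_bounded_support_bound[OF pC(2) P] by blast
  have Bp0: "0 \<le> Bp" using Bp[of 0] by linarith
  have Bp2: "(p x)\<^sup>2 \<le> Bp\<^sup>2" for x using Bp by (simp add: abs_le_square_iff[symmetric] Bp0)
  have K0: "0 \<le> K" using rho(1,2)[of 0] by linarith
  have int: "integrable lborel (\<lambda>x. h x * rho x)" if [measurable]: "h \<in> borel_measurable borel" and h: "\<And>x. \<bar>h x\<bar> \<le> C" for h C
  proof (rule integrable_bounded_support[where R=R and K="C * K"])
    fix x
    have "\<bar>h x\<bar> * rho x \<le> C * K" by (intro mult_mono h) (use rho h[of x] in \<open>auto intro: order_trans[OF abs_ge_zero]\<close>)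
    then show "\<bar>h x * rho x\<bar> \<le> C * K" using rho(1)[of x] by (simp add: abs_mult)
  qed (use rho in auto)
  define Zr where "Zr = (\<integral>x. rho x \<partial>lborel)"
  have Zr: "0 < Zr" using Z by (simp add: Zr_def)
  define L where "L = (\<integral>x. (p x)\<^sup>2 * ln ((p x)\<^sup>2) * rho x \<partial>lborel)"
  define I where "I = 2 / k * (\<integral>x. (norm (P x))\<^sup>2 * rho x \<partial>lborel)"
  have iN: "integrable lborel (\<lambda>x. (p x)\<^sup>2 * rho x)" by (rule int[where C="Bp\<^sup>2"]) (auto simp: Bp2)
  have iZ: "integrable lborel rho" using int[of "\<lambda>_. 1" 1] by simp
  have iI: "integrable lborel (\<lambda>x. (norm (P x))\<^sup>2 * rho x)"
    by (rule int[where C="B\<^sup>2"]) (auto simp: B intro!: power_mono)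
  have I0: "0 \<le> I" unfolding I_def using k rho by (intro mult_nonneg_nonneg integral_nonneg_AE) auto
  have iL: "integrable lborel (\<lambda>x. (p x)\<^sup>2 * ln ((p x)\<^sup>2) * rho x)"
  proof (rule int[where C="2 + Bp\<^sup>2 * Bp\<^sup>2"])
    show "(\<lambda>x. (p x)\<^sup>2 * ln ((p x)\<^sup>2)) \<in> borel_measurable borel" by measurable
    show "\<bar>(p x)\<^sup>2 * ln ((p x)\<^sup>2)\<bar> \<le> 2 + Bp\<^sup>2 * Bp\<^sup>2" for x
      by (rule abs_mult_ln_le[OF zero_le_power2 Bp2])
  qed
  have step: "L + e * ln e * Zr - (N + e * Zr) * ln ((N + e * Zr) / Zr) \<le> I" if e: "0 < e" "e \<le> 1" for e
  proof -
    define q where "q x = ln ((p x)\<^sup>2 + e)" for x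
    define Q where "Q x = (2 * p x / ((p x)\<^sup>2 + e)) *\<^sub>R P x" for x
    have pe: "0 < (p x)\<^sup>2 + e" for x using e by (simp add: add_nonneg_pos)
    have eq: "exp (q x) = (p x)\<^sup>2 + e" for x using pe by (simp add: q_def)
    have qQ: "C1_gradient q Q"
      unfolding q_def Q_def
    proof (rule C1_gradient_compose[OF p])
      fix x show "((\<lambda>s. ln (s\<^sup>2 + e)) has_real_derivative 2 * p x / ((p x)\<^sup>2 + e)) (at (p x))"
        using pe by (auto intro!: derivative_eq_intros simp: field_simps)
    next
      have "s\<^sup>2 + e \<noteq> 0" for s using e by (metis add_nonneg_pos less_irrefl zero_le_power2)
      then show "continuous_on (range p) (\<lambda>s. 2 * s / (s\<^sup>2 + e))" by (intro continuous_intros) auto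
    qed
    have Qz: "Q x = 0" if "R' < norm x" for x using P that by (simp add: Q_def)
    obtain BQ where BQ: "0 \<le> BQ" "\<And>x. norm (Q x) \<le> BQ"
      by (rule continuous_bounded_support_bound[OF C1_gradientD(2)[OF qQ] Qz]) auto
    have uc: "uniformly_continuous_on UNIV Q"
    proof -
      \<comment> \<open>Two points at distance less than 1 either both lie in the ball of radius
        \<open>R' + 1\<close>, or both lie outside the ball of radius \<open>R'\<close>, where
        \<open>Q\<close> vanishes.\<close>
      have "uniformly_continuous_on (cball 0 (R' + 1)) Q"
        by (rule compact_uniformly_continuous, rule continuous_on_subset[OF C1_gradientD(2)[OF qQ]]) auto
      show ?thesis unfolding uniformly_continuous_on_def
      proof (intro allI impI)
        fix d :: real assume "0 < d"
        then obtain c where c: "0 < c" "\<And>x y. x \<in> cball 0 (R'+1) \<Longrightarrow> y \<in> cball 0 (R'+1) \<Longrightarrow> dist y x < c \<Longrightarrow> dist (Q y) (Q x) < d"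
          using \<open>uniformly_continuous_on (cball 0 (R' + 1)) Q\<close> unfolding uniformly_continuous_on_def by blast
        have "dist (Q y) (Q x) < d" if xy: "dist y x < min c 1" for x y
        proof (cases "norm x \<le> R' \<or> norm y \<le> R'")
          case True
          have "\<bar>norm x - norm y\<bar> < 1" using xy norm_triangle_ineq3[of x y] by (simp add: dist_norm norm_minus_commute)
          then have "x \<in> cball 0 (R'+1)" "y \<in> cball 0 (R'+1)" using True by auto
          then show ?thesis using c(2) xy by auto
        qed (use Qz \<open>0 < d\<close> in auto)
        then show "\<exists>c>0. \<forall>x\<in>UNIV. \<forall>x'\<in>UNIV. dist x' x < c \<longrightarrow> dist (Q x') (Q x) < d"
          using c(1) by (intro exI[of _ "min c 1"]) auto
      qed
    qed
    have qb: "\<bar>q x\<bar> \<le> max (- ln e) (ln (Bp\<^sup>2 + 1))" for x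
    proof -
      have "ln e \<le> q x" unfolding q_def using e pe[of x] by (subst ln_le_cancel_iff) auto
      moreover have "q x \<le> ln (Bp\<^sup>2 + 1)" unfolding q_def using pe[of x] Bp2[of x] e by (subst ln_le_cancel_iff) auto
      ultimately show ?thesis by linarith
    qed
    have ls: "(\<integral>x. q x * exp (q x) * rho x \<partial>lborel) - (\<integral>x. exp (q x) * rho x \<partial>lborel) * ln ((\<integral>x. exp (q x) * rho x \<partial>lborel) / Zr)
    \<le> 1 / (2 * k) * (\<integral>x. (norm (Q x))\<^sup>2 * exp (q x) * rho x \<partial>lborel)"
      unfolding Zr_def
      by (rule log_Sobolev_log_concave[OF rho_m rho Z k conc C1_gradientD(1)[OF qQ] qb BQ(2) uc])
    have Ne: "(\<integral>x. exp (q x) * rho x \<partial>lborel) = N + e * Zr"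
      using iN iZ by (simp add: eq distrib_right N_def Zr_def)
    have [measurable]: "q \<in> borel_measurable borel" "Q \<in> borel_measurable borel"
      using C1_gradient_measurable[OF qQ] by auto
    have expb: "exp (q x) \<le> Bp\<^sup>2 + 1" for x using e Bp2[of x] by (simp add: eq)
    have "L + e * ln e * Zr = (\<integral>x. (p x)\<^sup>2 * ln ((p x)\<^sup>2) * rho x + e * ln e * rho x \<partial>lborel)"
      using iL iZ by (simp add: L_def Zr_def)
    also have "\<dots> \<le> (\<integral>x. q x * exp (q x) * rho x \<partial>lborel)"
    proof (rule integral_mono)
      show "integrable lborel (\<lambda>x. q x * exp (q x) * rho x)"
        by (rule int[where C="max (- ln e) (ln (Bp\<^sup>2 + 1)) * (Bp\<^sup>2 + 1)"])
           (use qb expb in \<open>auto simp: abs_mult intro!: mult_mono order_trans[OF abs_ge_zero qb]\<close>)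
      fix x
      have "(p x)\<^sup>2 * ln ((p x)\<^sup>2) \<le> (p x)\<^sup>2 * q x"
        using e by (cases "p x = 0") (auto simp: q_def intro!: mult_left_mono ln_mono)
      moreover have "e * ln e \<le> e * q x" unfolding q_def using e pe[of x] by (intro mult_left_mono) auto
      ultimately have "(p x)\<^sup>2 * ln ((p x)\<^sup>2) + e * ln e \<le> q x * exp (q x)" by (simp add: eq algebra_simps)
      from mult_right_mono[OF this rho(1)[of x]]
      show "(p x)\<^sup>2 * ln ((p x)\<^sup>2) * rho x + e * ln e * rho x \<le> q x * exp (q x) * rho x"
        by (simp add: algebra_simps)
    qed (use iL iZ in auto)
    finally have 1: "L + e * ln e * Zr \<le> (\<integral>x. q x * exp (q x) * rho x \<partial>lborel)" .
    have "(\<integral>x. (norm (Q x))\<^sup>2 * exp (q x) * rho x \<partial>lborel) \<le> (\<integral>x. 4 * ((norm (P x))\<^sup>2 * rho x) \<partial>lborel)"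
    proof (rule integral_mono')
      fix x
      have "(norm (Q x))\<^sup>2 * exp (q x) = 4 * ((p x)\<^sup>2 / ((p x)\<^sup>2 + e)) * (norm (P x))\<^sup>2"
        using pe[of x] by (simp add: Q_def eq power_mult_distrib power_divide) (simp add: power2_eq_square)
      also have "\<dots> \<le> 4 * 1 * (norm (P x))\<^sup>2"
        using pe[of x] e by (intro mult_right_mono mult_left_mono) auto
      finally show "(norm (Q x))\<^sup>2 * exp (q x) * rho x \<le> 4 * ((norm (P x))\<^sup>2 * rho x)"
        using mult_right_mono[OF _ rho(1)[of x]] by fastforce
    qed (use iI rho in auto)
    then have "1 / (2 * k) * (\<integral>x. (norm (Q x))\<^sup>2 * exp (q x) * rho x \<partial>lborel) \<le> 1 / (2 * k) * (\<integral>x. 4 * ((norm (P x))\<^sup>2 * rho x) \<partial>lborel)"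
      using k by (intro mult_left_mono) auto
    also have "\<dots> = I" by (simp add: I_def)
    finally show ?thesis using ls 1 unfolding Ne by linarith
  qed
  have "L - N * ln (N / Zr) \<le> I"
  \<comment> \<open>For \<open>N = 0\<close> the argument of the logarithm would tend to 0; there
    the value \<open>e = 1\<close> gives the claim at once, since all logarithms of the
    normalization vanish.\<close>
  proof (cases "N = 0")
    case True
    then show ?thesis using step[of 1] Zr by simp
  next
    case False
    have "0 \<le> N" unfolding N_def by (intro integral_nonneg_AE) (auto simp: rho)
    with False have N: "0 < N" by simp
    have t1: "((\<lambda>e. L + (-2 * sqrt e) * Zr - (N + e * Zr) * ln ((N + e * Zr) / Zr)) \<longlongrightarrow> L + (-2 * sqrt 0) * Zr - (N + 0 * Zr) * ln ((N + 0 * Zr) / Zr)) (at_right 0)"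
      using N Zr by (intro tendsto_intros) auto
    have "L + (-2 * sqrt 0) * Zr - (N + 0 * Zr) * ln ((N + 0 * Zr) / Zr) \<le> I"
    proof (rule tendsto_upperbound[OF t1])
      have "L + (-2 * sqrt e) * Zr - (N + e * Zr) * ln ((N + e * Zr) / Zr) \<le> I" if e: "0 < e" "e < 1" for e
        using step[of e] mult_right_mono[OF mult_ln_ge[of e], of Zr] e Zr by auto
      then show "\<forall>\<^sub>F e in at_right 0. L + (-2 * sqrt e) * Zr - (N + e * Zr) * ln ((N + e * Zr) / Zr) \<le> I"
        unfolding eventually_at_right_field by (intro exI[of _ 1]) auto
    qed simp
    then show ?thesis by simp
  qed
  then show ?thesis by (simp add: L_def Zr_def I_def)
qed

text \<open>The divergence of \<open>w x *\<^sub>R x\<close> integrates to 0. Applied to the square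
  of a function, this fixes the sign of the cross term in the Gaussian computation below.\<close>

lemma integral_gradient_radial:
  fixes w :: "'a::euclidean_space \<Rightarrow> real"
  assumes w: "C1_gradient w W" and R: "\<And>x. R < norm x \<Longrightarrow> w x = 0"
  shows "(\<integral>x. W x \<bullet> x \<partial>lborel) = - real DIM('a) * (\<integral>x. w x \<partial>lborel)"
proof -
  note C = C1_gradientD[OF w]
  have RW: "\<And>x. R < norm x \<Longrightarrow> W x = 0" using C1_gradient_zero_outside[OF w R] .
  have lin: "C1_gradient (\<lambda>x::'a. x \<bullet> b) (\<lambda>x. b)" for b
    by (auto simp: C1_gradient_def gderiv_def intro!: derivative_eq_intros)
  have i1: "integrable lborel w" using C(3) R by (rule continuous_bounded_support_integrable)
  have i2: "integrable lborel (\<lambda>x. (x \<bullet> b) * (b \<bullet> W x))" for b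
    using C(2) RW by (intro continuous_bounded_support_integrable[of _ R] continuous_intros) auto
  have 1: "(\<integral>x. (x \<bullet> b) * (b \<bullet> W x) \<partial>lborel) = - (\<integral>x. w x \<partial>lborel)" if "b \<in> Basis" for b
  proof -
    have "(\<integral>x. b \<bullet> (w x *\<^sub>R b + (x \<bullet> b) *\<^sub>R W x) \<partial>lborel) = 0"
      by (rule integral_directional_derivative_zero[OF C1_gradient_mult[OF w lin[of b]], where R=R]) (simp add: R)
    also have "(\<lambda>x. b \<bullet> (w x *\<^sub>R b + (x \<bullet> b) *\<^sub>R W x)) = (\<lambda>x. w x + (x \<bullet> b) * (b \<bullet> W x))"
      using that by (simp add: inner_add_right)
    finally show ?thesis using i1 i2[of b] by simp
  qed
  have "(\<integral>x. W x \<bullet> x \<partial>lborel) = (\<integral>x. (\<Sum>b\<in>Basis. (x \<bullet> b) * (b \<bullet> W x)) \<partial>lborel)"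
    by (intro Bochner_Integration.integral_cong refl) (subst euclidean_inner, simp add: inner_commute mult.commute)
  also have "\<dots> = (\<Sum>b\<in>(Basis::'a set). - (\<integral>x. w x \<partial>lborel))" using i2 1 by simp
  finally show ?thesis by simp
qed

lemma norm_convex_combination_identity:
  fixes x y :: "'a::real_inner"
  assumes "s + r = (1::real)"
  shows "s * (norm x)\<^sup>2 + r * (norm y)\<^sup>2 = (norm (s *\<^sub>R x + r *\<^sub>R y))\<^sup>2 + s * r * (norm (x - y))\<^sup>2"
proof -
  have r: "r = 1 - s" using assms by simp
  show ?thesis unfolding r power2_norm_eq_inner
    by (simp add: inner_add_left inner_add_right inner_diff_left inner_diff_right inner_commute algebra_simps)
qed

text \<open>A Gaussian log-Sobolev inequality in disguise, applied to w exp(|x|^2 / (4a)) with the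
  Gaussian weight of variance \<open>a\<close>. Entropy and Fisher integral both produce the
  integral of |x|^2 w^2 / (2a), which cancels; the cross term is nonpositive and dropped; the term
  in \<open>ln a\<close> comes from the normalization of the Gaussian. The mass is only bounded by
  1, since the inequality will be applied to a function dominated by a normalized one.\<close>

lemma entropy_le_fisher_lborel:
  fixes w :: "'a::euclidean_space \<Rightarrow> real"
  assumes w: "C1_gradient w W" and R: "\<And>x. R < norm x \<Longrightarrow> w x = 0"
    and N1: "(\<integral>x. (w x)\<^sup>2 \<partial>lborel) \<le> 1" and a: "0 < a" "a \<le> 1"
  shows "(\<integral>x. (w x)\<^sup>2 * ln ((w x)\<^sup>2) \<partial>lborel)
     \<le> 2 * a * (\<integral>x. (norm (W x))\<^sup>2 \<partial>lborel) + \<bar>ln (exp (-1/2) * measure lborel (ball (0::'a) 1))\<bar> - DIM('a) / 2 * ln a"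
proof -
  note C = C1_gradientD[OF w]
  have [measurable]: "w \<in> borel_measurable borel" "W \<in> borel_measurable borel"
    using C1_gradient_measurable[OF w] by auto
  have RW: "\<And>x. R < norm x \<Longrightarrow> W x = 0" using C1_gradient_zero_outside[OF w R] .
  \<comment> \<open>Radius at which the Gaussian is truncated. The ball contains the support of
    \<open>w\<close> and, thanks to the 1, the ball of radius \<open>sqrt a\<close> on which the
    mass is estimated.\<close>
  define R1 where "R1 = max R 1"
  have R1: "w x = 0" "W x = 0" if "R1 < norm x" for x using that R[of x] RW[of x] by (auto simp: R1_def)
  define ga where "ga x = exp (- (norm x)\<^sup>2 / (2 * a))" for x :: 'a
  define rho where "rho x = indicator (cball 0 R1) x * ga x" for x :: 'a
  have [measurable]: "ga \<in> borel_measurable borel" unfolding ga_def by measurable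
  have rho_m[measurable]: "rho \<in> borel_measurable borel" unfolding rho_def
    by (intro borel_measurable_times borel_measurable_indicator \<open>ga \<in> _\<close>) auto
  have rho: "0 \<le> rho x" "rho x \<le> 1" "R1 < norm x \<Longrightarrow> rho x = 0" for x
    using a by (auto simp: rho_def ga_def indicator_def)
  have irho: "integrable lborel rho" by (rule integrable_bounded_support[of _ 1 R1]) (use rho in auto)
  define p where "p x = w x * exp ((norm x)\<^sup>2 / (4 * a))" for x
  define P where "P x = exp ((norm x)\<^sup>2 / (4 * a)) *\<^sub>R (W x + (w x / (2 * a)) *\<^sub>R x)" for x
  have gn: "C1_gradient (\<lambda>x::'a. x \<bullet> x) (\<lambda>x. 2 *\<^sub>R x)"
    by (auto simp: C1_gradient_def gderiv_def inner_commute intro!: derivative_eq_intros continuous_intros)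
  have ge: "C1_gradient (\<lambda>x::'a. exp ((x \<bullet> x) / (4 * a))) (\<lambda>x. (exp ((x \<bullet> x) / (4 * a)) / (4 * a)) *\<^sub>R (2 *\<^sub>R x))"
    by (rule C1_gradient_compose[OF gn, where h="\<lambda>s. exp (s / (4 * a))" and h'="\<lambda>s. exp (s / (4 * a)) / (4 * a)"])
       (use a in \<open>auto intro!: derivative_eq_intros continuous_intros\<close>)
  have pP: "C1_gradient p P"
    using C1_gradient_mult[OF w ge] a
    by (simp add: p_def[abs_def] P_def[abs_def] power2_norm_eq_inner scaleR_add_right algebra_simps)
  have pz: "p x = 0" "P x = 0" if "R1 < norm x" for x using R1[OF that] by (auto simp: p_def P_def)
  obtain Bp where Bp: "0 \<le> Bp" "\<And>x. norm (p x) \<le> Bp"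
    using continuous_bounded_support_bound[OF C1_gradientD(3)[OF pP] pz(1)] by blast
  have r1: "exp ((norm x)\<^sup>2 / (4 * a)) ^ 2 * rho x = 1" if "norm x \<le> R1" for x
    using that a by (simp add: rho_def ga_def exp_double[symmetric] field_simps flip: exp_add)
  have p2: "(p x)\<^sup>2 * rho x = (w x)\<^sup>2" for x
    using r1[of x] R1[of x] by (cases "norm x \<le> R1") (auto simp: p_def power_mult_distrib mult.assoc)
  have P2: "(norm (P x))\<^sup>2 * rho x = (norm (W x + (w x / (2 * a)) *\<^sub>R x))\<^sup>2" for x
  proof (cases "norm x \<le> R1")
    case True
    then show ?thesis using mult.commute[of "_ ^ 2" "rho x"] r1[OF True]
      by (simp add: P_def power_mult_distrib)
  qed (use R1[of x] in \<open>auto simp: P_def\<close>)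
  define Z where "Z = (\<integral>x. rho x \<partial>lborel)"
  define N where "N = (\<integral>x. (w x)\<^sup>2 \<partial>lborel)"
  \<comment> \<open>On the ball of radius \<open>sqrt a\<close> the Gaussian factor is at least
    exp(-1/2); with the volume of that ball this bounds \<open>Z\<close> from below.\<close>
  define V where "V = exp (-1/2) * measure lborel (ball (0::'a) 1)"
  have V: "0 < V" by (simp add: V_def content_ball_pos)
  have Zlow: "V * sqrt a ^ DIM('a) \<le> Z"
  proof -
    have "V * sqrt a ^ DIM('a) = (\<integral>x. exp (-1/2) * indicator (ball (0::'a) (sqrt a)) x \<partial>lborel)"
      using a by (simp add: V_def content_ball)
    also have "\<dots> \<le> Z" unfolding Z_def
    proof (rule integral_mono)
      show "integrable lborel (\<lambda>x. exp (-1/2) * indicator (ball (0::'a) (sqrt a)) x :: real)"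
        using emeasure_lborel_ball_finite[of "0::'a" "sqrt a"] by (intro integrable_mult_right integrable_real_indicator) auto
      fix x :: 'a
      show "exp (-1/2) * indicator (ball 0 (sqrt a)) x \<le> rho x"
      proof (cases "norm x < sqrt a")
        case True
        then have "(norm x)\<^sup>2 < a" using a by (metis norm_ge_zero real_sqrt_pow2 less_imp_le power_strict_mono pos2)
        moreover have "norm x \<le> R1" using True a real_sqrt_le_1_iff[of a] unfolding R1_def by linarith
        ultimately show ?thesis using a True by (simp add: rho_def ga_def field_simps)
      qed (simp add: rho)
    qed (rule irho)
    finally show ?thesis .
  qed
  have Z: "0 < Z" using Zlow V a by (smt (verit) mult_pos_pos real_sqrt_gt_0_iff zero_less_power)
  have lnZ: "- ln Z \<le> \<bar>ln V\<bar> - DIM('a) / 2 * ln a"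
  proof -
    have "ln (V * sqrt a ^ DIM('a)) \<le> ln Z" using Zlow Z V a by (subst ln_le_cancel_iff) auto
    then show ?thesis using V a by (simp add: ln_mult ln_realpow ln_sqrt)
  qed
  have LS: "(\<integral>x. (p x)\<^sup>2 * ln ((p x)\<^sup>2) * rho x \<partial>lborel) - N * ln (N / Z) \<le> 2 / (1/a) * (\<integral>x. (norm (P x))\<^sup>2 * rho x \<partial>lborel)"
    unfolding N_def Z_def p2[symmetric]
  proof (rule log_Sobolev_log_concave_square[OF rho_m rho])
    show "0 < (\<integral>x. rho x \<partial>lborel)" using Z by (simp add: Z_def)
    show "\<bar>p x\<bar> \<le> Bp" for x using Bp by simp
    fix x y :: 'a and s r :: real assume sr: "0 < s" "0 < r" "s + r = 1"
    show "rho x powr s * rho y powr r * exp (s * r * (1 / a) / 2 * (norm (x - y))\<^sup>2) \<le> rho (s *\<^sub>R x + r *\<^sub>R y)"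
    proof (cases "norm x \<le> R1 \<and> norm y \<le> R1")
      case True
      then have "s *\<^sub>R x + r *\<^sub>R y \<in> cball 0 R1" using sr convexD[OF convex_cball, of x 0 R1 y s r] by auto
      then have "rho (s *\<^sub>R x + r *\<^sub>R y) = ga (s *\<^sub>R x + r *\<^sub>R y)" by (simp add: rho_def)
      moreover have "rho x = ga x" "rho y = ga y" using True by (auto simp: rho_def)
      moreover have "ga x powr s * ga y powr r * exp (s * r * (1 / a) / 2 * (norm (x - y))\<^sup>2) = ga (s *\<^sub>R x + r *\<^sub>R y)"
        unfolding ga_def powr_def using a norm_convex_combination_identity[OF sr(3), of x y]
        by (simp add: exp_add[symmetric] field_simps)
      ultimately show ?thesis by simp
    next
      case False
      then have "rho x = 0 \<or> rho y = 0" using rho(3) by (auto simp: not_le)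
      then show ?thesis using rho(1) by auto
    qed
  qed (use a pP pz(2) in auto)
  have iN: "integrable lborel (\<lambda>x. (w x)\<^sup>2)"
    using C(3) R by (intro continuous_bounded_support_integrable[of _ R] continuous_intros) auto
  have iX: "integrable lborel (\<lambda>x. (w x)\<^sup>2 * (norm x)\<^sup>2)"
    using C(3) R by (intro continuous_bounded_support_integrable[of _ R] continuous_intros) auto
  have iW: "integrable lborel (\<lambda>x. (norm (W x))\<^sup>2)"
    using C(2) RW by (intro continuous_bounded_support_integrable[of _ R] continuous_intros) auto
  have iWx: "integrable lborel (\<lambda>x. w x * (W x \<bullet> x))"
    using C(2,3) R by (intro continuous_bounded_support_integrable[of _ R] continuous_intros) auto
  have entp: "(p x)\<^sup>2 * ln ((p x)\<^sup>2) * rho x = (w x)\<^sup>2 * ln ((w x)\<^sup>2) + 1 / (2 * a) * ((w x)\<^sup>2 * (norm x)\<^sup>2)" for x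
  proof (cases "w x = 0")
    case False
    have "ln ((p x)\<^sup>2) = ln ((w x)\<^sup>2) + (norm x)\<^sup>2 / (2 * a)"
      using False a by (simp add: p_def power_mult_distrib ln_mult ln_realpow)
    then have "(p x)\<^sup>2 * ln ((p x)\<^sup>2) * rho x = ((p x)\<^sup>2 * rho x) * (ln ((w x)\<^sup>2) + (norm x)\<^sup>2 / (2 * a))" by simp
    then show ?thesis unfolding p2 by (simp add: distrib_left)
  qed (simp add: p_def)
  have iE: "integrable lborel (\<lambda>x. (w x)\<^sup>2 * ln ((w x)\<^sup>2))"
  proof -
    obtain B where B: "0 \<le> B" "\<And>x. norm (w x) \<le> B" using continuous_bounded_support_bound[OF C(3) R] by blast
    show ?thesis
    proof (rule integrable_bounded_support[where R=R and K="2 + B\<^sup>2 * B\<^sup>2"])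
      show "\<bar>(w x)\<^sup>2 * ln ((w x)\<^sup>2)\<bar> \<le> 2 + B\<^sup>2 * B\<^sup>2" for x
        using B(2)[of x] B(1) by (intro abs_mult_ln_le) (auto simp: abs_le_square_iff[symmetric])
    qed (use R in auto)
  qed
  have radial: "(\<integral>x. w x * (W x \<bullet> x) \<partial>lborel) \<le> 0"
  proof -
    have "(\<integral>x. (w x *\<^sub>R W x + w x *\<^sub>R W x) \<bullet> x \<partial>lborel) = - real DIM('a) * (\<integral>x. w x * w x \<partial>lborel)"
      by (rule integral_gradient_radial[OF C1_gradient_mult[OF w w], where R=R]) (simp add: R)
    also have "(\<lambda>x. (w x *\<^sub>R W x + w x *\<^sub>R W x) \<bullet> x) = (\<lambda>x. 2 * (w x * (W x \<bullet> x)))" by (simp add: inner_add_left)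
    finally have "2 * (\<integral>x. w x * (W x \<bullet> x) \<partial>lborel) = - real DIM('a) * (\<integral>x. w x * w x \<partial>lborel)" by simp
    moreover have "0 \<le> real DIM('a) * (\<integral>x. w x * w x \<partial>lborel)" by (simp add: integral_nonneg_AE)
    ultimately show ?thesis by linarith
  qed
  have "(\<integral>x. (norm (P x))\<^sup>2 * rho x \<partial>lborel) = (\<integral>x. (norm (W x))\<^sup>2 + 1 / a * (w x * (W x \<bullet> x)) + 1 / (4 * a\<^sup>2) * ((w x)\<^sup>2 * (norm x)\<^sup>2) \<partial>lborel)"
    unfolding P2
  proof (intro Bochner_Integration.integral_cong refl)
    fix x
    show "(norm (W x + (w x / (2 * a)) *\<^sub>R x))\<^sup>2 = (norm (W x))\<^sup>2 + 1 / a * (w x * (W x \<bullet> x)) + 1 / (4 * a\<^sup>2) * ((w x)\<^sup>2 * (norm x)\<^sup>2)"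
    proof -
      have "(norm (u + c *\<^sub>R x))\<^sup>2 = (norm u)\<^sup>2 + 2 * c * (u \<bullet> x) + c\<^sup>2 * (norm x)\<^sup>2" for u and c :: real
        unfolding power2_norm_eq_inner
        by (simp add: inner_add_left inner_add_right inner_commute power2_eq_square algebra_simps)
      then show ?thesis by (simp add: power_divide power_mult_distrib)
    qed
  qed
  also have "\<dots> = (\<integral>x. (norm (W x))\<^sup>2 \<partial>lborel) + 1 / a * (\<integral>x. w x * (W x \<bullet> x) \<partial>lborel) + 1 / (4 * a\<^sup>2) * (\<integral>x. (w x)\<^sup>2 * (norm x)\<^sup>2 \<partial>lborel)"
    using iW iWx iX by simp
  finally have PPe: "(\<integral>x. (norm (P x))\<^sup>2 * rho x \<partial>lborel) = (\<integral>x. (norm (W x))\<^sup>2 \<partial>lborel) + 1 / a * (\<integral>x. w x * (W x \<bullet> x) \<partial>lborel) + 1 / (4 * a\<^sup>2) * (\<integral>x. (w x)\<^sup>2 * (norm x)\<^sup>2 \<partial>lborel)" .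
  have "2 / (1/a) * (\<integral>x. (norm (P x))\<^sup>2 * rho x \<partial>lborel) = 2 * a * (\<integral>x. (norm (W x))\<^sup>2 \<partial>lborel) + 2 * (\<integral>x. w x * (W x \<bullet> x) \<partial>lborel) + 1 / (2 * a) * (\<integral>x. (w x)\<^sup>2 * (norm x)\<^sup>2 \<partial>lborel)"
  proof -
    have "2 / (1 / a) * (X + 1 / a * Y + 1 / (4 * a\<^sup>2) * V) = 2 * a * X + 2 * Y + 1 / (2 * a) * V" for X Y V :: real
      using a by (simp add: distrib_left power2_eq_square)
    then show ?thesis unfolding PPe .
  qed
  moreover have "(\<integral>x. (p x)\<^sup>2 * ln ((p x)\<^sup>2) * rho x \<partial>lborel) = (\<integral>x. (w x)\<^sup>2 * ln ((w x)\<^sup>2) \<partial>lborel) + 1 / (2 * a) * (\<integral>x. (w x)\<^sup>2 * (norm x)\<^sup>2 \<partial>lborel)"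
    unfolding entp using iE iX by simp
  ultimately have main: "(\<integral>x. (w x)\<^sup>2 * ln ((w x)\<^sup>2) \<partial>lborel) \<le> 2 * a * (\<integral>x. (norm (W x))\<^sup>2 \<partial>lborel) + N * ln (N / Z)"
    using LS radial by linarith
  have N0: "0 \<le> N" unfolding N_def by (intro integral_nonneg_AE) auto
  have dln: "0 \<le> \<bar>ln V\<bar> - DIM('a) / 2 * ln a"
  proof -
    have "real DIM('a) / 2 * ln a \<le> 0" using a by (intro mult_nonneg_nonpos) auto
    then show ?thesis by linarith
  qed
  have "N * ln (N / Z) \<le> \<bar>ln V\<bar> - DIM('a) / 2 * ln a"
  proof (cases "N = 0")
    case False
    then have N: "0 < N" using N0 by simp
    have "N * ln (N / Z) = N * ln N + N * (- ln Z)" using N Z by (simp add: ln_div algebra_simps)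
    also have "N * ln N \<le> 0" using N N1 by (simp add: N_def mult_nonneg_nonpos)
    also have "N * (- ln Z) \<le> N * (\<bar>ln V\<bar> - DIM('a) / 2 * ln a)" using lnZ N by (intro mult_left_mono) auto
    also have "\<dots> \<le> 1 * (\<bar>ln V\<bar> - DIM('a) / 2 * ln a)"
      by (intro mult_right_mono dln) (use N1 in \<open>simp add: N_def\<close>)
    finally show ?thesis by simp
  qed (use dln in simp)
  with main show ?thesis by (simp add: V_def)
qed


text \<open>The entropy bound is applied to $w = \psi^2/\sqrt{1+\psi^2}$, which behaves like $|\psi|$ where $\psi$ is large, but
  has $w^2\log(1/w^2) = O(\psi^2)$, so that the negative part of its entropy integrand is harmless.\<close>

lemma entropy_one_plus_le_fisher:
  fixes psi :: "'a::euclidean_space \<Rightarrow> real"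
  assumes psi: "C1_gradient psi G" and R: "\<And>x. R < norm x \<Longrightarrow> psi x = 0"
    and N1: "(\<integral>x. (psi x)\<^sup>2 \<partial>lborel) = 1" and a: "0 < a" "a \<le> 1" and K: "0 \<le> K"
  shows "(\<integral>x. (psi x)\<^sup>2 * ln (1 + K * (psi x)\<^sup>2) \<partial>lborel)
     \<le> 4 * a * (\<integral>x. (norm (G x))\<^sup>2 \<partial>lborel) + (ln (1 + K) + 3 + \<bar>ln (exp (-1/2) * measure lborel (ball (0::'a) 1))\<bar>) - DIM('a) / 2 * ln a"
proof -
  note C = C1_gradientD[OF psi]
  have RG: "\<And>x. R < norm x \<Longrightarrow> G x = 0" using C1_gradient_zero_outside[OF psi R] .
  define h where "h s = s\<^sup>2 / sqrt (1 + s\<^sup>2)" for s :: real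
  define h' where "h' s = (2 * s + s ^ 3) / ((1 + s\<^sup>2) * sqrt (1 + s\<^sup>2))" for s :: real
  have p1: "0 < 1 + s\<^sup>2" for s :: real by (simp add: add_pos_nonneg)
  have hd: "(h has_real_derivative h' s) (at s)" for s
  proof -
    let ?q = "sqrt (1 + s\<^sup>2)"
    have q: "?q * ?q = 1 + s\<^sup>2" "0 < ?q" using p1[of s] by auto
    have "(h has_real_derivative (2 * s * ?q - s\<^sup>2 * (2 * s / (2 * ?q))) / (?q * ?q)) (at s)"
      unfolding h_def using p1[of s] by (auto intro!: derivative_eq_intros simp: field_simps)
    also have "(2 * s * ?q - s\<^sup>2 * (2 * s / (2 * ?q))) / (?q * ?q) = (2 * s * (?q * ?q) - s ^ 3) / ((?q * ?q) * ?q)"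
      using q(2) by (simp add: field_simps power2_eq_square power3_eq_cube)
    also have "\<dots> = h' s" unfolding q(1) h'_def by (simp add: algebra_simps power2_eq_square power3_eq_cube)
    finally show ?thesis .
  qed
  have hc: "continuous_on S h'" for S
  proof -
    have "(1 + s\<^sup>2) * sqrt (1 + s\<^sup>2) \<noteq> 0" for s :: real using p1[of s] by simp
    then show ?thesis unfolding h'_def by (intro continuous_intros) auto
  qed
  \<comment> \<open>The bound 2 turns the factor \<open>2 * a\<close> of the entropy inequality into
    \<open>4 * a\<close>.\<close>
  have hb: "(h' s)\<^sup>2 \<le> 2" for s
  proof -
    define x where "x = s\<^sup>2"
    have x0: "0 \<le> x" by (simp add: x_def)
    have "h' s = (s * (2 + x)) / ((1 + x) * sqrt (1 + x))"
      by (simp add: h'_def x_def algebra_simps power3_eq_cube power2_eq_square)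
    then have "(h' s)\<^sup>2 = (s * (2 + x))\<^sup>2 / ((1 + x)\<^sup>2 * (1 + x))"
      using x0 by (simp add: power_divide power_mult_distrib)
    also have "\<dots> = x * (2 + x)\<^sup>2 / ((1 + x)\<^sup>2 * (1 + x))" by (simp add: x_def power_mult_distrib)
    also have "\<dots> \<le> 2"
    proof -
      have "x * (2 + x)\<^sup>2 \<le> 2 * ((1 + x)\<^sup>2 * (1 + x))" using x0
        by (simp add: power2_eq_square algebra_simps)
      then show ?thesis using x0 by (simp add: divide_le_eq zero_less_mult_iff)
    qed
    finally show ?thesis .
  qed
  have h2: "(h s)\<^sup>2 = (s\<^sup>2)\<^sup>2 / (1 + s\<^sup>2)" for s using p1[of s] by (simp add: h_def power_divide)
  have h2le: "(h s)\<^sup>2 \<le> s\<^sup>2" for s unfolding h2 using p1[of s] by (simp add: divide_le_eq power2_eq_square algebra_simps)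
  \<comment> \<open>Put x = s^2 and w = x^2 / (1 + x), so that ln w = 2 ln x - ln (1 + x). Then w ln
    (1 + x) exceeds w ln w by 2 w (ln (1 + x) - ln x), which is at most 2 x / (1 + x), and the rest
    x - w = x / (1 + x) contributes at most x.\<close>
  have pw: "s\<^sup>2 * ln (1 + K * s\<^sup>2) \<le> (h s)\<^sup>2 * ln ((h s)\<^sup>2) + (ln (1 + K) + 3) * s\<^sup>2" for s
  proof (cases "s = 0")
    case False
    define x where "x = s\<^sup>2"
    have x: "0 < x" using False by (simp add: x_def)
    have "ln (1 + K * x) \<le> ln ((1 + K) * (1 + x))" using x K
      by (subst ln_le_cancel_iff) (auto simp: algebra_simps add_pos_nonneg)
    also have "\<dots> = ln (1 + K) + ln (1 + x)" using x K by (simp add: ln_mult)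
    finally have 1: "x * ln (1 + K * x) \<le> x * ln (1 + K) + x * ln (1 + x)"
      using x by (metis distrib_left mult_left_mono less_imp_le)
    define w where "w = x\<^sup>2 / (1 + x)"
    have w: "0 < w" using x by (simp add: w_def)
    have lnw: "ln w = 2 * ln x - ln (1 + x)" using x by (simp add: w_def ln_div ln_realpow)
    have "ln ((1 + x) / x) \<le> (1 + x) / x - 1" using x by (intro ln_le_minus_one) auto
    then have l1: "ln (1 + x) - ln x \<le> 1 / x" using x by (simp add: ln_div field_simps)
    have l2: "ln (1 + x) \<le> x" using x ln_add_one_self_le_self[of x] by simp
    have "(x\<^sup>2 + x) / (1 + x) = x" using x by (simp add: divide_eq_eq power2_eq_square algebra_simps)
    then have xw: "x = w + x / (1 + x)" by (simp add: w_def add_divide_distrib)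
    have "x * ln (1 + x) = w * ln (1 + x) + x / (1 + x) * ln (1 + x)" by (subst xw) (simp add: distrib_right)
    also have "\<dots> = w * ln w + 2 * w * (ln (1 + x) - ln x) + x / (1 + x) * ln (1 + x)"
      by (simp add: lnw algebra_simps)
    also have "2 * w * (ln (1 + x) - ln x) \<le> 2 * w * (1 / x)" using l1 w by (intro mult_left_mono) auto
    also have "2 * w * (1 / x) = 2 * x / (1 + x)" using x by (simp add: w_def power2_eq_square)
    also have "x / (1 + x) * ln (1 + x) \<le> x / (1 + x) * x" using l2 x by (intro mult_left_mono) auto
    also have "2 * x / (1 + x) \<le> 2 * x" using x by (simp add: divide_le_eq algebra_simps)
    also have "x / (1 + x) * x \<le> x" using x by (simp add: field_simps)
    finally have "x * ln (1 + x) \<le> w * ln w + 3 * x" by simp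
    with 1 show ?thesis by (simp add: h2 x_def w_def algebra_simps)
  qed (simp add: h_def)
  define w where "w x = h (psi x)" for x
  define W where "W x = h' (psi x) *\<^sub>R G x" for x
  have wW: "C1_gradient w W" unfolding w_def W_def by (rule C1_gradient_compose[OF psi hd hc])
  have wR: "w x = 0" if "R < norm x" for x using R[OF that] by (simp add: w_def h_def)
  have ci: "continuous_on UNIV w" "continuous_on UNIV W" using C1_gradientD[OF wW] by auto
  have ip: "integrable lborel (\<lambda>x. (psi x)\<^sup>2)"
    using C(3) R by (intro continuous_bounded_support_integrable[of _ R] continuous_intros) auto
  have iw: "integrable lborel (\<lambda>x. (w x)\<^sup>2)"
    using ci wR by (intro continuous_bounded_support_integrable[of _ R] continuous_intros) auto
  have iW: "integrable lborel (\<lambda>x. (norm (W x))\<^sup>2)"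
    using ci RG by (intro continuous_bounded_support_integrable[of _ R] continuous_intros) (auto simp: W_def)
  have iG: "integrable lborel (\<lambda>x. (norm (G x))\<^sup>2)"
    using C RG by (intro continuous_bounded_support_integrable[of _ R] continuous_intros) auto
  have "1 + K * (psi x)\<^sup>2 \<noteq> 0" for x using K by (metis add_pos_nonneg less_irrefl mult_nonneg_nonneg zero_le_power2 zero_less_one)
  then have il: "integrable lborel (\<lambda>x. (psi x)\<^sup>2 * ln (1 + K * (psi x)\<^sup>2))"
    using C(3) R by (intro continuous_bounded_support_integrable[of _ R] continuous_intros) auto
  have [measurable]: "w \<in> borel_measurable borel" using C1_gradient_measurable[OF wW] by auto
  obtain B where B: "0 \<le> B" "\<And>x. norm (w x) \<le> B" by (rule continuous_bounded_support_bound[OF ci(1) wR]) auto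
  have iE: "integrable lborel (\<lambda>x. (w x)\<^sup>2 * ln ((w x)\<^sup>2))"
  proof (rule integrable_bounded_support[where R=R and K="2 + B\<^sup>2 * B\<^sup>2"])
    show "\<bar>(w x)\<^sup>2 * ln ((w x)\<^sup>2)\<bar> \<le> 2 + B\<^sup>2 * B\<^sup>2" for x
      using B(2)[of x] B(1) by (intro abs_mult_ln_le) (auto simp: abs_le_square_iff[symmetric])
  qed (use wR in auto)
  have "(\<integral>x. (w x)\<^sup>2 \<partial>lborel) \<le> (\<integral>x. (psi x)\<^sup>2 \<partial>lborel)"
    using h2le by (intro integral_mono iw ip) (simp add: w_def)
  then have ent: "(\<integral>x. (w x)\<^sup>2 * ln ((w x)\<^sup>2) \<partial>lborel)
     \<le> 2 * a * (\<integral>x. (norm (W x))\<^sup>2 \<partial>lborel) + \<bar>ln (exp (-1/2) * measure lborel (ball (0::'a) 1))\<bar> - DIM('a) / 2 * ln a"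
    using N1 a by (intro entropy_le_fisher_lborel[OF wW wR]) auto
  have "(\<integral>x. (norm (W x))\<^sup>2 \<partial>lborel) \<le> (\<integral>x. 2 * (norm (G x))\<^sup>2 \<partial>lborel)"
    using hb iG by (intro integral_mono iW) (auto simp: W_def power_mult_distrib intro!: mult_right_mono)
  then have "2 * a * (\<integral>x. (norm (W x))\<^sup>2 \<partial>lborel) \<le> 2 * a * (2 * (\<integral>x. (norm (G x))\<^sup>2 \<partial>lborel))"
    using a by (intro mult_left_mono) auto
  moreover have "(\<integral>x. (psi x)\<^sup>2 * ln (1 + K * (psi x)\<^sup>2) \<partial>lborel)
      \<le> (\<integral>x. (w x)\<^sup>2 * ln ((w x)\<^sup>2) + (ln (1 + K) + 3) * (psi x)\<^sup>2 \<partial>lborel)"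
    using pw by (intro integral_mono il Bochner_Integration.integrable_add iE integrable_mult_right ip) (simp add: w_def)
  moreover have "\<dots> = (\<integral>x. (w x)\<^sup>2 * ln ((w x)\<^sup>2) \<partial>lborel) + (ln (1 + K) + 3)"
    using iE ip N1 by simp
  ultimately show ?thesis using ent by linarith
qed

section \<open>Estimates away from the minimizer\<close>

text \<open>A $C^1$ step from 0 to 1, chosen such that $1$ minus its square is log-concave.\<close>

definition step_profile :: "real \<Rightarrow> real" where
  "step_profile s = 1 - (max 0 (1 - (max 0 s)\<^sup>2))\<^sup>2"

definition step_profile' :: "real \<Rightarrow> real" where
  "step_profile' s = 4 * max 0 (1 - (max 0 s)\<^sup>2) * max 0 s"

lemma DERIV_square_max_0: "((\<lambda>s::real. (max 0 s)\<^sup>2) has_real_derivative 2 * max 0 s) (at s)"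
proof -
  consider "s < 0" | "s > 0" | "s = 0" by linarith
  then show ?thesis
  proof cases
    case 1
    have "((\<lambda>s::real. 0) has_real_derivative 0) (at s)" by auto
    then have "((\<lambda>s::real. (max 0 s)\<^sup>2) has_real_derivative 0) (at s)"
      by (rule has_field_derivative_transform_within_open[where S="{..<0}"]) (use 1 in \<open>auto simp: max_def\<close>)
    then show ?thesis using 1 by (simp add: max_def)
  next
    case 2
    have "((\<lambda>s::real. s\<^sup>2) has_real_derivative 2 * s) (at s)" by (auto intro!: derivative_eq_intros)
    then have "((\<lambda>s::real. (max 0 s)\<^sup>2) has_real_derivative 2 * s) (at s)"
      by (rule has_field_derivative_transform_within_open[where S="{0<..}"]) (use 2 in \<open>auto simp: max_def\<close>)
    then show ?thesis using 2 by (simp add: max_def)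
  next
    case 3
    have "((\<lambda>h::real. (max 0 h)\<^sup>2 / h) \<longlongrightarrow> 0) (at 0)"
    proof (rule Lim_null_comparison)
      show "\<forall>\<^sub>F h::real in at 0. norm ((max 0 h)\<^sup>2 / h) \<le> \<bar>h\<bar>"
        by (intro always_eventually allI) (auto simp: max_def power2_eq_square)
      show "((\<lambda>h::real. \<bar>h\<bar>) \<longlongrightarrow> 0) (at 0)" by (intro tendsto_eq_intros refl) auto
    qed
    then show ?thesis using 3 by (simp add: DERIV_def)
  qed
qed

lemma step_profile_DERIV: "(step_profile has_real_derivative step_profile' s) (at s)"
proof -
  have "((\<lambda>s. 1 - (max 0 s)\<^sup>2) has_real_derivative - (2 * max 0 s)) (at s)"
    by (rule derivative_eq_intros DERIV_square_max_0 refl)+ simp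
  from DERIV_chain2[OF DERIV_square_max_0 this]
  have "((\<lambda>s. (max 0 (1 - (max 0 s)\<^sup>2))\<^sup>2) has_real_derivative - step_profile' s) (at s)"
    by (simp add: step_profile'_def algebra_simps)
  from DERIV_diff[OF DERIV_const[of 1] this] show ?thesis unfolding step_profile_def[abs_def] by simp
qed

lemma step_profile'_cont: "continuous_on S step_profile'"
  unfolding step_profile'_def by (intro continuous_intros)

lemma step_profile_0: "s \<le> 0 \<Longrightarrow> step_profile s = 0" "s \<le> 0 \<Longrightarrow> step_profile' s = 0"
  by (auto simp: step_profile_def step_profile'_def max_def)

lemma step_profile_1: assumes "1 \<le> s" shows "step_profile s = 1" "step_profile' s = 0"
proof -
  have "1 \<le> s\<^sup>2" using assms by simp
  moreover have "max 0 s = s" using assms by simp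
  ultimately have "max 0 (1 - (max 0 s)\<^sup>2) = 0" by simp
  then show "step_profile s = 1" "step_profile' s = 0" by (auto simp: step_profile_def step_profile'_def)
qed

lemma step_profile_bounds: "0 \<le> step_profile s" "step_profile s \<le> 1" "0 \<le> step_profile' s" "step_profile' s \<le> 4"
proof -
  define m where "m = max 0 (1 - (max 0 s)\<^sup>2)"
  have m: "0 \<le> m" "m \<le> 1" by (auto simp: m_def)
  have sp: "step_profile s = 1 - m\<^sup>2" "step_profile' s = 4 * m * max 0 s" by (auto simp: step_profile_def step_profile'_def m_def)
  show "0 \<le> step_profile s" "step_profile s \<le> 1" using m by (auto simp: sp power_le_one)
  show "0 \<le> step_profile' s" using m by (simp add: sp)
  show "step_profile' s \<le> 4"
  proof (cases "s \<le> 1")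
    case True
    then have "m * max 0 s \<le> 1 * 1" using m by (intro mult_mono) auto
    then show ?thesis by (simp add: sp)
  qed (use step_profile_1 in auto)
qed

text \<open>The step is a function of the squared distance, which is smooth at the centre and
  convex. The transition takes place while the squared distance runs from \<open>A\<close> to
  \<open>A + D\<close>.\<close>

definition radial_step :: "'a::euclidean_space \<Rightarrow> real \<Rightarrow> real \<Rightarrow> 'a \<Rightarrow> real" where
  "radial_step c A D x = step_profile (((norm (x - c))\<^sup>2 - A) / D)"

definition radial_step_gradient :: "'a::euclidean_space \<Rightarrow> real \<Rightarrow> real \<Rightarrow> 'a \<Rightarrow> 'a" where
  "radial_step_gradient c A D x = (step_profile' (((norm (x - c))\<^sup>2 - A) / D) * (2 / D)) *\<^sub>R (x - c)"

lemma radial_step_C1: assumes "0 < D" shows "C1_gradient (radial_step c A D) (radial_step_gradient c A D)"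
proof -
  have n: "C1_gradient (\<lambda>x. (norm (x - c))\<^sup>2) (\<lambda>x. 2 *\<^sub>R (x - c))"
    unfolding power2_norm_eq_inner
    by (auto simp: C1_gradient_def gderiv_def inner_commute intro!: derivative_eq_intros continuous_intros)
  have "((\<lambda>s. step_profile ((s - A) / D)) has_real_derivative step_profile' ((s - A) / D) * (1 / D)) (at s)" for s
    by (rule DERIV_chain2[OF step_profile_DERIV]) (use assms in \<open>auto intro!: derivative_eq_intros\<close>)
  moreover have "continuous_on S (\<lambda>s. step_profile' ((s - A) / D) * (1 / D))" for S
    using assms by (intro continuous_intros continuous_on_compose2[OF step_profile'_cont[of UNIV]]) (auto simp: divide_inverse intro!: continuous_intros)
  ultimately show ?thesis
    using C1_gradient_compose[OF n, of "\<lambda>s. step_profile ((s - A) / D)" "\<lambda>s. step_profile' ((s - A) / D) * (1 / D)"]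
    by (simp add: radial_step_def[abs_def] radial_step_gradient_def[abs_def] mult_ac)
qed

lemma radial_step_bounds: "0 \<le> radial_step c A D x" "radial_step c A D x \<le> 1"
  by (auto simp: radial_step_def step_profile_bounds)

lemma radial_step_inner:
  "0 < D \<Longrightarrow> (norm (x - c))\<^sup>2 \<le> A \<Longrightarrow> radial_step c A D x = 0"
  "0 < D \<Longrightarrow> (norm (x - c))\<^sup>2 \<le> A \<Longrightarrow> radial_step_gradient c A D x = 0"
  by (auto simp: radial_step_def radial_step_gradient_def divide_le_0_iff intro!: step_profile_0)

lemma radial_step_outer:
  "0 < D \<Longrightarrow> A + D \<le> (norm (x - c))\<^sup>2 \<Longrightarrow> radial_step c A D x = 1"
  "0 < D \<Longrightarrow> A + D \<le> (norm (x - c))\<^sup>2 \<Longrightarrow> radial_step_gradient c A D x = 0"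
  by (auto simp: radial_step_def radial_step_gradient_def le_divide_eq intro!: step_profile_1)

lemma radial_step_gradient_le:
  assumes "0 < D" "0 \<le> A"
  shows "norm (radial_step_gradient c A D x) \<le> 8 * sqrt (A + D) / D"
proof (cases "A + D \<le> (norm (x - c))\<^sup>2")
  case True
  then show ?thesis using assms by (simp add: radial_step_outer)
next
  case False
  then have "norm (x - c) \<le> sqrt (A + D)" by (simp add: real_le_rsqrt)
  then have "step_profile' (((norm (x - c))\<^sup>2 - A) / D) * (2 / D) * norm (x - c) \<le> 4 * (2 / D) * sqrt (A + D)"
    using assms step_profile_bounds by (intro mult_mono) auto
  then show ?thesis using assms step_profile_bounds(3) by (simp add: radial_step_gradient_def abs_mult)
qed

section \<open>Gibbs measures of a potential with a unique minimizer\<close>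

locale gibbs_potential =
  fixes f :: "'a::euclidean_space \<Rightarrow> real" and a :: 'a
  assumes f2: "C_k 2 f"
    and exp_integrable: "0 < t \<Longrightarrow> integrable lborel (\<lambda>x. exp (- f x / t))"
    and min: "x \<noteq> a \<Longrightarrow> f a < f x"
begin

abbreviation "G \<equiv> gradient f"

definition Z :: "real \<Rightarrow> real" where "Z t = (\<integral>x. exp (- f x / t) \<partial>lborel)"

definition dens :: "real \<Rightarrow> 'a \<Rightarrow> real" where "dens t x = exp (- f x / t) / Z t"

lemma f_C1: "C1_gradient f G" by (rule C_k_2_gradient(1)[OF f2])

lemma f_min: "f a \<le> f x" using min[of x] by (cases "x = a") auto

lemma f_measurable [measurable]: "f \<in> borel_measurable borel" "G \<in> borel_measurable borel"
  using C1_gradient_measurable[OF f_C1] by auto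

lemma Z_nonneg_nonzero: assumes "0 < t" shows "0 \<le> Z t" "Z t \<noteq> 0"
proof -
  show "0 \<le> Z t" unfolding Z_def by (intro integral_nonneg_AE) auto
  show "Z t \<noteq> 0"
  proof
    assume "Z t = 0"
    then have "AE x in lborel. exp (- f x / t) = 0"
      unfolding Z_def using exp_integrable[OF assms] by (subst (asm) integral_nonneg_eq_0_iff_AE) auto
    then have "AE x in lborel. (x::'a) \<notin> UNIV" by simp
    then have "(UNIV::'a set) \<in> null_sets lborel" by (subst AE_iff_null_sets) auto
    then show False by (simp add: null_sets_def)
  qed
qed

lemma Z_pos: "0 < t \<Longrightarrow> 0 < Z t"
  by (rule ccontr) (use Z_nonneg_nonzero in force)

lemma dens_pos: "0 < t \<Longrightarrow> 0 < dens t x" using Z_pos by (simp add: dens_def)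

lemma dens_measurable [measurable]: "dens t \<in> borel_measurable borel" unfolding dens_def by measurable

lemma dens_integrable: "0 < t \<Longrightarrow> integrable lborel (dens t)"
  unfolding dens_def using exp_integrable by simp

lemma gibbs_eq: "gibbs f t = density lborel (\<lambda>x. ennreal (dens t x))"
  unfolding gibbs_def dens_def Z_def ..

lemma sets_gibbs [simp, measurable_cong]: "sets (gibbs f t) = sets borel" by (simp add: gibbs_eq)

lemma space_gibbs [simp]: "space (gibbs f t) = UNIV" by (simp add: gibbs_eq)

lemma prob_gibbs: assumes "0 < t" shows "prob_space (gibbs f t)"
proof
  have "emeasure (gibbs f t) (space (gibbs f t)) = (\<integral>\<^sup>+x. ennreal (dens t x) \<partial>lborel)"
    by (simp add: gibbs_eq emeasure_density)
  also have "\<dots> = ennreal (\<integral>x. dens t x \<partial>lborel)"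
    using dens_integrable[OF assms] dens_pos[OF assms] by (intro nn_integral_eq_integral) (auto simp: less_imp_le)
  also have "(\<integral>x. dens t x \<partial>lborel) = 1" using Z_pos[OF assms] by (simp add: dens_def Z_def)
  finally show "emeasure (gibbs f t) (space (gibbs f t)) = 1" by simp
qed

lemma integral_gibbs:
  assumes "0 < t" and [measurable]: "h \<in> borel_measurable borel"
  shows "(\<integral>x. h x \<partial>gibbs f t) = (\<integral>x. h x * dens t x \<partial>lborel)"
  unfolding gibbs_eq using dens_pos[OF assms(1)]
  by (subst integral_density) (auto simp: less_imp_le mult.commute)

lemma integrable_gibbs:
  fixes h :: "'a \<Rightarrow> real"
  assumes "0 < t" and [measurable]: "h \<in> borel_measurable borel" and "\<And>x. \<bar>h x\<bar> \<le> B"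
  shows "integrable (gibbs f t) h"
proof -
  interpret prob_space "gibbs f t" by (rule prob_gibbs) fact
  show ?thesis by (rule integrable_const_bound[where B=B]) (use assms(3) in auto)
qed

end

text \<open>Adds what the upper bound uses. The lower bound lives in \<open>gibbs_potential\<close>,
  since it must also cover the case in which no PL constant exists.\<close>

locale PL_potential = gibbs_potential f a for f :: "'a::euclidean_space \<Rightarrow> real" and a :: 'a +
  fixes L C :: real
  assumes L: "0 < L"
    and lap: "laplacian f x \<le> L * (1 + (norm (gradient f x))\<^sup>2)"
    and C: "0 < C" and PL: "f x - f a \<le> C / 2 * (norm (gradient f x))\<^sup>2"
begin

text \<open>Quadratic growth bounds \<open>f x - f a\<close> from below, and PL bounds it from above
  by the gradient.\<close>

lemma gradient_lower: assumes "r \<le> norm (x - a)" "0 \<le> r" shows "r\<^sup>2 / C\<^sup>2 \<le> (norm (G x))\<^sup>2"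
proof -
  have "r\<^sup>2 / (2 * C) \<le> (norm (x - a))\<^sup>2 / (2 * C)" using assms C by (intro divide_right_mono power_mono) auto
  also have "\<dots> \<le> f x - f a" by (rule PL_quadratic_growth[OF C1_gradientD(1)[OF f_C1] C PL min])
  also have "\<dots> \<le> C / 2 * (norm (G x))\<^sup>2" by (rule PL)
  finally show ?thesis using C by (simp add: field_simps power2_eq_square)
qed

text \<open>With \<open>e\<close> the square root of the density and
  \<open>psi x = v x * e x\<close>, one has e V = Psi + psi G / (2t). Squaring gives a cross term,
  the inner product of the gradient of psi^2 with G, and integration by parts turns it into the
  Laplacian of \<open>f\<close>; this is where the bound on the Laplacian enters. Later arguments
  use \<open>psi\<close> and \<open>Psi\<close> only through the listed properties, hence the
  existential form.\<close>

lemma ground_state: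
  assumes t: "0 < t" and v: "C1_gradient v V" and R: "\<And>x. R < norm x \<Longrightarrow> v x = 0"
  shows "\<exists>psi Psi. C1_gradient psi Psi \<and> (\<forall>x. R < norm x \<longrightarrow> psi x = 0) \<and>
    (\<forall>x. (psi x)\<^sup>2 = (v x)\<^sup>2 * dens t x) \<and>
    4 * t\<^sup>2 * (\<integral>x. (norm (Psi x))\<^sup>2 \<partial>lborel) - 2 * t * L * (\<integral>x. (v x)\<^sup>2 \<partial>gibbs f t) + (1 - 2 * t * L) * (\<integral>x. (v x)\<^sup>2 * (norm (G x))\<^sup>2 \<partial>gibbs f t)
       \<le> 4 * t\<^sup>2 * (\<integral>x. (norm (V x))\<^sup>2 \<partial>gibbs f t)"
proof -
  note vC = C1_gradientD[OF v] and fC = C1_gradientD[OF f_C1]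
  have [measurable]: "v \<in> borel_measurable borel" "V \<in> borel_measurable borel"
    using C1_gradient_measurable[OF v] by auto
  have RV: "\<And>x. R < norm x \<Longrightarrow> V x = 0" using C1_gradient_zero_outside[OF v R] .
  define z where "z = sqrt (Z t)"
  have z: "0 < z" "z\<^sup>2 = Z t" using Z_pos[OF t] by (auto simp: z_def)
  define e where "e x = exp (- f x / (2 * t)) / z" for x
  have eC: "C1_gradient e (\<lambda>x. (- 1 / (2 * t) * e x) *\<^sub>R G x)"
    unfolding e_def
    by (rule C1_gradient_compose[OF f_C1, where h="\<lambda>s. exp (- s / (2 * t)) / z"])
       (use t z in \<open>auto intro!: derivative_eq_intros continuous_intros\<close>)
  have e2: "(e x)\<^sup>2 = dens t x" for x
    using z t by (simp add: e_def dens_def power_divide exp_double[symmetric])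
  define psi where "psi x = v x * e x" for x
  define Psi where "Psi x = v x *\<^sub>R ((- 1 / (2 * t) * e x) *\<^sub>R G x) + e x *\<^sub>R V x" for x
  have pC: "C1_gradient psi Psi" unfolding psi_def Psi_def by (rule C1_gradient_mult[OF v eC])
  have pR: "psi x = 0" "Psi x = 0" if "R < norm x" for x using that R RV by (auto simp: psi_def Psi_def)
  note pc = C1_gradientD[OF pC]
  have psi2: "(psi x)\<^sup>2 = (v x)\<^sup>2 * dens t x" for x by (simp add: psi_def power_mult_distrib e2)
  have pw: "(norm (V x))\<^sup>2 * dens t x = (norm (Psi x))\<^sup>2 + 1 / (2 * t) * ((psi x *\<^sub>R Psi x + psi x *\<^sub>R Psi x) \<bullet> G x) + 1 / (4 * t\<^sup>2) * ((psi x)\<^sup>2 * (norm (G x))\<^sup>2)" for x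
  proof -
    have "e x *\<^sub>R V x = Psi x + (psi x / (2 * t)) *\<^sub>R G x" by (simp add: Psi_def psi_def)
    then have "(norm (V x))\<^sup>2 * dens t x = (norm (Psi x + (psi x / (2 * t)) *\<^sub>R G x))\<^sup>2"
      by (simp add: e2[symmetric] power_mult_distrib[symmetric]) (metis norm_scaleR power2_abs power_mult_distrib mult.commute)
    also have "\<dots> = (norm (Psi x))\<^sup>2 + 2 * (psi x / (2 * t)) * (Psi x \<bullet> G x) + (psi x / (2 * t))\<^sup>2 * (norm (G x))\<^sup>2"
      unfolding power2_norm_eq_inner
      by (simp add: inner_add_left inner_add_right inner_commute power2_eq_square algebra_simps)
    finally show ?thesis by (simp add: inner_add_left power_divide power_mult_distrib)
  qed
  have lc: "continuous_on UNIV (laplacian f)"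
    unfolding C_k_2_gradient(4)[OF f2, abs_def]
    using C1_gradientD(2)[OF C_k_2_gradient(2)[OF f2]] by (intro continuous_intros) auto
  have i1: "integrable lborel (\<lambda>x. (norm (Psi x))\<^sup>2)"
    using pc pR by (intro continuous_bounded_support_integrable[of _ R] continuous_intros) auto
  have i2: "integrable lborel (\<lambda>x. (psi x *\<^sub>R Psi x + psi x *\<^sub>R Psi x) \<bullet> G x)"
    using pc fC pR by (intro continuous_bounded_support_integrable[of _ R] continuous_intros) auto
  have i3: "integrable lborel (\<lambda>x. (psi x)\<^sup>2 * (norm (G x))\<^sup>2)"
    using pc fC pR by (intro continuous_bounded_support_integrable[of _ R] continuous_intros) auto
  have i4: "integrable lborel (\<lambda>x. (psi x)\<^sup>2)"
    using pc fC pR by (intro continuous_bounded_support_integrable[of _ R] continuous_intros) auto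
  have i5: "integrable lborel (\<lambda>x. psi x * psi x * laplacian f x)"
    using pc lc pR by (intro continuous_bounded_support_integrable[of _ R] continuous_intros) auto
  have "(\<integral>x. (norm (V x))\<^sup>2 \<partial>gibbs f t) = (\<integral>x. (norm (V x))\<^sup>2 * dens t x \<partial>lborel)"
    by (rule integral_gibbs[OF t]) measurable
  also have "\<dots> = (\<integral>x. (norm (Psi x))\<^sup>2 \<partial>lborel) + 1 / (2 * t) * (\<integral>x. (psi x *\<^sub>R Psi x + psi x *\<^sub>R Psi x) \<bullet> G x \<partial>lborel)
     + 1 / (4 * t\<^sup>2) * (\<integral>x. (psi x)\<^sup>2 * (norm (G x))\<^sup>2 \<partial>lborel)"
    unfolding pw using i1 i2 i3 by simp
  also have "(\<integral>x. (psi x *\<^sub>R Psi x + psi x *\<^sub>R Psi x) \<bullet> G x \<partial>lborel) = - (\<integral>x. psi x * psi x * laplacian f x \<partial>lborel)"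
    using integral_mult_laplacian[OF f2 C1_gradient_mult[OF pC pC], of R] pR by simp
  finally have eq: "(\<integral>x. (norm (V x))\<^sup>2 \<partial>gibbs f t) = (\<integral>x. (norm (Psi x))\<^sup>2 \<partial>lborel) - 1 / (2 * t) * (\<integral>x. psi x * psi x * laplacian f x \<partial>lborel)
     + 1 / (4 * t\<^sup>2) * (\<integral>x. (psi x)\<^sup>2 * (norm (G x))\<^sup>2 \<partial>lborel)" by simp
  have v2: "(\<integral>x. (v x)\<^sup>2 \<partial>gibbs f t) = (\<integral>x. (psi x)\<^sup>2 \<partial>lborel)"
    unfolding psi2 by (rule integral_gibbs[OF t]) measurable
  have g2: "(\<integral>x. (v x)\<^sup>2 * (norm (G x))\<^sup>2 \<partial>gibbs f t) = (\<integral>x. (psi x)\<^sup>2 * (norm (G x))\<^sup>2 \<partial>lborel)"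
    unfolding psi2 by (subst integral_gibbs[OF t]) (auto simp: mult_ac)
  have "(\<integral>x. psi x * psi x * laplacian f x \<partial>lborel) \<le> (\<integral>x. L * (psi x)\<^sup>2 + L * ((psi x)\<^sup>2 * (norm (G x))\<^sup>2) \<partial>lborel)"
  proof (intro integral_mono i5 Bochner_Integration.integrable_add integrable_mult_right i3 i4)
    fix x
    show "psi x * psi x * laplacian f x \<le> L * (psi x)\<^sup>2 + L * ((psi x)\<^sup>2 * (norm (G x))\<^sup>2)"
      using mult_left_mono[OF lap[of x], of "psi x * psi x"] by (simp add: power2_eq_square algebra_simps)
  qed
  also have "\<dots> = L * (\<integral>x. (psi x)\<^sup>2 \<partial>lborel) + L * (\<integral>x. (psi x)\<^sup>2 * (norm (G x))\<^sup>2 \<partial>lborel)"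
    using i3 i4 by simp
  finally have lapb: "(\<integral>x. psi x * psi x * laplacian f x \<partial>lborel) \<le> \<dots>" .
  have "4 * t\<^sup>2 * (X - 1 / (2 * t) * Y + 1 / (4 * t\<^sup>2) * W) = 4 * t\<^sup>2 * X - 2 * t * Y + W" for X Y W :: real
    using t by (simp add: power2_eq_square algebra_simps)
  then have "4 * t\<^sup>2 * (\<integral>x. (norm (V x))\<^sup>2 \<partial>gibbs f t) = 4 * t\<^sup>2 * (\<integral>x. (norm (Psi x))\<^sup>2 \<partial>lborel) - 2 * t * (\<integral>x. psi x * psi x * laplacian f x \<partial>lborel)
     + (\<integral>x. (psi x)\<^sup>2 * (norm (G x))\<^sup>2 \<partial>lborel)" unfolding eq .
  with mult_left_mono[OF lapb, of "2 * t"] t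
  have "4 * t\<^sup>2 * (\<integral>x. (norm (Psi x))\<^sup>2 \<partial>lborel) - 2 * t * L * (\<integral>x. (v x)\<^sup>2 \<partial>gibbs f t) + (1 - 2 * t * L) * (\<integral>x. (v x)\<^sup>2 * (norm (G x))\<^sup>2 \<partial>gibbs f t)
       \<le> 4 * t\<^sup>2 * (\<integral>x. (norm (V x))\<^sup>2 \<partial>gibbs f t)"
    unfolding v2 g2 by (simp add: algebra_simps)
  with pC pR(1) psi2 show ?thesis by blast
qed


text \<open>Let d = r^2 / C^2, let X and Y be the integrals of v^2 and v^2 |G|^2, and W that of
  |V|^2. The gradient bound gives d X \<le> Y. Dropping the term with \<open>Psi\<close> from the
  ground-state inequality and using 1 - 2tL \<ge> 1/2 and 2tL \<le> d/4 leaves (d/4) X \<le> 4 t^2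
  W, which explains the 16.\<close>

lemma outer_poincare_compact:
  assumes r: "0 < r" and t: "0 < t" "4 * t * L \<le> 1" "8 * t * L \<le> r\<^sup>2 / C\<^sup>2"
    and v: "C1_gradient v V" and R: "\<And>x. R < norm x \<Longrightarrow> v x = 0"
    and v0: "\<And>x. norm (x - a) < r \<Longrightarrow> v x = 0"
  shows "(\<integral>x. (v x)\<^sup>2 \<partial>gibbs f t) \<le> 16 * C\<^sup>2 / r\<^sup>2 * t\<^sup>2 * (\<integral>x. (norm (V x))\<^sup>2 \<partial>gibbs f t)"
    and "r\<^sup>2 / C\<^sup>2 * (\<integral>x. (v x)\<^sup>2 \<partial>gibbs f t) \<le> (\<integral>x. (v x)\<^sup>2 * (norm (G x))\<^sup>2 \<partial>gibbs f t)"
proof -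
  define d where "d = r\<^sup>2 / C\<^sup>2"
  have d: "0 < d" using r C by (simp add: d_def)
  have [measurable]: "v \<in> borel_measurable borel" using C1_gradient_measurable[OF v] by auto
  define X where "X = (\<integral>x. (v x)\<^sup>2 \<partial>gibbs f t)"
  define Y where "Y = (\<integral>x. (v x)\<^sup>2 * (norm (G x))\<^sup>2 \<partial>gibbs f t)"
  define W where "W = (\<integral>x. (norm (V x))\<^sup>2 \<partial>gibbs f t)"
  note vC = C1_gradientD[OF v] and fC = C1_gradientD[OF f_C1]
  have pw: "d * (v x)\<^sup>2 \<le> (v x)\<^sup>2 * (norm (G x))\<^sup>2" for x
  proof (cases "norm (x - a) < r")
    case False
    then have "d \<le> (norm (G x))\<^sup>2" unfolding d_def using r by (intro gradient_lower) auto
    from mult_left_mono[OF this, of "(v x)\<^sup>2"] show ?thesis by (simp add: mult.commute)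
  qed (simp add: v0)
  obtain Bv where "\<And>x. norm (v x) \<le> Bv" by (rule continuous_bounded_support_bound[OF vC(3) R]) auto
  then have vb: "(v x)\<^sup>2 \<le> Bv\<^sup>2" for x by (metis real_norm_def abs_ge_zero power2_abs power_mono)
  have i1: "integrable (gibbs f t) (\<lambda>x. d * (v x)\<^sup>2)"
  proof (rule integrable_gibbs[OF t(1)])
    show "\<bar>d * (v x)\<^sup>2\<bar> \<le> d * Bv\<^sup>2" for x using vb[of x] d by (simp add: abs_mult)
  qed measurable
  obtain Bw where "\<And>x. norm ((v x)\<^sup>2 * (norm (G x))\<^sup>2) \<le> Bw"
    by (rule continuous_bounded_support_bound[of "\<lambda>x. (v x)\<^sup>2 * (norm (G x))\<^sup>2" R]) (use vC fC R in \<open>auto intro!: continuous_intros\<close>)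
  then have i2: "integrable (gibbs f t) (\<lambda>x. (v x)\<^sup>2 * (norm (G x))\<^sup>2)"
    by (intro integrable_gibbs[OF t(1), where B=Bw]) auto
  have "(\<integral>x. d * (v x)\<^sup>2 \<partial>gibbs f t) \<le> Y"
    unfolding Y_def by (rule integral_mono[OF i1 i2 pw])
  then have XY: "d * X \<le> Y" by (simp add: X_def)
  then show "r\<^sup>2 / C\<^sup>2 * (\<integral>x. (v x)\<^sup>2 \<partial>gibbs f t) \<le> (\<integral>x. (v x)\<^sup>2 * (norm (G x))\<^sup>2 \<partial>gibbs f t)"
    by (simp add: d_def X_def Y_def)
  have X0: "0 \<le> X" unfolding X_def by (intro integral_nonneg_AE) auto
  obtain psi Psi where "C1_gradient psi Psi" and g: "4 * t\<^sup>2 * (\<integral>x. (norm (Psi x :: 'a))\<^sup>2 \<partial>lborel) - 2 * t * L * X + (1 - 2 * t * L) * Y \<le> 4 * t\<^sup>2 * W"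
    unfolding X_def Y_def W_def using ground_state[OF t(1) v, of R] R by blast
  have I0: "0 \<le> 4 * t\<^sup>2 * (\<integral>x. (norm (Psi x :: 'a))\<^sup>2 \<partial>lborel)" by (intro mult_nonneg_nonneg integral_nonneg_AE) auto
  have "(1/2) * (d * X) \<le> (1 - 2 * t * L) * Y"
    using XY t d X0 by (intro mult_mono) auto
  moreover have "2 * t * L * X \<le> d / 4 * X" using t X0 by (intro mult_right_mono) (auto simp: d_def)
  ultimately have "d / 4 * X \<le> 4 * t\<^sup>2 * W" using g I0 by linarith
  then have "X \<le> 16 / d * t\<^sup>2 * W" using d by (simp add: field_simps)
  then show "X \<le> 16 * C\<^sup>2 / r\<^sup>2 * t\<^sup>2 * W" by (simp add: d_def)
qed

lemma tendsto_mult_ln_at_right_0: "((\<lambda>t::real. t * ln t) \<longlongrightarrow> 0) (at_right 0)"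
proof (rule Lim_null_comparison)
  have "norm (t * ln t) \<le> 2 * sqrt t" if "0 < t" "t < 1" for t :: real
  proof -
    have "t * ln t \<le> 0" using that by (intro mult_nonneg_nonpos) auto
    then show ?thesis using mult_ln_ge[of t] that by simp
  qed
  then show "\<forall>\<^sub>F t::real in at_right 0. norm (t * ln t) \<le> 2 * sqrt t"
    unfolding eventually_at_right_field by (intro exI[of _ 1]) auto
  show "((\<lambda>t::real. 2 * sqrt t) \<longlongrightarrow> 0) (at_right 0)" by (auto intro!: tendsto_eq_intros)
qed

text \<open>Let I be the Lebesgue integral of |Psi|^2 and Y that of v^2 |G|^2 under the Gibbs
  measure. Multiplied by t, the potential part of the logarithm costs C/2 Y by PL and the other part
  2 C t^2 I; together this is C/2 times the main part 4 t^2 I + Y of the ground-state lower bound.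
  Since \<open>v\<close> is normalized and lives where |G|^2 is at least d, also Y \<ge> d, so every
  remaining constant is absorbed by a small multiple of Y.\<close>

lemma outer_log_Sobolev_compact:
  assumes r: "0 < r" and e: "0 < e"
  shows "\<forall>\<^sub>F t in at_right 0. \<forall>v V R. C1_gradient v V \<longrightarrow> (\<forall>x. R < norm x \<longrightarrow> v x = 0) \<longrightarrow>
      (\<forall>x. norm (x - a) < r \<longrightarrow> v x = 0) \<longrightarrow> (\<integral>x. (v x)\<^sup>2 \<partial>gibbs f t) = 1 \<longrightarrow>
      (\<integral>x. (v x)\<^sup>2 * ln (1 + (v x)\<^sup>2) \<partial>gibbs f t) \<le> 2 * C * t * (1 + e) * (\<integral>x. (norm (V x))\<^sup>2 \<partial>gibbs f t)"
proof -
  define d where "d = r\<^sup>2 / C\<^sup>2"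
  have d: "0 < d" using r C by (simp add: d_def)
  \<comment> \<open>A bound for \<open>Z t * exp (f a / t)\<close> that is uniform in
    \<open>t < 1\<close>.\<close>
  define K where "K = (\<integral>x. exp (- (f x - f a)) \<partial>lborel)"
  have intK: "integrable lborel (\<lambda>x. exp (- (f x - f a) / t))" if "0 < t" for t
    using integrable_mult_right[OF exp_integrable[OF that], of "exp (f a / t)"]
    by (simp add: exp_add[symmetric] diff_divide_distrib)
  have K0: "0 \<le> K" unfolding K_def by (intro integral_nonneg_AE) auto
  define c0 where "c0 = ln (1 + K) + 3 + \<bar>ln (exp (-1/2) * measure lborel (ball (0::'a) 1))\<bar>"
  \<comment> \<open>\<open>t\<close> times the remainder of the entropy inequality with parameter
    \<open>C * t / 2\<close>. With this parameter \<open>t\<close> times the Fisher term is exactly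
    C/2 times \<open>4 * t\<^sup>2 * I\<close>.\<close>
  define eta where "eta t = t * (c0 - DIM('a) / 2 * ln (C * t / 2))" for t
  have eta_lim: "(eta \<longlongrightarrow> 0) (at_right 0)"
  proof -
    have "((\<lambda>t. t * (c0 - DIM('a) / 2 * ln (C / 2)) - DIM('a) / 2 * (t * ln t)) \<longlongrightarrow> 0 * (c0 - DIM('a) / 2 * ln (C / 2)) - DIM('a) / 2 * 0) (at_right 0)"
      by (intro tendsto_intros tendsto_mult_ln_at_right_0)
    then have "((\<lambda>t. t * (c0 - DIM('a) / 2 * ln (C / 2)) - DIM('a) / 2 * (t * ln t)) \<longlongrightarrow> 0) (at_right 0)"
      by simp
    moreover have "\<forall>\<^sub>F t in at_right 0. t * (c0 - DIM('a) / 2 * ln (C / 2)) - DIM('a) / 2 * (t * ln t) = eta t"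
    proof -
      have "t * (c0 - DIM('a) / 2 * ln (C / 2)) - DIM('a) / 2 * (t * ln t) = eta t" if "0 < t" for t
      proof -
        have "ln (C * t / 2) = ln (C / 2) + ln t" using C that ln_mult[of "C / 2" t] by simp
        then show ?thesis unfolding eta_def by (simp add: algebra_simps)
      qed
      then show ?thesis unfolding eventually_at_right_field by (intro exI[of _ 1]) auto
    qed
    ultimately show ?thesis by (rule Lim_transform_eventually)
  qed
  have "\<forall>\<^sub>F t in at_right 0. eta t < C / 2 * (e / 2) * d"
    using eta_lim C e d by (intro order_tendstoD(2)[OF eta_lim]) auto
  moreover have "\<forall>\<^sub>F t in at_right 0. (1 + e) * (2 * t * L) * (1 + 1 / d) < e / 2"
    using e by (intro order_tendstoD(2)[of _ 0]) (auto intro!: tendsto_eq_intros)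
  moreover have "\<forall>\<^sub>F t in at_right 0. C * t / 2 < 1"
    by (intro order_tendstoD(2)[of _ 0]) (auto intro!: tendsto_eq_intros)
  moreover have "\<forall>\<^sub>F t in at_right 0. 4 * t * L < 1"
    by (intro order_tendstoD(2)[of _ 0]) (auto intro!: tendsto_eq_intros)
  moreover have "\<forall>\<^sub>F t in at_right 0. 8 * t * L < d"
    using d by (intro order_tendstoD(2)[of _ 0]) (auto intro!: tendsto_eq_intros)
  moreover have "\<forall>\<^sub>F t::real in at_right 0. 0 < t \<and> t < 1"
    unfolding eventually_at_right_field by (intro exI[of _ 1]) auto
  ultimately show ?thesis
  proof eventually_elim
    case (elim t)
    then have t: "0 < t" "t < 1" and small: "eta t < C / 2 * (e / 2) * d" "(1 + e) * (2 * t * L) * (1 + 1 / d) < e / 2"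
      "C * t / 2 < 1" "4 * t * L < 1" "8 * t * L < d" by auto
    show ?case
    proof (intro allI impI)
      fix v V R assume v: "C1_gradient v V" and R': "\<forall>x. R < norm x \<longrightarrow> v x = 0"
        and v0: "\<forall>x. norm (x - a) < r \<longrightarrow> v x = 0" and one: "(\<integral>x. (v x)\<^sup>2 \<partial>gibbs f t) = 1"
      have R: "\<And>x. R < norm x \<Longrightarrow> v x = 0" using R' by blast
      note vC = C1_gradientD[OF v] and fC = C1_gradientD[OF f_C1]
      have [measurable]: "v \<in> borel_measurable borel" using C1_gradient_measurable[OF v] by auto
      define Y where "Y = (\<integral>x. (v x)\<^sup>2 * (norm (G x))\<^sup>2 \<partial>gibbs f t)"
      define W where "W = (\<integral>x. (norm (V x))\<^sup>2 \<partial>gibbs f t)"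
      have dY: "d \<le> Y"
        using outer_poincare_compact(2)[OF r t(1) _ _ v R, of] small v0 one by (simp add: d_def Y_def)
      obtain psi Psi where pC: "C1_gradient psi Psi" and pR: "\<And>x. R < norm x \<Longrightarrow> psi x = 0"
        and psi2: "\<And>x. (psi x)\<^sup>2 = (v x)\<^sup>2 * dens t x"
        and gs: "4 * t\<^sup>2 * (\<integral>x. (norm (Psi x :: 'a))\<^sup>2 \<partial>lborel) - 2 * t * L * (\<integral>x. (v x)\<^sup>2 \<partial>gibbs f t) + (1 - 2 * t * L) * Y \<le> 4 * t\<^sup>2 * W"
        unfolding Y_def W_def using ground_state[OF t(1) v, of R] R by blast
      define I where "I = (\<integral>x. (norm (Psi x))\<^sup>2 \<partial>lborel)"
      have I0: "0 \<le> I" unfolding I_def by (intro integral_nonneg_AE) auto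
      have psi1: "(\<integral>x. (psi x)\<^sup>2 \<partial>lborel) = 1"
        unfolding psi2 one[symmetric] by (rule integral_gibbs[OF t(1), symmetric]) measurable
      have ent: "(\<integral>x. (psi x)\<^sup>2 * ln (1 + K * (psi x)\<^sup>2) \<partial>lborel) \<le> 4 * (C * t / 2) * I + c0 - DIM('a) / 2 * ln (C * t / 2)"
        using entropy_one_plus_le_fisher[OF pC _ psi1, of R "C * t / 2" K] pR C t small K0 by (simp add: I_def c0_def)
      have Zt: "Z t * exp (f a / t) \<le> K"
      proof -
        have "Z t * exp (f a / t) = (\<integral>x. exp (- (f x - f a) / t) \<partial>lborel)"
          unfolding Z_def by (subst integral_mult_left_zero[symmetric]) (simp add: exp_add[symmetric] diff_divide_distrib)
        also have "\<dots> \<le> K" unfolding K_def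
        proof (rule integral_mono)
          fix x
          have "f x - f a \<le> (f x - f a) / t" using t f_min[of x] by (simp add: le_divide_eq mult_left_le)
          then have "- (f x - f a) / t \<le> - (f x - f a)" unfolding minus_divide_left[symmetric] by linarith
          then show "exp (- (f x - f a) / t) \<le> exp (- (f x - f a))" by (simp only: exp_le_cancel_iff)
        qed (use intK[of t] intK[of 1] t in auto)
        finally show ?thesis .
      qed
      \<comment> \<open>v^2 is psi^2 divided by the density, and the reciprocal density is at most K
        e^F with F = (f x - f a) / t. As F is nonnegative, the summand 1 in the logarithm is covered
        as well.\<close>
      have pw: "t * ((v x)\<^sup>2 * ln (1 + (v x)\<^sup>2) * dens t x) \<le> (psi x)\<^sup>2 * (f x - f a) + t * ((psi x)\<^sup>2 * ln (1 + K * (psi x)\<^sup>2))" for x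
      proof -
        define F where "F = (f x - f a) / t"
        have F0: "0 \<le> F" using f_min[of x] t by (simp add: F_def)
        have "(v x)\<^sup>2 = (psi x)\<^sup>2 * (Z t * exp (f a / t)) * exp F"
          using Z_pos[OF t(1)] by (simp add: psi2 dens_def F_def exp_diff exp_minus diff_divide_distrib field_simps)
        also have "\<dots> \<le> (psi x)\<^sup>2 * K * exp F" using Zt by (intro mult_right_mono mult_left_mono) auto
        finally have "1 + (v x)\<^sup>2 \<le> (1 + K * (psi x)\<^sup>2) * exp F" using F0 by (simp add: algebra_simps add_mono)
        then have "ln (1 + (v x)\<^sup>2) \<le> ln ((1 + K * (psi x)\<^sup>2) * exp F)"
          by (subst ln_le_cancel_iff) (auto simp: add_pos_nonneg K0)
        also have "\<dots> = ln (1 + K * (psi x)\<^sup>2) + F"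
        proof -
          have "0 < 1 + K * (psi x)\<^sup>2" using K0 by (simp add: add_pos_nonneg)
          then show ?thesis by (simp add: ln_mult)
        qed
        finally have "(psi x)\<^sup>2 * ln (1 + (v x)\<^sup>2) \<le> (psi x)\<^sup>2 * (ln (1 + K * (psi x)\<^sup>2) + F)" by (intro mult_left_mono) auto
        then have "t * ((psi x)\<^sup>2 * ln (1 + (v x)\<^sup>2)) \<le> t * ((psi x)\<^sup>2 * (ln (1 + K * (psi x)\<^sup>2) + F))"
          by (rule mult_left_mono) (use t in simp)
        also have "\<dots> = (psi x)\<^sup>2 * (t * F) + t * ((psi x)\<^sup>2 * ln (1 + K * (psi x)\<^sup>2))"
          by (simp add: distrib_left mult_ac)
        also have "t * F = f x - f a" using t by (simp add: F_def)
        also have "t * ((psi x)\<^sup>2 * ln (1 + (v x)\<^sup>2)) = t * ((v x)\<^sup>2 * ln (1 + (v x)\<^sup>2) * dens t x)"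
          by (simp add: psi2 mult_ac)
        finally show ?thesis .
      qed
      have pc: "continuous_on UNIV psi" using C1_gradientD[OF pC] by auto
      have "1 + K * (psi x)\<^sup>2 \<noteq> 0" "1 + (v x)\<^sup>2 \<noteq> 0" for x using K0
        by (metis add_pos_nonneg less_irrefl mult_nonneg_nonneg zero_le_power2 zero_less_one)+
      then have j1: "integrable lborel (\<lambda>x. (psi x)\<^sup>2 * ln (1 + K * (psi x)\<^sup>2))"
        and j2: "integrable lborel (\<lambda>x. (v x)\<^sup>2 * ln (1 + (v x)\<^sup>2) * dens t x)"
        using pc pR vC(3) R fC(3) t Z_pos[OF t(1)] unfolding dens_def
        by (intro continuous_bounded_support_integrable[of _ R] continuous_intros; auto)+
      have j3: "integrable lborel (\<lambda>x. (psi x)\<^sup>2 * (f x - f a))"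
        using pc pR fC(3) by (intro continuous_bounded_support_integrable[of _ R] continuous_intros) auto
      have j4: "integrable lborel (\<lambda>x. (psi x)\<^sup>2 * (norm (G x))\<^sup>2)"
        using pc pR fC(2) by (intro continuous_bounded_support_integrable[of _ R] continuous_intros) auto
      have "(\<integral>x. (psi x)\<^sup>2 * (f x - f a) \<partial>lborel) \<le> (\<integral>x. C / 2 * ((psi x)\<^sup>2 * (norm (G x))\<^sup>2) \<partial>lborel)"
        using mult_left_mono[OF PL, of "(psi _)\<^sup>2"] by (intro integral_mono j3 integrable_mult_right j4) (simp add: mult_ac)
      also have "\<dots> = C / 2 * Y" unfolding Y_def psi2 using integral_gibbs[OF t(1), of "\<lambda>x. (v x)\<^sup>2 * (norm (G x))\<^sup>2"] by (simp add: mult_ac)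
      finally have PLint: "(\<integral>x. (psi x)\<^sup>2 * (f x - f a) \<partial>lborel) \<le> C / 2 * Y" .
      define E where "E = (\<integral>x. (v x)\<^sup>2 * ln (1 + (v x)\<^sup>2) \<partial>gibbs f t)"
      have "t * E = (\<integral>x. t * ((v x)\<^sup>2 * ln (1 + (v x)\<^sup>2) * dens t x) \<partial>lborel)"
        unfolding E_def by (subst integral_gibbs[OF t(1)]) auto
      also have "\<dots> \<le> (\<integral>x. (psi x)\<^sup>2 * (f x - f a) + t * ((psi x)\<^sup>2 * ln (1 + K * (psi x)\<^sup>2)) \<partial>lborel)"
        by (intro integral_mono pw integrable_mult_right Bochner_Integration.integrable_add j1 j2 j3)
      also have "\<dots> = (\<integral>x. (psi x)\<^sup>2 * (f x - f a) \<partial>lborel) + t * (\<integral>x. (psi x)\<^sup>2 * ln (1 + K * (psi x)\<^sup>2) \<partial>lborel)"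
        using j1 j3 by simp
      also have "\<dots> \<le> C / 2 * Y + t * (4 * (C * t / 2) * I + c0 - DIM('a) / 2 * ln (C * t / 2))"
        using PLint ent t by (intro add_mono mult_left_mono) auto
      also have "\<dots> = C / 2 * Y + 2 * C * t\<^sup>2 * I + eta t"
        by (simp add: eta_def power2_eq_square algebra_simps)
      finally have up: "t * E \<le> C / 2 * Y + 2 * C * t\<^sup>2 * I + eta t" .
      have W1: "4 * t\<^sup>2 * I + Y - 2 * t * L * (1 + Y) \<le> 4 * t\<^sup>2 * W" using gs unfolding one by (simp add: I_def algebra_simps)
      have "(1 + e) * (2 * t * L) * (1 + Y) \<le> (1 + e) * (2 * t * L) * ((1 + 1 / d) * Y)"
        using dY d e t L by (intro mult_left_mono) (auto simp: field_simps)
      also have "\<dots> = ((1 + e) * (2 * t * L) * (1 + 1 / d)) * Y" by (simp add: mult_ac)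
      also have "\<dots> \<le> e / 2 * Y" using small(2) dY d by (intro mult_right_mono) auto
      finally have s1: "(1 + e) * (2 * t * L) * (1 + Y) \<le> e / 2 * Y" .
      have s2: "eta t \<le> C / 2 * (e / 2 * Y)"
      proof -
        have "C / 2 * (e / 2) * d \<le> C / 2 * (e / 2) * Y" using dY C e by (intro mult_left_mono) auto
        then show ?thesis using small(1) by (simp add: mult.assoc)
      qed
      \<comment> \<open>Of the margin \<open>e * Y\<close> one half absorbs the terms with
        \<open>L\<close> and the other half absorbs \<open>eta t\<close>.\<close>
      have "4 * t\<^sup>2 * I + Y + e / 2 * Y \<le> (1 + e) * (4 * t\<^sup>2 * I + Y) - e / 2 * Y"
        using e I0 by (simp add: algebra_simps)
      also have "\<dots> \<le> (1 + e) * (4 * t\<^sup>2 * I + Y) - (1 + e) * (2 * t * L) * (1 + Y)" using s1 by linarith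
      also have "\<dots> = (1 + e) * (4 * t\<^sup>2 * I + Y - 2 * t * L * (1 + Y))" by (simp add: algebra_simps)
      also have "\<dots> \<le> (1 + e) * (4 * t\<^sup>2 * W)" using W1 e by (intro mult_left_mono) auto
      finally have "C / 2 * (4 * t\<^sup>2 * I + Y + e / 2 * Y) \<le> C / 2 * ((1 + e) * (4 * t\<^sup>2 * W))"
        using C by (intro mult_left_mono) auto
      then have "t * E \<le> t * (2 * C * t * (1 + e) * W)"
        using up s2 by (simp add: algebra_simps power2_eq_square)
      then show "(\<integral>x. (v x)\<^sup>2 * ln (1 + (v x)\<^sup>2) \<partial>gibbs f t) \<le> 2 * C * t * (1 + e) * (\<integral>x. (norm (V x))\<^sup>2 \<partial>gibbs f t)"
        using t by (simp add: E_def W_def)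
    qed
  qed
qed


text \<open>Removes the normalization, by homogeneity, and the compact support. The function to be
  inserted later, a cutoff times g - 1, is merely bounded with a gradient of bounded support and
  need not vanish at infinity. It is truncated at growing radii; uniformly bounded gradients of the
  truncations suffice, because the measure is finite.\<close>

lemma outer_inequalities:
  assumes r: "0 < r" and e: "0 < e"
  shows "\<forall>\<^sub>F t in at_right 0. \<forall>v V R B. C1_gradient v V \<longrightarrow> (\<forall>x. \<bar>v x\<bar> \<le> B) \<longrightarrow> (\<forall>x. R < norm x \<longrightarrow> V x = 0) \<longrightarrow>
      (\<forall>x. norm (x - a) < r \<longrightarrow> v x = 0) \<longrightarrow>
      (\<integral>x. (v x)\<^sup>2 \<partial>gibbs f t) \<le> 16 * C\<^sup>2 / r\<^sup>2 * t\<^sup>2 * (\<integral>x. (norm (V x))\<^sup>2 \<partial>gibbs f t) \<and>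
      (0 < (\<integral>x. (v x)\<^sup>2 \<partial>gibbs f t) \<longrightarrow>
        (\<integral>x. (v x)\<^sup>2 * ln (1 + (v x)\<^sup>2 / (\<integral>x. (v x)\<^sup>2 \<partial>gibbs f t)) \<partial>gibbs f t)
          \<le> 2 * C * t * (1 + e) * (\<integral>x. (norm (V x))\<^sup>2 \<partial>gibbs f t))"
proof -
  have d: "0 < r\<^sup>2 / C\<^sup>2" using r C by simp
  have "\<forall>\<^sub>F t in at_right 0. 4 * t * L < 1"
    by (intro order_tendstoD(2)[of _ 0]) (auto intro!: tendsto_eq_intros)
  moreover have "\<forall>\<^sub>F t in at_right 0. 8 * t * L < r\<^sup>2 / C\<^sup>2"
    using d by (intro order_tendstoD(2)[of _ 0]) (auto intro!: tendsto_eq_intros)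
  moreover have "\<forall>\<^sub>F t::real in at_right 0. 0 < t \<and> t < 1"
    unfolding eventually_at_right_field by (intro exI[of _ 1]) auto
  moreover note outer_log_Sobolev_compact[OF r e]
  ultimately show ?thesis
  proof eventually_elim
    case (elim t)
    then have t: "0 < t" "t < 1" "4 * t * L \<le> 1" "8 * t * L \<le> r\<^sup>2 / C\<^sup>2" by auto
    interpret prob_space "gibbs f t" by (rule prob_gibbs[OF t(1)])
    have ls: "(\<integral>x. (v x)\<^sup>2 * ln (1 + (v x)\<^sup>2 / (\<integral>x. (v x)\<^sup>2 \<partial>gibbs f t)) \<partial>gibbs f t)
          \<le> 2 * C * t * (1 + e) * (\<integral>x. (norm (V x))\<^sup>2 \<partial>gibbs f t)"
      if v: "C1_gradient v V" and R: "\<forall>x. R < norm x \<longrightarrow> v x = 0"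
        and v0: "\<forall>x. norm (x - a) < r \<longrightarrow> v x = 0" and X: "0 < (\<integral>x. (v x)\<^sup>2 \<partial>gibbs f t)" for v V R
    proof -
      define X where "X = (\<integral>x. (v x)\<^sup>2 \<partial>gibbs f t)"
      have X0: "0 < X" using X by (simp add: X_def)
      define c where "c = 1 / sqrt X"
      have c2: "c\<^sup>2 = 1 / X" using X0 by (simp add: c_def power_divide)
      have cv: "C1_gradient (\<lambda>x. c * v x) (\<lambda>x. c *\<^sub>R V x)"
        using C1_gradient_mult[OF C1_gradient_const v, of c] by simp
      have "(\<integral>x. (c * v x)\<^sup>2 \<partial>gibbs f t) = 1" using X0 by (simp add: power_mult_distrib c2 X_def[symmetric])
      then have "(\<integral>x. (c * v x)\<^sup>2 * ln (1 + (c * v x)\<^sup>2) \<partial>gibbs f t) \<le> 2 * C * t * (1 + e) * (\<integral>x. (norm (c *\<^sub>R V x))\<^sup>2 \<partial>gibbs f t)"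
        by (intro elim(4)[rule_format, OF cv, of R]) (use R v0 in auto)
      moreover have "(\<integral>x. (c * v x)\<^sup>2 * ln (1 + (c * v x)\<^sup>2) \<partial>gibbs f t) = 1 / X * (\<integral>x. (v x)\<^sup>2 * ln (1 + (v x)\<^sup>2 / X) \<partial>gibbs f t)"
        by (subst integral_mult_right_zero[symmetric]) (simp add: power_mult_distrib c2)
      moreover have "(\<integral>x. (norm (c *\<^sub>R V x))\<^sup>2 \<partial>gibbs f t) = 1 / X * (\<integral>x. (norm (V x))\<^sup>2 \<partial>gibbs f t)"
        by (subst integral_mult_right_zero[symmetric]) (simp add: power_mult_distrib c2)
      ultimately show ?thesis using X0 unfolding X_def[symmetric] by (simp add: divide_le_cancel)
    qed
    show ?case
    proof (intro allI impI)
      fix v V R B assume v: "C1_gradient v V" and B: "\<forall>x. \<bar>v x\<bar> \<le> B" and R': "\<forall>x. R < norm x \<longrightarrow> V x = 0"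
        and v0: "\<forall>x. norm (x - a) < r \<longrightarrow> v x = 0"
      have R: "\<And>x. R < norm x \<Longrightarrow> V x = 0" using R' by blast
      note vC = C1_gradientD[OF v]
      have [measurable]: "v \<in> borel_measurable borel" "V \<in> borel_measurable borel"
        using C1_gradient_measurable[OF v] by auto
      obtain BV where BV: "0 \<le> BV" "\<And>x. norm (V x) \<le> BV" by (rule continuous_bounded_support_bound[OF vC(2) R]) auto
      have B0: "0 \<le> B" using B[rule_format, of 0] by linarith
      have v2B: "(v x)\<^sup>2 \<le> B\<^sup>2" for x using B[rule_format, of x] B0 by (simp add: abs_le_square_iff[symmetric])
      define m where "m n = real (Suc n)" for n
      have m: "0 < m n" "1 \<le> m n" for n by (auto simp: m_def)
      define z where "z n x = 1 + (-1) * radial_step 0 ((m n)\<^sup>2) ((m n)\<^sup>2) x" for n and x :: 'a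
      define zg where "zg n x = (-1) *\<^sub>R radial_step_gradient 0 ((m n)\<^sup>2) ((m n)\<^sup>2) x" for n and x :: 'a
      have zC: "C1_gradient (z n) (zg n)" for n
        using C1_gradient_add[OF C1_gradient_const[of 1] C1_gradient_mult[OF C1_gradient_const[of "-1"] radial_step_C1[of "(m n)\<^sup>2" 0 "(m n)\<^sup>2"]]] m(1)[of n]
        by (simp add: z_def[abs_def] zg_def[abs_def])
      have z01: "0 \<le> z n x" "z n x \<le> 1" for n x using radial_step_bounds[of 0 "(m n)\<^sup>2" "(m n)\<^sup>2" x] by (auto simp: z_def)
      have zin: "z n x = 1" "zg n x = 0" if "norm x \<le> m n" for n x
        using that m(1)[of n] by (auto simp: z_def zg_def radial_step_inner)
      have zout: "z n x = 0" if "2 * m n < norm x" for n x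
      proof -
        have "(2 * m n)\<^sup>2 \<le> (norm x)\<^sup>2" using that m(1)[of n] by (intro power_mono) auto
        moreover have "(m n)\<^sup>2 + (m n)\<^sup>2 \<le> (2 * m n)\<^sup>2" by (simp add: power2_eq_square)
        ultimately have "(m n)\<^sup>2 + (m n)\<^sup>2 \<le> (norm (x - 0))\<^sup>2" by (metis diff_zero order_trans)
        from radial_step_outer(1)[OF _ this] show ?thesis using m(1)[of n] by (simp add: z_def)
      qed
      have zgb: "norm (zg n x) \<le> 16" for n x
      proof -
        have "norm (zg n x) \<le> 8 * sqrt ((m n)\<^sup>2 + (m n)\<^sup>2) / (m n)\<^sup>2"
          using radial_step_gradient_le[of "(m n)\<^sup>2" "(m n)\<^sup>2" 0 x] m(1)[of n] by (simp add: zg_def)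
        also have "sqrt ((m n)\<^sup>2 + (m n)\<^sup>2) \<le> sqrt ((2 * m n)\<^sup>2)" by (intro real_sqrt_le_mono) (simp add: power2_eq_square)
        also have "sqrt ((2 * m n)\<^sup>2) = 2 * m n" using m(1)[of n] by (subst real_sqrt_abs) simp
        also have "8 * (2 * m n) / (m n)\<^sup>2 = 16 / m n" using m(1)[of n] by (simp add: power2_eq_square)
        also have "\<dots> \<le> 16" using m(2)[of n] by (simp add: divide_le_eq)
        finally show ?thesis by (simp add: divide_right_mono)
      qed
      define vn Vn where "vn n x = z n x * v x" and "Vn n x = z n x *\<^sub>R V x + v x *\<^sub>R zg n x" for n x
      have vnC: "C1_gradient (vn n) (Vn n)" for n
        unfolding vn_def Vn_def by (rule C1_gradient_mult[OF zC v])
      have [measurable]: "vn n \<in> borel_measurable borel" "Vn n \<in> borel_measurable borel" for n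
        using C1_gradient_measurable[OF vnC] by auto
      have vnR: "vn n x = 0" if "2 * m n < norm x" for n x using zout[OF that] by (simp add: vn_def)
      have vn0: "vn n x = 0" if "norm (x - a) < r" for n x using v0 that by (simp add: vn_def)
      have ev: "\<forall>\<^sub>F n in sequentially. norm x \<le> m n" for x :: 'a
      proof -
        obtain N where "norm x \<le> real N" using real_arch_simple by blast
        then show ?thesis unfolding m_def by (intro eventually_sequentiallyI[of N]) linarith
      qed
      have evn: "\<forall>\<^sub>F n in sequentially. vn n x = v x \<and> Vn n x = V x" for x
        using ev[of x] by eventually_elim (auto simp: vn_def Vn_def zin)
      \<comment> \<open>At each point the truncations are eventually equal to \<open>v\<close> and
        \<open>V\<close>, so any expression in them converges pointwise.\<close>
      have tend: "(\<lambda>n. P (vn n x) (Vn n x)) \<longlonglongrightarrow> P (v x) (V x)" for P :: "real \<Rightarrow> 'a \<Rightarrow> real" and x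
        by (rule tendsto_eventually, rule eventually_mono[OF evn[of x]]) auto
      have vn2: "(vn n x)\<^sup>2 \<le> (v x)\<^sup>2" for n x
        using z01[of n x] by (simp add: vn_def power_mult_distrib mult_left_le_one_le power_le_one)
      have Vnb: "norm (Vn n x) \<le> BV + B * 16" for n x
      proof -
        have "norm (Vn n x) \<le> \<bar>z n x\<bar> * norm (V x) + \<bar>v x\<bar> * norm (zg n x)"
          unfolding Vn_def by (rule order_trans[OF norm_triangle_ineq]) simp
        also have "\<dots> \<le> 1 * BV + B * 16" using z01[of n x] BV zgb[of n x] B B0 by (intro add_mono mult_mono) auto
        finally show ?thesis by simp
      qed
      define X where "X = (\<integral>x. (v x)\<^sup>2 \<partial>gibbs f t)"
      define W where "W = (\<integral>x. (norm (V x))\<^sup>2 \<partial>gibbs f t)"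
      have limX: "(\<lambda>n. \<integral>x. (vn n x)\<^sup>2 \<partial>gibbs f t) \<longlonglongrightarrow> X" unfolding X_def
      proof (rule integral_dominated_convergence[where w="\<lambda>_. B\<^sup>2"])
        show "AE x in gibbs f t. (\<lambda>n. (vn n x)\<^sup>2) \<longlonglongrightarrow> (v x)\<^sup>2"
          by (intro AE_I2 tend[of "\<lambda>b c. b\<^sup>2"])
        show "AE x in gibbs f t. norm ((vn n x)\<^sup>2) \<le> B\<^sup>2" for n
          using order_trans[OF vn2 v2B] by (intro AE_I2) simp
      qed auto
      have limW: "(\<lambda>n. \<integral>x. (norm (Vn n x))\<^sup>2 \<partial>gibbs f t) \<longlonglongrightarrow> W" unfolding W_def
      proof (rule integral_dominated_convergence[where w="\<lambda>_. (BV + B * 16)\<^sup>2"])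
        show "AE x in gibbs f t. (\<lambda>n. (norm (Vn n x))\<^sup>2) \<longlonglongrightarrow> (norm (V x))\<^sup>2"
          by (intro AE_I2 tend[of "\<lambda>b c. (norm c)\<^sup>2"])
        show "AE x in gibbs f t. norm ((norm (Vn n x))\<^sup>2) \<le> (BV + B * 16)\<^sup>2" for n
          using Vnb by (intro AE_I2) (auto intro!: power_mono)
      qed auto
      have 1: "X \<le> 16 * C\<^sup>2 / r\<^sup>2 * t\<^sup>2 * W"
      proof (rule LIMSEQ_le[OF limX tendsto_mult_left[OF limW]])
        show "\<exists>N. \<forall>n\<ge>N. (\<integral>x. (vn n x)\<^sup>2 \<partial>gibbs f t) \<le> 16 * C\<^sup>2 / r\<^sup>2 * t\<^sup>2 * (\<integral>x. (norm (Vn n x))\<^sup>2 \<partial>gibbs f t)"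
          using outer_poincare_compact(1)[OF r t(1,3,4) vnC vnR vn0] by blast
      qed
      have 2: "(\<integral>x. (v x)\<^sup>2 * ln (1 + (v x)\<^sup>2 / X) \<partial>gibbs f t) \<le> 2 * C * t * (1 + e) * W" if X0: "0 < X"
      proof -
        have mono_ln: "ln (1 + u / X) \<le> ln (1 + w / X')" if "0 \<le> u" "u \<le> w" "0 < X'" "X' \<le> X" for u w X'
        proof -
          have "u / X \<le> w / X'" using that X0 by (intro frac_le) auto
          moreover have "0 \<le> u / X" using that X0 by simp
          ultimately show ?thesis by (intro ln_mono) auto
        qed
        have lim: "(\<lambda>n. \<integral>x. (vn n x)\<^sup>2 * ln (1 + (vn n x)\<^sup>2 / X) \<partial>gibbs f t) \<longlonglongrightarrow> (\<integral>x. (v x)\<^sup>2 * ln (1 + (v x)\<^sup>2 / X) \<partial>gibbs f t)"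
        proof (rule integral_dominated_convergence[where w="\<lambda>_. B\<^sup>2 * ln (1 + B\<^sup>2 / X)"])
          show "AE x in gibbs f t. (\<lambda>n. (vn n x)\<^sup>2 * ln (1 + (vn n x)\<^sup>2 / X)) \<longlonglongrightarrow> (v x)\<^sup>2 * ln (1 + (v x)\<^sup>2 / X)"
            by (intro AE_I2 tend[of "\<lambda>b c. b\<^sup>2 * ln (1 + b\<^sup>2 / X)"])
          show "AE x in gibbs f t. norm ((vn n x)\<^sup>2 * ln (1 + (vn n x)\<^sup>2 / X)) \<le> B\<^sup>2 * ln (1 + B\<^sup>2 / X)" for n
          proof (intro AE_I2)
            fix x
            have "0 \<le> ln (1 + (vn n x)\<^sup>2 / X)" using X0 by simp
            moreover have "ln (1 + (vn n x)\<^sup>2 / X) \<le> ln (1 + B\<^sup>2 / X)"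
              using order_trans[OF vn2 v2B] X0 by (intro mono_ln) auto
            ultimately show "norm ((vn n x)\<^sup>2 * ln (1 + (vn n x)\<^sup>2 / X)) \<le> B\<^sup>2 * ln (1 + B\<^sup>2 / X)"
              using order_trans[OF vn2 v2B] by (auto simp: abs_mult intro!: mult_mono)
          qed
        qed auto
        show ?thesis
        proof (rule tendsto_le[OF _ tendsto_mult_left[OF limW] lim])
          show "\<forall>\<^sub>F n in sequentially. (\<integral>x. (vn n x)\<^sup>2 * ln (1 + (vn n x)\<^sup>2 / X) \<partial>gibbs f t)
              \<le> 2 * C * t * (1 + e) * (\<integral>x. (norm (Vn n x))\<^sup>2 \<partial>gibbs f t)"
            using order_tendstoD(1)[OF limX X0]
          proof eventually_elim
            case (elim n)
            \<comment> \<open>The normalizing mass depends on \<open>n\<close>. As it is at most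
              \<open>X\<close>, writing \<open>X\<close> in the logarithm decreases the left side,
              and the limit is taken with a fixed denominator.\<close>
            define Xn where "Xn = (\<integral>x. (vn n x)\<^sup>2 \<partial>gibbs f t)"
            have XnX: "Xn \<le> X" unfolding Xn_def X_def
              by (intro integral_mono vn2 integrable_gibbs[OF t(1), where B="B\<^sup>2"])
                 (use v2B order_trans[OF vn2 v2B] in auto)
            have Xn0: "0 < Xn" using elim by (simp add: Xn_def)
            have bnd: "\<bar>(vn n x)\<^sup>2 * ln (1 + (vn n x)\<^sup>2 / X')\<bar> \<le> B\<^sup>2 * ln (1 + B\<^sup>2 / Xn)" if "Xn \<le> X'" "X' \<le> X" for X' x
            proof -
              have X'0: "0 < X'" using that Xn0 by linarith
              have "(vn n x)\<^sup>2 / X' \<le> B\<^sup>2 / Xn" using order_trans[OF vn2 v2B, of n x] that Xn0 by (intro frac_le) auto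
              then have "ln (1 + (vn n x)\<^sup>2 / X') \<le> ln (1 + B\<^sup>2 / Xn)" using X'0 by (intro ln_mono add_left_mono) (auto simp: add_pos_nonneg)
              moreover have "0 \<le> ln (1 + (vn n x)\<^sup>2 / X')" using X'0 by simp
              ultimately show ?thesis
                using order_trans[OF vn2 v2B] by (auto simp: abs_mult intro!: mult_mono)
            qed
            have "(\<integral>x. (vn n x)\<^sup>2 * ln (1 + (vn n x)\<^sup>2 / X) \<partial>gibbs f t) \<le> (\<integral>x. (vn n x)\<^sup>2 * ln (1 + (vn n x)\<^sup>2 / Xn) \<partial>gibbs f t)"
              using mono_ln[OF _ order_refl Xn0 XnX] XnX
              by (intro integral_mono integrable_gibbs[OF t(1), where B="B\<^sup>2 * ln (1 + B\<^sup>2 / Xn)"] bnd) (auto intro!: mult_left_mono)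
            also have "\<dots> \<le> 2 * C * t * (1 + e) * (\<integral>x. (norm (Vn n x))\<^sup>2 \<partial>gibbs f t)"
              unfolding Xn_def using vnR vn0 elim by (intro ls[OF vnC, of "2 * m n"]) auto
            finally show ?case .
          qed
        qed simp
      qed
      show "(\<integral>x. (v x)\<^sup>2 \<partial>gibbs f t) \<le> 16 * C\<^sup>2 / r\<^sup>2 * t\<^sup>2 * (\<integral>x. (norm (V x))\<^sup>2 \<partial>gibbs f t) \<and>
      (0 < (\<integral>x. (v x)\<^sup>2 \<partial>gibbs f t) \<longrightarrow>
        (\<integral>x. (v x)\<^sup>2 * ln (1 + (v x)\<^sup>2 / (\<integral>x. (v x)\<^sup>2 \<partial>gibbs f t)) \<partial>gibbs f t)
          \<le> 2 * C * t * (1 + e) * (\<integral>x. (norm (V x))\<^sup>2 \<partial>gibbs f t))"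
        using 1 2 by (simp add: X_def W_def)
    qed
  qed
qed

end

section \<open>Gluing the local estimates\<close>

text \<open>The bound ln y \<le> y - 1 at y = 1/s. Through it the inner entropy controls the
  integral of (g - 1)^2 near the minimizer, so that the inner log-Sobolev inequality also does the
  work of a Poincare inequality.\<close>

lemma entropy_integrand_ge: "(s - 1)\<^sup>2 \<le> s\<^sup>2 * ln (s\<^sup>2) - s\<^sup>2 + 1" if "0 < s" for s :: real
proof -
  have "ln (1 / s) \<le> 1 / s - 1" using that by (intro ln_le_minus_one) auto
  then have "1 - 1 / s \<le> ln s" using that by (simp add: ln_div)
  then have "2 * s\<^sup>2 * (1 - 1 / s) \<le> 2 * s\<^sup>2 * ln s" by (intro mult_left_mono) auto
  moreover have "2 * s\<^sup>2 * (1 - 1 / s) = 2 * s\<^sup>2 - 2 * s" using that by (simp add: power2_eq_square algebra_simps)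
  moreover have "s\<^sup>2 * ln (s\<^sup>2) = 2 * s\<^sup>2 * ln s" using that by (simp add: ln_realpow)
  moreover have "(s - 1)\<^sup>2 = s\<^sup>2 - 2 * s + 1" by (simp add: power2_eq_square algebra_simps)
  ultimately show ?thesis by linarith
qed

text \<open>Makes the entropy integrand quadratic in s - 1 up to a logarithm, the form in which the
  outer inequality for a cutoff times g - 1 applies. For s \<ge> 1 one expands in h = s - 1; for s <
  1 the left side is at most (s^2 - 1)^2 = (s + 1)^2 (s - 1)^2.\<close>

lemma entropy_integrand_le:
  fixes s :: real
  assumes "0 < s"
  shows "s\<^sup>2 * ln (s\<^sup>2) - s\<^sup>2 + 1 \<le> (s - 1)\<^sup>2 * ln ((1 + \<bar>s - 1\<bar>)\<^sup>2) + 4 * (s - 1)\<^sup>2"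
proof (cases "1 \<le> s")
  case True
  define h where "h = s - 1"
  have h: "0 \<le> h" "s = 1 + h" using True by (auto simp: h_def)
  have l: "ln (1 + h) \<le> h" using h ln_add_one_self_le_self[of h] by simp
  have ls: "ln ((1 + h)\<^sup>2) = 2 * ln (1 + h)" using h by (simp add: ln_realpow)
  have "(2 + 4 * h) * ln (1 + h) \<le> (2 + 4 * h) * h" using l h by (intro mult_left_mono) auto
  moreover have "(2 + 4 * h) * h = 2 * h + 4 * h\<^sup>2" by (simp add: power2_eq_square algebra_simps)
  moreover have "(1 + h)\<^sup>2 * (2 * ln (1 + h)) - (1 + h)\<^sup>2 + 1 = h\<^sup>2 * (2 * ln (1 + h)) + (2 + 4 * h) * ln (1 + h) - 2 * h - h\<^sup>2"
    by (simp add: power2_eq_square algebra_simps)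
  ultimately have "(1 + h)\<^sup>2 * (2 * ln (1 + h)) - (1 + h)\<^sup>2 + 1 \<le> h\<^sup>2 * (2 * ln (1 + h)) + 4 * h\<^sup>2"
    using zero_le_power2[of h] by linarith
  then show ?thesis using h by (simp add: ls)
next
  case False
  have "ln (s\<^sup>2) \<le> s\<^sup>2 - 1" using assms by (intro ln_le_minus_one) auto
  then have "s\<^sup>2 * ln (s\<^sup>2) \<le> s\<^sup>2 * (s\<^sup>2 - 1)" by (intro mult_left_mono) auto
  then have 1: "s\<^sup>2 * ln (s\<^sup>2) - s\<^sup>2 + 1 \<le> (s + 1)\<^sup>2 * (s - 1)\<^sup>2" by (simp add: power2_eq_square algebra_simps)
  have "(s + 1)\<^sup>2 \<le> 2\<^sup>2" using False assms by (intro power_mono) auto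
  then have "(s + 1)\<^sup>2 * (s - 1)\<^sup>2 \<le> 4 * (s - 1)\<^sup>2" by (intro mult_right_mono) auto
  moreover have "0 \<le> (s - 1)\<^sup>2 * ln ((1 + \<bar>s - 1\<bar>)\<^sup>2)"
    by (intro mult_nonneg_nonneg ln_ge_zero) (auto intro: one_le_power)
  ultimately show ?thesis using 1 by linarith
qed

text \<open>The bound ln y \<le> y - 1 at y = sqrt (1 + x). It lets the squared logarithm of the
  normalizing constant in the gluing be absorbed.\<close>

lemma ln_one_plus_square_le: "(ln (1 + x))\<^sup>2 \<le> 4 * x" if "0 \<le> x" for x :: real
proof -
  have "ln (sqrt (1 + x)) \<le> sqrt (1 + x) - 1" using that by (intro ln_le_minus_one) auto
  then have 1: "ln (1 + x) \<le> 2 * (sqrt (1 + x) - 1)" using that by (simp add: ln_sqrt)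
  have s: "1 \<le> sqrt (1 + x)" using that by simp
  have "(ln (1 + x))\<^sup>2 \<le> (2 * (sqrt (1 + x) - 1))\<^sup>2" using 1 that by (intro power_mono) auto
  also have "\<dots> = 4 * (2 + x - 2 * sqrt (1 + x))" using that
    by (simp add: power2_eq_square algebra_simps)
  also have "\<dots> \<le> 4 * x" using s by simp
  finally show ?thesis .
qed

text \<open>Moving \<open>eta\<close> inside the logarithm costs eta^2 ln (1 / eta^2), which is at
  most 1 - eta^2. This vanishes at \<open>eta = 1\<close>, and the case distinction makes it vanish
  at \<open>eta = 0\<close>, so the cost is confined to the transition shell.\<close>

lemma cutoff_log_le:
  fixes eta h :: real
  assumes "0 \<le> eta" "eta \<le> 1"
  shows "eta\<^sup>2 * ln ((1 + \<bar>h\<bar>)\<^sup>2) \<le> eta\<^sup>2 * ln ((1 + \<bar>eta * h\<bar>)\<^sup>2) + (if eta = 0 then 0 else 1 - eta\<^sup>2)"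
proof (cases "eta = 0")
  case False
  then have e: "0 < eta" using assms by simp
  have "eta * (1 + \<bar>h\<bar>) \<le> 1 + \<bar>eta * h\<bar>" using assms by (simp add: distrib_left abs_mult)
  then have "1 + \<bar>h\<bar> \<le> (1 + \<bar>eta * h\<bar>) / eta" using e by (simp add: le_divide_eq mult.commute)
  then have "(1 + \<bar>h\<bar>)\<^sup>2 \<le> ((1 + \<bar>eta * h\<bar>) / eta)\<^sup>2" by (intro power_mono) auto
  then have "ln ((1 + \<bar>h\<bar>)\<^sup>2) \<le> ln ((1 + \<bar>eta * h\<bar>)\<^sup>2 / eta\<^sup>2)"
    by (intro ln_mono) (auto simp: power_divide add_pos_nonneg zero_less_power)
  also have "\<dots> = ln ((1 + \<bar>eta * h\<bar>)\<^sup>2) + ln (1 / eta\<^sup>2)"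
  proof -
    have "0 < (1 + \<bar>eta * h\<bar>)\<^sup>2" by (simp add: add_pos_nonneg zero_less_power)
    then show ?thesis using e by (simp add: ln_div)
  qed
  also have "ln (1 / eta\<^sup>2) \<le> 1 / eta\<^sup>2 - 1" using e by (intro ln_le_minus_one) auto
  finally have "eta\<^sup>2 * ln ((1 + \<bar>h\<bar>)\<^sup>2) \<le> eta\<^sup>2 * (ln ((1 + \<bar>eta * h\<bar>)\<^sup>2) + (1 / eta\<^sup>2 - 1))"
    by (intro mult_left_mono) auto
  then show ?thesis using e by (simp add: distrib_left right_diff_distrib)
qed simp

text \<open>With S the rescaled squared distance, which is convex, and \<open>b\<close> the positive
  part of 1 - max(0, S)^2, the weight is b^2 (2 - b^2). Where both values of \<open>b\<close> are
  positive, their convex combination m is at most \<open>b z\<close>. The arithmetic-geometric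
  inequality bounds the geometric mean of the factors b^2 by m^2 and, by convexity of the square,
  that of the factors 2 - b^2 by 2 - m^2. Finally u^2 (2 - u^2) increases on [0,1].\<close>

lemma step_weight_log_concave:
  fixes x y c :: "'a::euclidean_space" and A D :: real
  assumes D: "0 < D" and s: "0 < s" "0 < r" "s + r = 1"
  defines "w \<equiv> (\<lambda>x. 1 - (radial_step c A D x)\<^sup>2)"
  shows "w x powr s * w y powr r \<le> w (s *\<^sub>R x + r *\<^sub>R y)"
proof -
  define z where "z = s *\<^sub>R x + r *\<^sub>R y"
  define S where "S x = ((norm (x - c))\<^sup>2 - A) / D" for x
  define b where "b x = max 0 (1 - (max 0 (S x))\<^sup>2)" for x
  have b01: "0 \<le> b x" "b x \<le> 1" for x by (auto simp: b_def)
  have w: "w x = (b x)\<^sup>2 * (2 - (b x)\<^sup>2)" "w x = 1 - (1 - (b x)\<^sup>2)\<^sup>2" for x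
    by (auto simp: w_def radial_step_def step_profile_def b_def S_def power2_eq_square algebra_simps)
  have w0: "0 \<le> w x" for x using radial_step_bounds[of c A D x] by (simp add: w_def power_le_one)
  show ?thesis
  proof (cases "b x = 0 \<or> b y = 0")
    case True
    then have "w x = 0 \<or> w y = 0" by (auto simp: w(1))
    then show ?thesis using w0 by auto
  next
    case False
    then have bx: "b x = 1 - (max 0 (S x))\<^sup>2" and bY: "b y = 1 - (max 0 (S y))\<^sup>2" by (auto simp: b_def)
    have bp: "0 < b x" "0 < b y" using False b01 by (auto simp: less_le)
    have "z - c = s *\<^sub>R (x - c) + r *\<^sub>R (y - c)" using s by (simp add: z_def algebra_simps flip: scaleR_add_left)
    then have "(norm (z - c))\<^sup>2 \<le> s * (norm (x - c))\<^sup>2 + r * (norm (y - c))\<^sup>2"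
      using norm_convex_combination_identity[OF s(3), of "x - c" "y - c"] s by simp
    then have "((norm (z - c))\<^sup>2 - A) / D \<le> (s * (norm (x - c))\<^sup>2 + r * (norm (y - c))\<^sup>2 - (s + r) * A) / D"
      using D s by (intro divide_right_mono) auto
    also have "\<dots> = s * S x + r * S y" using D by (simp add: S_def field_simps)
    finally have Sz: "S z \<le> s * S x + r * S y" by (simp add: S_def)
    define p q where "p = max 0 (S x)" and "q = max 0 (S y)"
    have "max 0 (S z) \<le> s * p + r * q"
    proof -
      have "s * S x \<le> s * p" "r * S y \<le> r * q" using s by (auto simp: p_def q_def intro!: mult_left_mono)
      moreover have "0 \<le> s * p" "0 \<le> r * q" using s by (auto simp: p_def q_def)
      ultimately show ?thesis using Sz by simp
    qed
    then have "(max 0 (S z))\<^sup>2 \<le> (s * p + r * q)\<^sup>2" by (intro power_mono) auto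
    also have "\<dots> \<le> s * p\<^sup>2 + r * q\<^sup>2"
      using norm_convex_combination_identity[OF s(3), of p q] s by simp
    finally have le: "(max 0 (S z))\<^sup>2 \<le> s * p\<^sup>2 + r * q\<^sup>2" .
    have bz: "s * b x + r * b y \<le> b z"
    proof -
      have "s * b x + r * b y = (s + r) - (s * p\<^sup>2 + r * q\<^sup>2)" by (simp add: bx bY p_def q_def algebra_simps)
      moreover have "1 - (max 0 (S z))\<^sup>2 \<le> b z" by (simp add: b_def)
      ultimately show ?thesis using le s(3) by linarith
    qed
    define m where "m = s * b x + r * b y"
    have m: "0 \<le> m" "m \<le> b z" using bz b01 s by (auto simp: m_def)
    have gm: "(b x) powr s * (b y) powr r \<le> m" unfolding m_def using s b01 by (intro weighted_arith_geom) auto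
    have "(b x)\<^sup>2 powr s * (b y)\<^sup>2 powr r = ((b x) powr s * (b y) powr r)\<^sup>2"
      using bp by (simp add: power2_eq_square powr_mult)
    also have "\<dots> \<le> m\<^sup>2" using gm by (intro power_mono) auto
    finally have 1: "(b x)\<^sup>2 powr s * (b y)\<^sup>2 powr r \<le> m\<^sup>2" .
    have b2: "(b x)\<^sup>2 \<le> 1" for x using b01 by (simp add: power_le_one)
    have "(2 - (b x)\<^sup>2) powr s * (2 - (b y)\<^sup>2) powr r \<le> s * (2 - (b x)\<^sup>2) + r * (2 - (b y)\<^sup>2)"
      using s b2[of x] b2[of y] by (intro weighted_arith_geom) auto
    also have "\<dots> = 2 * (s + r) - (s * (b x)\<^sup>2 + r * (b y)\<^sup>2)" by (simp add: algebra_simps)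
    also have "\<dots> = 2 - (s * (b x)\<^sup>2 + r * (b y)\<^sup>2)" using s by simp
    also have "\<dots> \<le> 2 - m\<^sup>2" using norm_convex_combination_identity[OF s(3), of "b x" "b y"] s by (simp add: m_def)
    finally have 2: "(2 - (b x)\<^sup>2) powr s * (2 - (b y)\<^sup>2) powr r \<le> 2 - m\<^sup>2" .
    have "w x powr s * w y powr r = ((b x)\<^sup>2 powr s * (b y)\<^sup>2 powr r) * ((2 - (b x)\<^sup>2) powr s * (2 - (b y)\<^sup>2) powr r)"
      unfolding w(1) using b2[of x] b2[of y] by (simp add: powr_mult)
    also have "\<dots> \<le> m\<^sup>2 * (2 - m\<^sup>2)" using 1 2 by (intro mult_mono) auto
    also have "\<dots> = 1 - (1 - m\<^sup>2)\<^sup>2" by (simp add: power2_eq_square algebra_simps)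
    also have "\<dots> \<le> 1 - (1 - (b z)\<^sup>2)\<^sup>2"
    proof -
      have "m\<^sup>2 \<le> (b z)\<^sup>2" using m by (intro power_mono) auto
      then have "(1 - (b z)\<^sup>2)\<^sup>2 \<le> (1 - m\<^sup>2)\<^sup>2" using b2[of z] by (intro power_mono) auto
      then show ?thesis by simp
    qed
    also have "\<dots> = w z" by (simp add: w(2))
    finally show ?thesis by (simp add: z_def)
  qed
qed

context PL_potential begin

text \<open>On the ball the density is log-concave with modulus \<open>k / t\<close>, and the
  log-concave factor \<open>w\<close> preserves the modulus; \<open>A + D < r\<^sup>2\<close> keeps
  the support of the product inside the ball, where \<open>conv\<close> applies. The normalization
  in the second claim makes the term N ln (N / Z) of the weighted inequality vanish.\<close>

lemma inner_log_Sobolev: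
  fixes A D :: real
  assumes r: "0 < r" and k: "0 < k"
    and conv: "\<And>x y s t. x \<in> ball a r \<Longrightarrow> y \<in> ball a r \<Longrightarrow> 0 < s \<Longrightarrow> 0 < t \<Longrightarrow> s + t = 1 \<Longrightarrow>
       f (s *\<^sub>R x + t *\<^sub>R y) + s * t * k / 2 * (norm (x - y))\<^sup>2 \<le> s * f x + t * f y"
    and t: "0 < t" and AD: "0 < D" "0 < A" "A + D < r\<^sup>2"
    and g: "C1_gradient g Dg" and B: "\<And>x. \<bar>g x\<bar> \<le> B" and R: "\<And>x. R < norm x \<Longrightarrow> Dg x = 0"
  defines "w \<equiv> (\<lambda>x. 1 - (radial_step a A D x)\<^sup>2)"
  shows "0 < (\<integral>x. w x \<partial>gibbs f t)"
    and "(\<integral>x. (g x)\<^sup>2 * w x \<partial>gibbs f t) = (\<integral>x. w x \<partial>gibbs f t) \<Longrightarrow>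
      (\<integral>x. (g x)\<^sup>2 * ln ((g x)\<^sup>2) * w x \<partial>gibbs f t) \<le> 2 * t / k * (\<integral>x. (norm (Dg x))\<^sup>2 * w x \<partial>gibbs f t)"
proof -
  have [measurable]: "g \<in> borel_measurable borel" "Dg \<in> borel_measurable borel"
    using C1_gradient_measurable[OF g] by auto
  have [measurable]: "radial_step a A D \<in> borel_measurable borel"
    using C1_gradient_measurable[OF radial_step_C1[OF AD(1)]] by auto
  have [measurable]: "w \<in> borel_measurable borel" unfolding w_def by measurable
  have w01: "0 \<le> w x" "w x \<le> 1" for x using radial_step_bounds[of a A D x] by (auto simp: w_def power_le_one)
  have w_out: "w x = 0" if "r \<le> norm (x - a)" for x
  proof -
    have "r\<^sup>2 \<le> (norm (x - a))\<^sup>2" using that r by (intro power_mono) auto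
    then show ?thesis using AD by (simp add: w_def radial_step_outer)
  qed
  define rho where "rho x = w x * dens t x" for x
  have rm: "rho \<in> borel_measurable borel" unfolding rho_def by measurable
  have ig: "(\<integral>x. h x * w x \<partial>gibbs f t) = (\<integral>x. h x * rho x \<partial>lborel)" if [measurable]: "h \<in> borel_measurable borel" for h
    by (subst integral_gibbs[OF t]) (auto simp: rho_def mult.assoc)
  have ig1: "(\<integral>x. w x \<partial>gibbs f t) = (\<integral>x. rho x \<partial>lborel)" using ig[of "\<lambda>_. 1"] by simp
  have r0: "0 \<le> rho x" for x using w01 dens_pos[OF t, of x] by (simp add: rho_def)
  have rb: "rho x \<le> exp (- f a / t) / Z t" for x
  proof -
    have "dens t x \<le> exp (- f a / t) / Z t" unfolding dens_def
      using f_min[of x] t Z_pos[OF t] by (intro divide_right_mono) (auto simp: divide_right_mono)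
    moreover have "rho x \<le> 1 * dens t x" unfolding rho_def using w01 dens_pos[OF t, of x] by (intro mult_right_mono) auto
    ultimately show ?thesis by simp
  qed
  have rR: "rho x = 0" if "norm a + r < norm x" for x
  proof -
    have "r \<le> norm (x - a)" using that norm_triangle_ineq2[of x a] by linarith
    then show ?thesis by (simp add: rho_def w_out)
  qed
  have irho: "integrable lborel rho"
    by (rule integrable_bounded_support[OF rm, where K="exp (- f a / t) / Z t" and R="norm a + r"]) (use r0 rb rR in auto)
  show pos: "0 < (\<integral>x. w x \<partial>gibbs f t)"
  proof (rule ccontr)
    assume "\<not> ?thesis"
    moreover have "0 \<le> (\<integral>x. rho x \<partial>lborel)" by (intro integral_nonneg_AE) (simp add: r0)
    ultimately have "(\<integral>x. rho x \<partial>lborel) = 0" unfolding ig1 by linarith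
    then have ae: "AE x in lborel. rho x = 0"
      using integral_nonneg_eq_0_iff_AE[OF irho] r0 by simp
    have "rho x \<noteq> 0" if "x \<in> ball a (sqrt A)" for x
    proof -
      have "norm (x - a) \<le> sqrt A" using that by (simp add: dist_norm norm_minus_commute)
      then have "(norm (x - a))\<^sup>2 \<le> A" using AD by (metis norm_ge_zero power_mono real_sqrt_pow2 less_imp_le)
      then have "w x = 1" using AD by (simp add: w_def radial_step_inner)
      then show ?thesis using dens_pos[OF t, of x] by (simp add: rho_def)
    qed
    then have "AE x in lborel. x \<notin> ball a (sqrt A)" using ae by auto
    then have "ball a (sqrt A) \<in> null_sets lborel" by (subst AE_iff_null_sets) auto
    then have "measure lborel (ball a (sqrt A)) = 0" by (simp add: null_sets_def measure_def)
    then show False using content_ball_pos[of "sqrt A" a] AD by simp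
  qed
  assume N: "(\<integral>x. (g x)\<^sup>2 * w x \<partial>gibbs f t) = (\<integral>x. w x \<partial>gibbs f t)"
  have "(\<integral>x. (g x)\<^sup>2 * ln ((g x)\<^sup>2) * rho x \<partial>lborel) - (\<integral>x. (g x)\<^sup>2 * rho x \<partial>lborel) * ln ((\<integral>x. (g x)\<^sup>2 * rho x \<partial>lborel) / (\<integral>x. rho x \<partial>lborel))
    \<le> 2 / (k / t) * (\<integral>x. (norm (Dg x))\<^sup>2 * rho x \<partial>lborel)"
  proof (rule log_Sobolev_log_concave_square[OF rm r0 rb])
    show "rho x = 0" if "norm a + r < norm x" for x using rR that .
    show "0 < (\<integral>x. rho x \<partial>lborel)" using pos by (simp add: ig1)
    show "0 < k / t" using k t by simp
    show "C1_gradient g Dg" by (rule g)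
    show "\<bar>g x\<bar> \<le> B" for x by (rule B)
    show "Dg x = 0" if "R < norm x" for x by (rule R[OF that])
    fix x y :: 'a and s q :: real assume sq: "0 < s" "0 < q" "s + q = 1"
    show "rho x powr s * rho y powr q * exp (s * q * (k / t) / 2 * (norm (x - y))\<^sup>2) \<le> rho (s *\<^sub>R x + q *\<^sub>R y)"
    proof (cases "norm (x - a) < r \<and> norm (y - a) < r")
      case False
      then have "rho x = 0 \<or> rho y = 0" by (auto simp: rho_def w_out not_less)
      then show ?thesis using r0 by auto
    next
      case True
      let ?z = "s *\<^sub>R x + q *\<^sub>R y"
      have cz: "f ?z + s * q * k / 2 * (norm (x - y))\<^sup>2 \<le> s * f x + q * f y"
        using True sq by (intro conv) (auto simp: dist_norm norm_minus_commute)
      have "dens t x powr s * dens t y powr q * exp (s * q * (k / t) / 2 * (norm (x - y))\<^sup>2)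
        = exp (- (s * f x + q * f y - s * q * k / 2 * (norm (x - y))\<^sup>2) / t) / (Z t powr s * Z t powr q)"
        unfolding dens_def using Z_pos[OF t] t
        by (simp add: powr_divide powr_def[of "exp _"] exp_add[symmetric]) (simp add: field_simps)
      also have "Z t powr s * Z t powr q = Z t" using Z_pos[OF t] sq by (simp flip: powr_add)
      also have "exp (- (s * f x + q * f y - s * q * k / 2 * (norm (x - y))\<^sup>2) / t) / Z t \<le> dens t ?z"
      proof -
        have "- (s * f x + q * f y - s * q * k / 2 * (norm (x - y))\<^sup>2) / t \<le> - f ?z / t"
          using cz t by (intro divide_right_mono) auto
        then show ?thesis unfolding dens_def using Z_pos[OF t] by (intro divide_right_mono) auto
      qed
      finally have 1: "dens t x powr s * dens t y powr q * exp (s * q * (k / t) / 2 * (norm (x - y))\<^sup>2) \<le> dens t ?z" .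
      have 2: "w x powr s * w y powr q \<le> w ?z" unfolding w_def by (rule step_weight_log_concave[OF AD(1) sq])
      have "rho x powr s * rho y powr q * exp (s * q * (k / t) / 2 * (norm (x - y))\<^sup>2)
        = (w x powr s * w y powr q) * (dens t x powr s * dens t y powr q * exp (s * q * (k / t) / 2 * (norm (x - y))\<^sup>2))"
        unfolding rho_def using w01 dens_pos[OF t] by (simp add: powr_mult less_imp_le)
      also have "\<dots> \<le> w ?z * dens t ?z" using 1 2 w01 by (intro mult_mono) auto
      finally show ?thesis by (simp add: rho_def)
    qed
  qed
  moreover have "(\<integral>x. (g x)\<^sup>2 * rho x \<partial>lborel) = (\<integral>x. rho x \<partial>lborel)" using N ig[of "\<lambda>x. (g x)\<^sup>2"] by (simp add: ig1)
  moreover have "(\<integral>x. rho x \<partial>lborel) \<noteq> 0" using pos by (simp add: ig1)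
  ultimately show "(\<integral>x. (g x)\<^sup>2 * ln ((g x)\<^sup>2) * w x \<partial>gibbs f t) \<le> 2 * t / k * (\<integral>x. (norm (Dg x))\<^sup>2 * w x \<partial>gibbs f t)"
    using ig[of "\<lambda>x. (g x)\<^sup>2 * ln ((g x)\<^sup>2)"] ig[of "\<lambda>x. (norm (Dg x))\<^sup>2"] by simp
qed


text \<open>The integrand phi(g) = g^2 ln g^2 - g^2 + 1 is split by the weights 1 - eta^2 and eta^2.
  By the normalization the first part integrates to the inner entropy; the second is estimated
  through v = eta (g - 1) and the outer inequality. A second cutoff zeta equals 1 wherever eta or
  its gradient is nonzero. All errors are multiples of one quantity, the integral of zeta^2 (g -
  1)^2.\<close>

lemma local_to_global:
  assumes r: "0 < r" and k: "0 < k" and e: "0 < e"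
    and conv: "\<And>x y s t. x \<in> ball a r \<Longrightarrow> y \<in> ball a r \<Longrightarrow> 0 < s \<Longrightarrow> 0 < t \<Longrightarrow> s + t = 1 \<Longrightarrow>
       f (s *\<^sub>R x + t *\<^sub>R y) + s * t * k / 2 * (norm (x - y))\<^sup>2 \<le> s * f x + t * f y"
  obtains K where "\<forall>\<^sub>F t in at_right 0. \<forall>g Dg B R. C1_gradient g Dg \<longrightarrow> (\<forall>x. 0 < g x) \<longrightarrow> (\<forall>x. g x \<le> B) \<longrightarrow> (\<forall>x. R < norm x \<longrightarrow> Dg x = 0) \<longrightarrow>
     (\<integral>x. (g x)\<^sup>2 * (1 - (radial_step a (r\<^sup>2/2) (r\<^sup>2/4) x)\<^sup>2) \<partial>gibbs f t) = (\<integral>x. 1 - (radial_step a (r\<^sup>2/2) (r\<^sup>2/4) x)\<^sup>2 \<partial>gibbs f t) \<longrightarrow>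
     (\<integral>x. (g x)\<^sup>2 * ln ((g x)\<^sup>2) \<partial>gibbs f t) - (\<integral>x. (g x)\<^sup>2 \<partial>gibbs f t) * ln (\<integral>x. (g x)\<^sup>2 \<partial>gibbs f t)
       \<le> 2 * t * (max (1 / k) (C * (1 + e)\<^sup>2) + K * t) * (\<integral>x. (norm (Dg x))\<^sup>2 \<partial>gibbs f t)"
proof -

  \<comment> \<open>Two nested cutoffs and the constants they produce\<close>
  define eta where "eta = radial_step a (r\<^sup>2/2) (r\<^sup>2/4)"
  define etag where "etag = radial_step_gradient a (r\<^sup>2/2) (r\<^sup>2/4)"
  define zeta where "zeta = radial_step a (r\<^sup>2/8) (r\<^sup>2/4)"
  define zetag where "zetag = radial_step_gradient a (r\<^sup>2/8) (r\<^sup>2/4)"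
  have r2: "0 < r\<^sup>2" "0 < r\<^sup>2/4" using r by auto
  have etaC: "C1_gradient eta etag" unfolding eta_def etag_def by (rule radial_step_C1[OF r2(2)])
  have zetaC: "C1_gradient zeta zetag" unfolding zeta_def zetag_def by (rule radial_step_C1[OF r2(2)])
  have eta01: "0 \<le> eta x" "eta x \<le> 1" for x unfolding eta_def by (rule radial_step_bounds)+
  have zeta01: "0 \<le> zeta x" "zeta x \<le> 1" for x unfolding zeta_def by (rule radial_step_bounds)+
  have eta_in: "eta x = 0" "etag x = 0" if "(norm (x - a))\<^sup>2 \<le> r\<^sup>2/2" for x
    unfolding eta_def etag_def using radial_step_inner[OF r2(2) that] by auto
  have eta_out: "eta x = 1" "etag x = 0" if "r\<^sup>2 \<le> (norm (x - a))\<^sup>2" for x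
    unfolding eta_def etag_def using radial_step_outer[OF r2(2), of "r\<^sup>2/2" x a] that r2(1) by auto
  have zeta_in: "zeta x = 0" "zetag x = 0" if "(norm (x - a))\<^sup>2 \<le> r\<^sup>2/8" for x
    unfolding zeta_def zetag_def using radial_step_inner[OF r2(2) that] by auto
  have zeta_out: "zeta x = 1" "zetag x = 0" if "r\<^sup>2/2 \<le> (norm (x - a))\<^sup>2" for x
    unfolding zeta_def zetag_def using radial_step_outer[OF r2(2), of "r\<^sup>2/8" x a] that r2(1) by auto
  \<comment> \<open>In terms of the squared distance, the transition of \<open>zeta\<close>, from
    r^2/8 to 3r^2/8, is over before that of \<open>eta\<close>, from r^2/2 to 3r^2/4,
    begins.\<close>
  have ez: "eta x = 0 \<and> etag x = 0 \<or> zeta x = 1" for x using eta_in[of x] zeta_out[of x] by linarith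
  have zz: "zetag x = 0 \<or> eta x = 0" for x using eta_in[of x] zeta_out[of x] by linarith
  define Ke where "Ke = 8 * sqrt (r\<^sup>2/2 + r\<^sup>2/4) / (r\<^sup>2/4)"
  define Kz where "Kz = 8 * sqrt (r\<^sup>2/8 + r\<^sup>2/4) / (r\<^sup>2/4)"
  have Ke: "norm (etag x) \<le> Ke" for x unfolding etag_def Ke_def by (rule radial_step_gradient_le) (use r2 in auto)
  have Kz: "norm (zetag x) \<le> Kz" for x unfolding zetag_def Kz_def by (rule radial_step_gradient_le) (use r2 in auto)
  \<comment> \<open>The constant of the outer Poincare inequality at radius \<open>r / 3\<close>;
    both cutoffs vanish there, since 1/9 < 1/8.\<close>
  define K1 where "K1 = 16 * C\<^sup>2 / (r/3)\<^sup>2"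
  have K1: "0 \<le> K1" by (simp add: K1_def)
  define K2 where "K2 = K1 * (2 + 2 * Kz\<^sup>2 * (2 / k))"
  have K2: "0 \<le> K2" unfolding K2_def using K1 k by (intro mult_nonneg_nonneg add_nonneg_nonneg) auto
  \<comment> \<open>The coefficient of the error integral in the final estimate, namely 12 plus the
    Young term, times \<open>K2\<close> and divided by the 2 in \<open>2 * t\<close>.\<close>
  define K3 where "K3 = C * (1 + e) * ((1 + 1 / e) * Ke\<^sup>2) * K2 + 6 * K2"
  have w_le1: "0 \<le> 1 - (eta x)\<^sup>2" "1 - (eta x)\<^sup>2 \<le> 1" for x using eta01[of x] by (auto simp: power_le_one)
  have "0 < r / 3" using r by simp
  have ev1: "\<forall>\<^sub>F t::real in at_right 0. 0 < t \<and> t < 1"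
    unfolding eventually_at_right_field by (intro exI[of _ 1]) auto
  show thesis
  proof (rule that[of K3])
    show "\<forall>\<^sub>F t in at_right 0. \<forall>g Dg B R. C1_gradient g Dg \<longrightarrow> (\<forall>x. 0 < g x) \<longrightarrow> (\<forall>x. g x \<le> B) \<longrightarrow> (\<forall>x. R < norm x \<longrightarrow> Dg x = 0) \<longrightarrow>
     (\<integral>x. (g x)\<^sup>2 * (1 - (radial_step a (r\<^sup>2/2) (r\<^sup>2/4) x)\<^sup>2) \<partial>gibbs f t) = (\<integral>x. 1 - (radial_step a (r\<^sup>2/2) (r\<^sup>2/4) x)\<^sup>2 \<partial>gibbs f t) \<longrightarrow>
     (\<integral>x. (g x)\<^sup>2 * ln ((g x)\<^sup>2) \<partial>gibbs f t) - (\<integral>x. (g x)\<^sup>2 \<partial>gibbs f t) * ln (\<integral>x. (g x)\<^sup>2 \<partial>gibbs f t)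
       \<le> 2 * t * (max (1 / k) (C * (1 + e)\<^sup>2) + K3 * t) * (\<integral>x. (norm (Dg x))\<^sup>2 \<partial>gibbs f t)"
      using outer_inequalities[OF \<open>0 < r / 3\<close> e] ev1
    proof eventually_elim
      case (elim t)
      then have t: "0 < t" "t < 1" by auto
      note outer = elim(1)[rule_format]
      interpret prob_space "gibbs f t" by (rule prob_gibbs[OF t(1)])
      show ?case
      proof (intro allI impI)
        fix g Dg B R assume g: "C1_gradient g Dg" and gp: "\<forall>x. 0 < g x" and gB: "\<forall>x. g x \<le> B"
          and gR: "\<forall>x. R < norm x \<longrightarrow> Dg x = 0"
          and norm0: "(\<integral>x. (g x)\<^sup>2 * (1 - (radial_step a (r\<^sup>2/2) (r\<^sup>2/4) x)\<^sup>2) \<partial>gibbs f t) = (\<integral>x. 1 - (radial_step a (r\<^sup>2/2) (r\<^sup>2/4) x)\<^sup>2 \<partial>gibbs f t)"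
        define w where "w x = 1 - (eta x)\<^sup>2" for x
        have w01: "0 \<le> w x" "w x \<le> 1" for x using w_le1 by (auto simp: w_def)
        have [measurable]: "g \<in> borel_measurable borel" "Dg \<in> borel_measurable borel"
          using C1_gradient_measurable[OF g] by auto
        have [measurable]: "eta \<in> borel_measurable borel" "zeta \<in> borel_measurable borel" "etag \<in> borel_measurable borel" "zetag \<in> borel_measurable borel"
          using C1_gradient_measurable[OF etaC] C1_gradient_measurable[OF zetaC] by auto
        have [measurable]: "w \<in> borel_measurable borel" unfolding w_def by measurable
        have B0: "0 < B" using gp gB by (meson less_le_trans)
        have gabs: "\<bar>g x\<bar> \<le> B" for x using gp[rule_format, of x] gB[rule_format, of x] by auto
        have g2B: "(g x)\<^sup>2 \<le> B\<^sup>2" for x using gabs[of x] B0 by (simp add: abs_le_square_iff[symmetric])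
        have gR': "Dg x = 0" if "R < norm x" for x using gR that by blast
        obtain BD where BD: "0 \<le> BD" "\<And>x. norm (Dg x) \<le> BD"
          by (rule continuous_bounded_support_bound[OF C1_gradientD(2)[OF g] gR']) auto
        have D2B: "(norm (Dg x))\<^sup>2 \<le> BD\<^sup>2" for x using BD by (intro power_mono) auto
        have intb: "integrable (gibbs f t) F" if "F \<in> borel_measurable borel" "\<And>x. \<bar>F x\<bar> \<le> b" for F :: "'a \<Rightarrow> real" and b
          using integrable_gibbs[OF t(1) that] .
        have multw: "\<bar>u * w x\<bar> \<le> b" if "\<bar>u\<bar> \<le> b" for u b x
        proof -
          have "\<bar>u * w x\<bar> = \<bar>u\<bar> * w x" using w01[of x] by (simp add: abs_mult)
          also have "\<dots> \<le> \<bar>u\<bar>" using w01[of x] by (simp add: mult_left_le)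
          finally show ?thesis using that by simp
        qed
        have mult1: "\<bar>u * p\<bar> \<le> b" if "0 \<le> u" "u \<le> 1" "\<bar>p\<bar> \<le> b" for u p b :: real
          using mult_mono[of "\<bar>u\<bar>" 1 "\<bar>p\<bar>" b] that by (simp add: abs_mult)

        \<comment> \<open>Centring at 1 and exact splitting of the Fisher integral\<close>
        define h where "h x = g x - 1" for x
        have hC: "C1_gradient h Dg"
          using C1_gradient_add[OF g C1_gradient_const[of "-1"]] by (simp add: h_def[abs_def])
        have [measurable]: "h \<in> borel_measurable borel" unfolding h_def by measurable
        have hB: "\<bar>h x\<bar> \<le> B + 1" for x using gabs[of x] by (simp add: h_def)
        have h2B: "(h x)\<^sup>2 \<le> (B + 1)\<^sup>2" for x using hB[of x] B0 by (simp add: abs_le_square_iff[symmetric])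
        have lnb: "\<bar>(g x)\<^sup>2 * ln ((g x)\<^sup>2)\<bar> \<le> 2 + B\<^sup>2 * B\<^sup>2" for x by (rule abs_mult_ln_le[OF zero_le_power2 g2B])
        define I where "I = (\<integral>x. (norm (Dg x))\<^sup>2 \<partial>gibbs f t)"
        define I1 where "I1 = (\<integral>x. (norm (Dg x))\<^sup>2 * w x \<partial>gibbs f t)"
        define I2 where "I2 = (\<integral>x. (eta x)\<^sup>2 * (norm (Dg x))\<^sup>2 \<partial>gibbs f t)"
        have iI: "integrable (gibbs f t) (\<lambda>x. (norm (Dg x))\<^sup>2)" by (rule intb[of _ "BD\<^sup>2"]) (auto simp: D2B)
        have iI1: "integrable (gibbs f t) (\<lambda>x. (norm (Dg x))\<^sup>2 * w x)" by (rule intb[of _ "BD\<^sup>2"]) (measurable, intro multw, simp add: D2B)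
        have eta2: "(eta x)\<^sup>2 \<le> 1" "(zeta x)\<^sup>2 \<le> 1" for x using eta01[of x] zeta01[of x] by (auto simp: power_le_one)
        have iI2: "integrable (gibbs f t) (\<lambda>x. (eta x)\<^sup>2 * (norm (Dg x))\<^sup>2)"
          by (rule intb[of _ "BD\<^sup>2"], measurable, rule mult1) (auto simp: D2B eta2)
        have I12: "I = I1 + I2"
        proof -
          have "I1 + I2 = (\<integral>x. (norm (Dg x))\<^sup>2 * w x + (eta x)\<^sup>2 * (norm (Dg x))\<^sup>2 \<partial>gibbs f t)"
            using iI1 iI2 by (simp add: I1_def I2_def)
          also have "\<dots> = I" unfolding I_def by (intro Bochner_Integration.integral_cong refl) (simp add: w_def algebra_simps)
          finally show ?thesis by simp
        qed
        have I10: "0 \<le> I1" unfolding I1_def by (intro integral_nonneg_AE) (simp add: w01)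
        have I20: "0 \<le> I2" unfolding I2_def by (intro integral_nonneg_AE) simp

        \<comment> \<open>The inner entropy and the square of \<open>h\<close> near the
          minimizer\<close>
        have norm1: "(\<integral>x. (g x)\<^sup>2 * w x \<partial>gibbs f t) = (\<integral>x. w x \<partial>gibbs f t)" using norm0 by (simp add: w_def eta_def)
        define EI where "EI = (\<integral>x. (g x)\<^sup>2 * ln ((g x)\<^sup>2) * w x \<partial>gibbs f t)"
        have inner: "EI \<le> 2 * t / k * I1"
          unfolding EI_def I1_def w_def eta_def
          by (rule inner_log_Sobolev(2)[OF r k conv t(1) r2(2) _ _ g gabs gR'])
             (use r2 norm0 in auto)
        have ih: "integrable (gibbs f t) (\<lambda>x. (h x)\<^sup>2 * w x)" by (rule intb[of _ "(B+1)\<^sup>2"]) (measurable, intro multw, simp add: h2B)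
        have iE: "integrable (gibbs f t) (\<lambda>x. (g x)\<^sup>2 * ln ((g x)\<^sup>2) * w x)" 
        proof (rule intb)
          show "\<bar>(g x)\<^sup>2 * ln ((g x)\<^sup>2) * w x\<bar> \<le> 2 + B\<^sup>2 * B\<^sup>2" for x by (intro multw lnb)
        qed measurable
        have igw: "integrable (gibbs f t) (\<lambda>x. (g x)\<^sup>2 * w x)" by (rule intb[of _ "B\<^sup>2"]) (measurable, intro multw, simp add: g2B)
        have iw: "integrable (gibbs f t) w" by (rule intb[of _ 1]) (use w01 in \<open>auto simp: abs_le_iff intro: order_trans[of _ 0]\<close>)
        define H where "H = (\<integral>x. (h x)\<^sup>2 * w x \<partial>gibbs f t)"
        have HE: "H \<le> EI"
        proof -
          have "H \<le> (\<integral>x. (g x)\<^sup>2 * ln ((g x)\<^sup>2) * w x - (g x)\<^sup>2 * w x + w x \<partial>gibbs f t)"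
            unfolding H_def
          proof (intro integral_mono ih Bochner_Integration.integrable_add Bochner_Integration.integrable_diff iE igw iw)
            fix x
            show "(h x)\<^sup>2 * w x \<le> (g x)\<^sup>2 * ln ((g x)\<^sup>2) * w x - (g x)\<^sup>2 * w x + w x"
              using mult_right_mono[OF entropy_integrand_ge[of "g x"] w01(1)[of x]] gp by (simp add: h_def algebra_simps)
          qed
          also have "\<dots> = EI" using iE igw iw norm1 by (simp add: EI_def)
          finally show ?thesis .
        qed

        \<comment> \<open>Poincare estimate for \<open>h\<close> away from the minimizer\<close>
        define J where "J = (\<integral>x. (zeta x)\<^sup>2 * (h x)\<^sup>2 \<partial>gibbs f t)"
        have iJ: "integrable (gibbs f t) (\<lambda>x. (zeta x)\<^sup>2 * (h x)\<^sup>2)"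
          by (rule intb[of _ "(B+1)\<^sup>2"], measurable, rule mult1) (auto simp: h2B eta2)
        have J0: "0 \<le> J" unfolding J_def by (intro integral_nonneg_AE) simp
        \<comment> \<open>The gradient of \<open>zeta\<close> is nonzero only where
          \<open>w x = 1\<close>, so the term it produces is bounded by \<open>H\<close>, hence by
          the inner entropy. This avoids a circle: the cutoff error of the outer Poincare inequality
          is controlled from inside.\<close>
        have Jle: "J \<le> K2 * t\<^sup>2 * I"
        proof -
          have zC: "C1_gradient (\<lambda>x. zeta x * h x) (\<lambda>x. zeta x *\<^sub>R Dg x + h x *\<^sub>R zetag x)"
            by (rule C1_gradient_mult[OF zetaC hC])
          have "(\<integral>x. (zeta x * h x)\<^sup>2 \<partial>gibbs f t) \<le> K1 * t\<^sup>2 * (\<integral>x. (norm (zeta x *\<^sub>R Dg x + h x *\<^sub>R zetag x))\<^sup>2 \<partial>gibbs f t)"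
            unfolding K1_def
          proof (rule outer[OF zC, THEN conjunct1])
            show "\<bar>zeta x * h x\<bar> \<le> 1 * (B + 1)" for x
              unfolding abs_mult using zeta01[of x] hB[of x] by (intro mult_mono) auto
            show "zeta x *\<^sub>R Dg x + h x *\<^sub>R zetag x = 0" if "max R (norm a + r) < norm x" for x
            proof -
              have "r \<le> norm (x - a)" using that norm_triangle_ineq2[of x a] by linarith
              then have "r\<^sup>2 \<le> (norm (x - a))\<^sup>2" using r by (intro power_mono) auto
              then have "r\<^sup>2/2 \<le> (norm (x - a))\<^sup>2" using r2 by linarith
              then have "zetag x = 0" by (rule zeta_out)
              then show ?thesis using that gR' by simp
            qed
            show "zeta x * h x = 0" if "norm (x - a) < r / 3" for x
            proof -
              have "(norm (x - a))\<^sup>2 \<le> (r / 3)\<^sup>2" using that by (intro power_mono) auto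
              also have "\<dots> \<le> r\<^sup>2 / 8" using r2 by (simp add: power_divide)
              finally show ?thesis using zeta_in by simp
            qed
          qed
          moreover have "(\<integral>x. (norm (zeta x *\<^sub>R Dg x + h x *\<^sub>R zetag x))\<^sup>2 \<partial>gibbs f t) \<le> (\<integral>x. 2 * (norm (Dg x))\<^sup>2 + 2 * Kz\<^sup>2 * ((h x)\<^sup>2 * w x) \<partial>gibbs f t)"
          proof (rule integral_mono')
            show "integrable (gibbs f t) (\<lambda>x. 2 * (norm (Dg x))\<^sup>2 + 2 * Kz\<^sup>2 * ((h x)\<^sup>2 * w x))"
              using iI ih by simp
            fix x
            have "(norm (zeta x *\<^sub>R Dg x + h x *\<^sub>R zetag x))\<^sup>2 \<le> (norm (zeta x *\<^sub>R Dg x) + norm (h x *\<^sub>R zetag x))\<^sup>2"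
              by (intro power_mono norm_triangle_ineq) simp
            also have "\<dots> \<le> 2 * (norm (zeta x *\<^sub>R Dg x))\<^sup>2 + 2 * (norm (h x *\<^sub>R zetag x))\<^sup>2"
              using sum_squares_ge_zero zero_le_power2[of "norm (zeta x *\<^sub>R Dg x) - norm (h x *\<^sub>R zetag x)"]
              by (simp add: power2_sum power2_diff)
            also have "(norm (zeta x *\<^sub>R Dg x))\<^sup>2 \<le> (norm (Dg x))\<^sup>2"
              using eta2(2)[of x] by (simp add: power_mult_distrib mult_left_le_one_le)
            also have "(norm (h x *\<^sub>R zetag x))\<^sup>2 \<le> Kz\<^sup>2 * ((h x)\<^sup>2 * w x)"
            proof (cases "zetag x = 0")
              case False
              then have "w x = 1" using zz[of x] by (simp add: w_def)
              moreover have "(norm (zetag x))\<^sup>2 \<le> Kz\<^sup>2" using Kz by (intro power_mono) auto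
              ultimately show ?thesis using mult_left_mono[of "(norm (zetag x))\<^sup>2" "Kz\<^sup>2" "(h x)\<^sup>2"]
                by (simp add: power_mult_distrib mult.commute)
            qed (use w01[of x] in simp)
            finally show "(norm (zeta x *\<^sub>R Dg x + h x *\<^sub>R zetag x))\<^sup>2 \<le> 2 * (norm (Dg x))\<^sup>2 + 2 * Kz\<^sup>2 * ((h x)\<^sup>2 * w x)" by simp
            show "0 \<le> 2 * (norm (Dg x))\<^sup>2 + 2 * Kz\<^sup>2 * ((h x)\<^sup>2 * w x)" using w01[of x] by simp
          qed
          moreover have "(\<integral>x. 2 * (norm (Dg x))\<^sup>2 + 2 * Kz\<^sup>2 * ((h x)\<^sup>2 * w x) \<partial>gibbs f t) = 2 * I + 2 * Kz\<^sup>2 * H"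
            using iI ih by (simp add: I_def H_def)
          moreover have "2 * Kz\<^sup>2 * H \<le> 2 * Kz\<^sup>2 * (2 / k * I)"
          proof -
            have "H \<le> 2 * t / k * I1" using HE inner by simp
            also have "\<dots> \<le> 2 / k * I" using t k I12 I20 I10 by (intro mult_mono divide_right_mono) auto
            finally show ?thesis by (intro mult_left_mono) auto
          qed
          ultimately have "(\<integral>x. (zeta x * h x)\<^sup>2 \<partial>gibbs f t) \<le> K1 * t\<^sup>2 * (2 * I + 2 * Kz\<^sup>2 * (2 / k * I))"
            using K1 by (elim order_trans) (intro mult_left_mono, linarith, simp)
          then show ?thesis by (simp add: J_def K2_def power_mult_distrib algebra_simps)
        qed

        \<comment> \<open>Fisher integral and entropy of the outer part\<close>
        define v where "v x = eta x * h x" for x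
        define V where "V x = eta x *\<^sub>R Dg x + h x *\<^sub>R etag x" for x
        have vC: "C1_gradient v V" unfolding v_def V_def by (rule C1_gradient_mult[OF etaC hC])
        have [measurable]: "v \<in> borel_measurable borel" "V \<in> borel_measurable borel" using C1_gradient_measurable[OF vC] by auto
        have vB: "\<bar>v x\<bar> \<le> 1 * (B + 1)" for x
          unfolding v_def abs_mult using eta01[of x] hB[of x] by (intro mult_mono) auto
        have v2B: "(v x)\<^sup>2 \<le> (B + 1)\<^sup>2" for x using vB[of x] B0 by (simp add: abs_le_square_iff[symmetric])
        define M0 where "M0 = (\<integral>x. (v x)\<^sup>2 \<partial>gibbs f t)"
        define WV where "WV = (\<integral>x. (norm (V x))\<^sup>2 \<partial>gibbs f t)"
        have iv: "integrable (gibbs f t) (\<lambda>x. (v x)\<^sup>2)" by (rule intb[of _ "(B+1)\<^sup>2"]) (auto simp: v2B)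
        have M00: "0 \<le> M0" unfolding M0_def by (intro integral_nonneg_AE) simp
        have vzeta: "(v x)\<^sup>2 \<le> (zeta x)\<^sup>2 * (h x)\<^sup>2" for x
          using ez[of x] eta2(1)[of x] by (auto simp: v_def power_mult_distrib intro!: mult_left_le_one_le)
        have M0J: "M0 \<le> J" unfolding M0_def J_def by (intro integral_mono iv iJ vzeta)
        \<comment> \<open>Young's inequality with parameter \<open>e\<close> separates the two terms
          of the product rule. This is the second factor \<open>1 + e\<close> in the final constant;
          the first one belongs to the outer log-Sobolev inequality.\<close>
        have WVle: "WV \<le> (1 + e) * I2 + (1 + 1 / e) * Ke\<^sup>2 * J"
        proof -
          have "WV \<le> (\<integral>x. (1 + e) * ((eta x)\<^sup>2 * (norm (Dg x))\<^sup>2) + (1 + 1 / e) * Ke\<^sup>2 * ((zeta x)\<^sup>2 * (h x)\<^sup>2) \<partial>gibbs f t)"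
            unfolding WV_def
          proof (rule integral_mono')
            show "integrable (gibbs f t) (\<lambda>x. (1 + e) * ((eta x)\<^sup>2 * (norm (Dg x))\<^sup>2) + (1 + 1 / e) * Ke\<^sup>2 * ((zeta x)\<^sup>2 * (h x)\<^sup>2))"
              using iI2 iJ by simp
            fix x
            have young: "(p + q)\<^sup>2 \<le> (1 + e) * p\<^sup>2 + (1 + 1 / e) * q\<^sup>2" for p q :: real
            proof -
              have "0 \<le> (e * p - q)\<^sup>2 / e" using e by simp
              also have "\<dots> = e * p\<^sup>2 + 1 / e * q\<^sup>2 - 2 * p * q" using e by (simp add: power2_eq_square field_simps)
              finally show ?thesis by (simp add: power2_sum algebra_simps)
            qed
            have "(norm (V x))\<^sup>2 \<le> (norm (eta x *\<^sub>R Dg x) + norm (h x *\<^sub>R etag x))\<^sup>2"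
              unfolding V_def by (intro power_mono norm_triangle_ineq) simp
            also have "\<dots> \<le> (1 + e) * (norm (eta x *\<^sub>R Dg x))\<^sup>2 + (1 + 1 / e) * (norm (h x *\<^sub>R etag x))\<^sup>2" by (rule young)
            also have "(norm (h x *\<^sub>R etag x))\<^sup>2 \<le> Ke\<^sup>2 * ((zeta x)\<^sup>2 * (h x)\<^sup>2)"
            proof (cases "etag x = 0")
              case False
              then have "zeta x = 1" using ez[of x] by simp
              moreover have "(norm (etag x))\<^sup>2 \<le> Ke\<^sup>2" using Ke by (intro power_mono) auto
              ultimately show ?thesis using mult_left_mono[of "(norm (etag x))\<^sup>2" "Ke\<^sup>2" "(h x)\<^sup>2"]
                by (simp add: power_mult_distrib mult.commute)
            qed simp
            finally show "(norm (V x))\<^sup>2 \<le> (1 + e) * ((eta x)\<^sup>2 * (norm (Dg x))\<^sup>2) + (1 + 1 / e) * Ke\<^sup>2 * ((zeta x)\<^sup>2 * (h x)\<^sup>2)"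
              using e by (simp add: power_mult_distrib mult_left_mono mult.assoc)
            show "0 \<le> (1 + e) * ((eta x)\<^sup>2 * (norm (Dg x))\<^sup>2) + (1 + 1 / e) * Ke\<^sup>2 * ((zeta x)\<^sup>2 * (h x)\<^sup>2)" using e by simp
          qed
          also have "\<dots> = (1 + e) * I2 + (1 + 1 / e) * Ke\<^sup>2 * J" using iI2 iJ by (simp add: I2_def J_def)
          finally show ?thesis .
        qed
        \<comment> \<open>The logarithm of the constant in the variational formula. The outer
          inequality is relative to the mass \<open>M0\<close> of v^2, and undoing this
          normalization costs \<open>l * M0\<close>, which is not linear in \<open>M0\<close>. The
          term - l g^2 of the variational formula compensates it.\<close>
        define l where "l = ln (1 + M0)"
        have l: "0 \<le> l" "l\<^sup>2 \<le> 4 * M0" using M00 ln_one_plus_square_le[OF M00] by (auto simp: l_def)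
        define OE where "OE = (\<integral>x. (v x)\<^sup>2 * ln ((1 + \<bar>v x\<bar>)\<^sup>2) \<partial>gibbs f t)"
        have lnnn: "0 \<le> ln ((1 + \<bar>s\<bar>)\<^sup>2)" for s :: real by (intro ln_ge_zero) (auto intro: one_le_power)
        have iOE: "integrable (gibbs f t) (\<lambda>x. (v x)\<^sup>2 * ln ((1 + \<bar>v x\<bar>)\<^sup>2))"
        proof (rule intb)
          fix x
          have "(1 + \<bar>v x\<bar>)\<^sup>2 \<le> (1 + (B + 1))\<^sup>2" using vB[of x] by (intro power_mono) auto
          then have "ln ((1 + \<bar>v x\<bar>)\<^sup>2) \<le> ln ((1 + (B + 1))\<^sup>2)" by (intro ln_mono) (auto simp: zero_less_power add_pos_nonneg)
          then show "\<bar>(v x)\<^sup>2 * ln ((1 + \<bar>v x\<bar>)\<^sup>2)\<bar> \<le> (B + 1)\<^sup>2 * ln ((1 + (B + 1))\<^sup>2)"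
            unfolding abs_mult using v2B[of x] lnnn[of "v x"] by (intro mult_mono) auto
        qed measurable
        have OEle: "OE - l * M0 \<le> M0 + 2 * C * t * (1 + e) * WV"
        \<comment> \<open>The outer log-Sobolev inequality divides by the mass; if that is 0,
          \<open>v\<close> vanishes almost everywhere and so does its entropy.\<close>
        proof (cases "M0 = 0")
          case True
          then have "AE x in gibbs f t. (v x)\<^sup>2 = 0" using integral_nonneg_eq_0_iff_AE[OF iv] by (simp add: M0_def)
          then have "AE x in gibbs f t. (v x)\<^sup>2 * ln ((1 + \<bar>v x\<bar>)\<^sup>2) = 0" by eventually_elim simp
          then have "OE = 0" unfolding OE_def by (rule integral_eq_zero_AE)
          moreover have "0 \<le> WV" unfolding WV_def by (intro integral_nonneg_AE) simp
          ultimately show ?thesis using True C t e by simp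
        next
          case False
          then have M0p: "0 < M0" using M00 by simp
          have vR: "V x = 0" if "max R (norm a + r) < norm x" for x
          proof -
            have "r \<le> norm (x - a)" using that norm_triangle_ineq2[of x a] by linarith
            then have "r\<^sup>2 \<le> (norm (x - a))\<^sup>2" using r by (intro power_mono) auto
            then have "etag x = 0" by (intro eta_out)
            then show ?thesis using that gR' by (simp add: V_def)
          qed
          have v0: "v x = 0" if "norm (x - a) < r / 3" for x
          proof -
            have "(norm (x - a))\<^sup>2 \<le> (r / 3)\<^sup>2" using that by (intro power_mono) auto
            also have "\<dots> \<le> r\<^sup>2 / 2" using r2 by (simp add: power_divide)
            finally show ?thesis using eta_in by (simp add: v_def)
          qed
          have o2: "(\<integral>x. (v x)\<^sup>2 * ln (1 + (v x)\<^sup>2 / M0) \<partial>gibbs f t) \<le> 2 * C * t * (1 + e) * WV"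
            unfolding M0_def WV_def
            using outer[OF vC vB, of "max R (norm a + r)"] vR v0 M0p unfolding M0_def by blast
          have io2: "integrable (gibbs f t) (\<lambda>x. (v x)\<^sup>2 * ln (1 + (v x)\<^sup>2 / M0))"
          proof (rule intb)
            fix x
            have "(v x)\<^sup>2 / M0 \<le> (B + 1)\<^sup>2 / M0" using v2B[of x] M0p by (intro divide_right_mono) auto
            moreover have "0 \<le> (v x)\<^sup>2 / M0" using M0p by simp
            ultimately have "ln (1 + (v x)\<^sup>2 / M0) \<le> ln (1 + (B + 1)\<^sup>2 / M0)" "0 \<le> ln (1 + (v x)\<^sup>2 / M0)" by (auto intro!: ln_mono)
            then show "\<bar>(v x)\<^sup>2 * ln (1 + (v x)\<^sup>2 / M0)\<bar> \<le> (B + 1)\<^sup>2 * ln (1 + (B + 1)\<^sup>2 / M0)"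
              unfolding abs_mult using v2B[of x] by (intro mult_mono) auto
          qed measurable
          have "OE \<le> (\<integral>x. (l + 1) * (v x)\<^sup>2 + (v x)\<^sup>2 * ln (1 + (v x)\<^sup>2 / M0) \<partial>gibbs f t)"
            unfolding OE_def
          proof (intro integral_mono iOE Bochner_Integration.integrable_add integrable_mult_right iv io2)
            fix x
            define y where "y = \<bar>v x\<bar>"
            have y: "(v x)\<^sup>2 = y\<^sup>2" "0 \<le> y" by (auto simp: y_def)
            \<comment> \<open>After (1 + y)^2 \<le> 2 (1 + y^2), adding M0 + y^2 / M0 completes a
              product whose logarithm separates into ln 2, \<open>l\<close> and the logarithm of the
              outer inequality.\<close>
            have "(1 + y)\<^sup>2 \<le> 2 * ((1 + M0) * (1 + y\<^sup>2 / M0))"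
            proof -
              have "(1 + y)\<^sup>2 \<le> 2 * (1 + y\<^sup>2)" using zero_le_power2[of "1 - y"] by (simp add: power2_eq_square algebra_simps)
              moreover have "0 \<le> y\<^sup>2 / M0" using M0p by simp
              ultimately have "(1 + y)\<^sup>2 \<le> 2 * (1 + y\<^sup>2 + M0 + y\<^sup>2 / M0)" using M0p by argo
              also have "1 + y\<^sup>2 + M0 + y\<^sup>2 / M0 = (1 + M0) * (1 + y\<^sup>2 / M0)" using M0p by (simp add: algebra_simps add_divide_distrib)
              finally show ?thesis .
            qed
            moreover have q0: "0 < 1 + y\<^sup>2 / M0" using M0p by (simp add: add_pos_nonneg)
            ultimately have "ln ((1 + y)\<^sup>2) \<le> ln (2 * ((1 + M0) * (1 + y\<^sup>2 / M0)))"
              using y by (intro ln_mono) (auto simp: zero_less_power add_pos_nonneg)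
            also have "\<dots> = ln 2 + (l + ln (1 + y\<^sup>2 / M0))" using M0p q0 by (simp add: ln_mult l_def)
            also have "ln 2 \<le> (1::real)" using ln_le_minus_one[of "2::real"] by simp
            finally have "y\<^sup>2 * ln ((1 + y)\<^sup>2) \<le> y\<^sup>2 * (1 + (l + ln (1 + y\<^sup>2 / M0)))" by (simp add: mult_left_mono)
            then show "(v x)\<^sup>2 * ln ((1 + \<bar>v x\<bar>)\<^sup>2) \<le> (l + 1) * (v x)\<^sup>2 + (v x)\<^sup>2 * ln (1 + (v x)\<^sup>2 / M0)"
              unfolding y(1) y_def[symmetric] by (simp add: algebra_simps)
          qed
          also have "\<dots> = (l + 1) * M0 + (\<integral>x. (v x)\<^sup>2 * ln (1 + (v x)\<^sup>2 / M0) \<partial>gibbs f t)"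
            using iv io2 by (simp add: M0_def)
          finally show ?thesis using o2 by (simp add: algebra_simps)
        qed

        \<comment> \<open>Assembly through the variational formula for the entropy\<close>
        have pU: "prob UNIV = 1" using prob_space by simp
        define N where "N = (\<integral>x. (g x)\<^sup>2 \<partial>gibbs f t)"
        define E where "E = (\<integral>x. (g x)\<^sup>2 * ln ((g x)\<^sup>2) \<partial>gibbs f t)"
        have ig: "integrable (gibbs f t) (\<lambda>x. (g x)\<^sup>2)" by (rule intb[of _ "B\<^sup>2"]) (auto simp: g2B)
        have iEE: "integrable (gibbs f t) (\<lambda>x. (g x)\<^sup>2 * ln ((g x)\<^sup>2))"
        proof (rule intb)
          show "\<bar>(g x)\<^sup>2 * ln ((g x)\<^sup>2)\<bar> \<le> 2 + B\<^sup>2 * B\<^sup>2" for x by (rule lnb)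
        qed measurable
        \<comment> \<open>The variational formula with constant \<open>1 + M0\<close>, as the
          tangent bound of ln at (1 + M0) / N.\<close>
        have NE: "N * (l + 1) - (1 + M0) \<le> N * ln N"
        proof (cases "N = 0")
          case False
          moreover have "0 \<le> N" unfolding N_def by (intro integral_nonneg_AE) simp
          ultimately have N: "0 < N" by simp
          have "ln ((1 + M0) / N) \<le> (1 + M0) / N - 1" using N M00 by (intro ln_le_minus_one) auto
          then have "l - ln N \<le> (1 + M0) / N - 1" using N M00 by (simp add: ln_div l_def)
          then have "N * (l - ln N) \<le> N * ((1 + M0) / N - 1)" using N by (intro mult_left_mono) auto
          also have "\<dots> = (1 + M0) - N" using N by (simp add: right_diff_distrib)
          finally show ?thesis by (simp add: algebra_simps)
        qed (use M00 in simp)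
        have "E - N * (l + 1) + (1 + M0) = (\<integral>x. (g x)\<^sup>2 * ln ((g x)\<^sup>2) - (l + 1) * (g x)\<^sup>2 + (1 + M0) \<partial>gibbs f t)"
          using ig iEE by (simp add: E_def N_def pU mult.commute)
        also have "\<dots> \<le> (\<integral>x. ((g x)\<^sup>2 * ln ((g x)\<^sup>2) * w x - (g x)\<^sup>2 * w x + w x) + (v x)\<^sup>2 * ln ((1 + \<bar>v x\<bar>)\<^sup>2)
            + 5 * ((zeta x)\<^sup>2 * (h x)\<^sup>2) + (1 - l) * (v x)\<^sup>2 + (l\<^sup>2 + M0) \<partial>gibbs f t)"
        proof (intro integral_mono)
          fix x
          let ?phi = "(g x)\<^sup>2 * ln ((g x)\<^sup>2) - (g x)\<^sup>2 + 1"
          have "?phi \<le> (h x)\<^sup>2 * ln ((1 + \<bar>h x\<bar>)\<^sup>2) + 4 * (h x)\<^sup>2"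
            using entropy_integrand_le[of "g x"] gp by (simp add: h_def)
          then have "(eta x)\<^sup>2 * ?phi \<le> (eta x)\<^sup>2 * ((h x)\<^sup>2 * ln ((1 + \<bar>h x\<bar>)\<^sup>2) + 4 * (h x)\<^sup>2)" by (intro mult_left_mono) auto
          also have "\<dots> = (h x)\<^sup>2 * ((eta x)\<^sup>2 * ln ((1 + \<bar>h x\<bar>)\<^sup>2)) + 4 * (v x)\<^sup>2" by (simp add: v_def power_mult_distrib algebra_simps)
          also have "(h x)\<^sup>2 * ((eta x)\<^sup>2 * ln ((1 + \<bar>h x\<bar>)\<^sup>2)) \<le> (h x)\<^sup>2 * ((eta x)\<^sup>2 * ln ((1 + \<bar>eta x * h x\<bar>)\<^sup>2) + (if eta x = 0 then 0 else 1 - (eta x)\<^sup>2))"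
            by (intro mult_left_mono cutoff_log_le eta01) auto
          also have "\<dots> \<le> (v x)\<^sup>2 * ln ((1 + \<bar>v x\<bar>)\<^sup>2) + (zeta x)\<^sup>2 * (h x)\<^sup>2"
          proof -
            have "(h x)\<^sup>2 * (if eta x = 0 then 0 else 1 - (eta x)\<^sup>2) \<le> (zeta x)\<^sup>2 * (h x)\<^sup>2"
              using ez[of x] w_le1[of x] by (auto intro!: mult_left_le)
            then show ?thesis by (simp add: v_def power_mult_distrib algebra_simps)
          qed
          finally have 1: "(eta x)\<^sup>2 * ?phi \<le> (v x)\<^sup>2 * ln ((1 + \<bar>v x\<bar>)\<^sup>2) + 5 * ((zeta x)\<^sup>2 * (h x)\<^sup>2)"
            using vzeta[of x] by simp
          \<comment> \<open>Only the part of - l g^2 with weight eta^2 is kept. With g = 1 + h,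
            nonnegativity of (h + l)^2 + l trades it for - l v^2 plus the remainder v^2 +
            l^2.\<close>
          have "- l * (g x)\<^sup>2 \<le> - l * ((eta x)\<^sup>2 * (g x)\<^sup>2)"
            using l(1) eta2(1)[of x] by (simp add: mult_left_mono mult_left_le_one_le)
          also have "\<dots> \<le> (eta x)\<^sup>2 * ((1 - l) * (h x)\<^sup>2 + l\<^sup>2)"
          proof -
            have "0 \<le> (h x + l)\<^sup>2 + l" using l by simp
            also have "\<dots> = l * (g x)\<^sup>2 + ((1 - l) * (h x)\<^sup>2 + l\<^sup>2)" by (simp add: h_def power2_eq_square algebra_simps)
            finally have "0 \<le> (eta x)\<^sup>2 * (l * (g x)\<^sup>2 + ((1 - l) * (h x)\<^sup>2 + l\<^sup>2))" by (intro mult_nonneg_nonneg) auto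
            then show ?thesis by (simp add: algebra_simps)
          qed
          also have "\<dots> \<le> (1 - l) * (v x)\<^sup>2 + l\<^sup>2"
            using eta2(1)[of x] by (simp add: v_def power_mult_distrib distrib_left mult_left_le_one_le mult.left_commute)
          finally have 2: "- l * (g x)\<^sup>2 \<le> (1 - l) * (v x)\<^sup>2 + l\<^sup>2" .
          have "?phi = ((g x)\<^sup>2 * ln ((g x)\<^sup>2) * w x - (g x)\<^sup>2 * w x + w x) + (eta x)\<^sup>2 * ?phi" by (simp add: w_def algebra_simps)
          then show "(g x)\<^sup>2 * ln ((g x)\<^sup>2) - (l + 1) * (g x)\<^sup>2 + (1 + M0) \<le> ((g x)\<^sup>2 * ln ((g x)\<^sup>2) * w x - (g x)\<^sup>2 * w x + w x) + (v x)\<^sup>2 * ln ((1 + \<bar>v x\<bar>)\<^sup>2)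
            + 5 * ((zeta x)\<^sup>2 * (h x)\<^sup>2) + (1 - l) * (v x)\<^sup>2 + (l\<^sup>2 + M0)"
            using 1 2 distrib_right[of l 1 "(g x)\<^sup>2"] by linarith
        qed (use ig iEE iE igw iw iOE iJ iv in auto)
        also have "\<dots> = EI + OE + 5 * J + (1 - l) * M0 + (l\<^sup>2 + M0)"
          using iE igw iw iOE iJ iv norm1 by (simp add: EI_def OE_def J_def M0_def pU)
        finally have up: "E - N * (l + 1) + (1 + M0) \<le> EI + OE + 5 * J + (1 - l) * M0 + (l\<^sup>2 + M0)" .
        have "E - N * ln N \<le> E - N * (l + 1) + (1 + M0)" using NE by linarith
        \<comment> \<open>Of the 11, 5 are explicit, 2 come from \<open>2 * M0\<close> and 4 from
          the bound of \<open>l\<^sup>2\<close> by \<open>4 * M0\<close>; \<open>M0\<close> is at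
          most \<open>J\<close>.\<close>
        also have "\<dots> \<le> EI + (OE - l * M0) + 11 * J"
          using up l(2) M0J by (simp add: algebra_simps)
        also have "\<dots> \<le> EI + (M0 + 2 * C * t * (1 + e) * WV) + 11 * J" using OEle by simp
        also have "\<dots> \<le> 2 * t / k * I1 + 2 * C * t * (1 + e) * ((1 + e) * I2 + (1 + 1 / e) * Ke\<^sup>2 * J) + 12 * J"
        proof -
          have "2 * C * t * (1 + e) * WV \<le> 2 * C * t * (1 + e) * ((1 + e) * I2 + (1 + 1 / e) * Ke\<^sup>2 * J)"
            using WVle C t e by (intro mult_left_mono) auto
          then show ?thesis using inner M0J by linarith
        qed
        also have "\<dots> = 2 * t * (1 / k * I1 + C * (1 + e)\<^sup>2 * I2) + (2 * C * t * (1 + e) * ((1 + 1 / e) * Ke\<^sup>2) + 12) * J"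
          by (simp add: power2_eq_square algebra_simps)
        also have "\<dots> \<le> 2 * t * (max (1 / k) (C * (1 + e)\<^sup>2) * I) + (2 * C * (1 + e) * ((1 + 1 / e) * Ke\<^sup>2) + 12) * (K2 * t\<^sup>2 * I)"
        proof (intro add_mono)
          have "1 / k * I1 + C * (1 + e)\<^sup>2 * I2 \<le> max (1 / k) (C * (1 + e)\<^sup>2) * I1 + max (1 / k) (C * (1 + e)\<^sup>2) * I2"
            using I10 I20 by (intro add_mono mult_right_mono) auto
          then show "2 * t * (1 / k * I1 + C * (1 + e)\<^sup>2 * I2) \<le> 2 * t * (max (1 / k) (C * (1 + e)\<^sup>2) * I)"
            using t unfolding I12 by (intro mult_left_mono) (auto simp: distrib_left)
          have "2 * C * t * (1 + e) * ((1 + 1 / e) * Ke\<^sup>2) \<le> 2 * C * 1 * (1 + e) * ((1 + 1 / e) * Ke\<^sup>2)"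
            using C t e by (intro mult_right_mono mult_left_mono) auto
          then show "(2 * C * t * (1 + e) * ((1 + 1 / e) * Ke\<^sup>2) + 12) * J \<le> (2 * C * (1 + e) * ((1 + 1 / e) * Ke\<^sup>2) + 12) * (K2 * t\<^sup>2 * I)"
            using Jle J0 C e t by (intro mult_mono) auto
        qed
        also have "\<dots> = 2 * t * (max (1 / k) (C * (1 + e)\<^sup>2) + K3 * t) * I"
        proof -
          have "2 * t * (m * I) + (2 * C * (1 + e) * X + 12) * (K2 * t\<^sup>2 * I) = 2 * t * (m + (C * (1 + e) * X * K2 + 6 * K2) * t) * I"
            for m X :: real by (simp add: power2_eq_square algebra_simps)
          then show ?thesis unfolding K3_def .
        qed
        finally show "(\<integral>x. (g x)\<^sup>2 * ln ((g x)\<^sup>2) \<partial>gibbs f t) - (\<integral>x. (g x)\<^sup>2 \<partial>gibbs f t) * ln (\<integral>x. (g x)\<^sup>2 \<partial>gibbs f t)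
       \<le> 2 * t * (max (1 / k) (C * (1 + e)\<^sup>2) + K3 * t) * (\<integral>x. (norm (Dg x))\<^sup>2 \<partial>gibbs f t)"
          by (simp add: E_def N_def I_def)
      qed
    qed
  qed
qed

end

section \<open>The upper bound\<close>

context PL_potential begin

text \<open>Both sides are homogeneous of degree 2 in \<open>g\<close>, so the normalization with
  the inner weight is reached by scaling. The parameters are chosen such that \<open>1 / k\<close>
  and \<open>C * (1 + e)\<^sup>2\<close> are at most \<open>C + eps / 2\<close>. Since
  \<open>K\<close> depends neither on \<open>t\<close> nor on \<open>g\<close>, the other half of
  \<open>eps\<close> absorbs \<open>K * t\<close>.\<close>

lemma log_Sobolev_positive:
  assumes eps: "0 < eps"
  shows "\<forall>\<^sub>F t in at_right 0. \<forall>g Dg B R. C1_gradient g Dg \<longrightarrow> (\<forall>x. 0 < g x) \<longrightarrow> (\<forall>x. g x \<le> B) \<longrightarrow> (\<forall>x. R < norm x \<longrightarrow> Dg x = 0) \<longrightarrow>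
     (\<integral>x. (g x)\<^sup>2 * ln ((g x)\<^sup>2) \<partial>gibbs f t) - (\<integral>x. (g x)\<^sup>2 \<partial>gibbs f t) * ln (\<integral>x. (g x)\<^sup>2 \<partial>gibbs f t)
       \<le> 2 * t * (C + eps) * (\<integral>x. (norm (Dg x))\<^sup>2 \<partial>gibbs f t)"
proof -
  \<comment> \<open>For \<open>e \<le> 1\<close> one has (1 + e)^2 \<le> 1 + 3 e, and the 6 makes
    \<open>3 * C * e\<close> at most \<open>eps / 2\<close>.\<close>
  define e where "e = min 1 (eps / (6 * C))"
  have e: "0 < e" "e \<le> 1" "6 * C * e \<le> eps" using eps C by (auto simp: e_def min_def field_simps)
  have Ce: "C * (1 + e)\<^sup>2 \<le> C + eps / 2"
  proof -
    have "(1 + e)\<^sup>2 \<le> 1 + 3 * e" using e by (simp add: power2_eq_square algebra_simps mult_left_le)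
    then have "C * (1 + e)\<^sup>2 \<le> C * (1 + 3 * e)" using C by (intro mult_left_mono) auto
    then show ?thesis using e(3) by (simp add: algebra_simps)
  qed
  define k where "k = 1 / (C + eps / 2)"
  have k: "0 < k" "k < 1 / C" "1 / k = C + eps / 2" using C eps by (auto simp: k_def field_simps)
  obtain r where r: "0 < r" and conv: "\<And>x y s t. x \<in> ball a r \<Longrightarrow> y \<in> ball a r \<Longrightarrow> 0 < s \<Longrightarrow> 0 < t \<Longrightarrow> s + t = 1 \<Longrightarrow>
       f (s *\<^sub>R x + t *\<^sub>R y) + s * t * k / 2 * (norm (x - y))\<^sup>2 \<le> s * f x + t * f y"
    using PL_locally_strongly_convex[OF f2 C PL min k(2)] by blast
  define w where "w = (\<lambda>x. 1 - (radial_step a (r\<^sup>2/2) (r\<^sup>2/4) x)\<^sup>2)"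
  obtain K where K: "\<forall>\<^sub>F t in at_right 0. \<forall>g Dg B R. C1_gradient g Dg \<longrightarrow> (\<forall>x. 0 < g x) \<longrightarrow> (\<forall>x. g x \<le> B) \<longrightarrow> (\<forall>x. R < norm x \<longrightarrow> Dg x = 0) \<longrightarrow>
     (\<integral>x. (g x)\<^sup>2 * w x \<partial>gibbs f t) = (\<integral>x. w x \<partial>gibbs f t) \<longrightarrow>
     (\<integral>x. (g x)\<^sup>2 * ln ((g x)\<^sup>2) \<partial>gibbs f t) - (\<integral>x. (g x)\<^sup>2 \<partial>gibbs f t) * ln (\<integral>x. (g x)\<^sup>2 \<partial>gibbs f t)
       \<le> 2 * t * (max (1 / k) (C * (1 + e)\<^sup>2) + K * t) * (\<integral>x. (norm (Dg x))\<^sup>2 \<partial>gibbs f t)"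
    unfolding w_def using local_to_global[OF r k(1) e(1) conv] by blast
  have "\<forall>\<^sub>F t in at_right 0. K * t < eps / 2"
    using eps by (intro order_tendstoD(2)[of _ 0]) (auto intro!: tendsto_eq_intros)
  moreover have "\<forall>\<^sub>F t::real in at_right 0. 0 < t"
    unfolding eventually_at_right_field by (intro exI[of _ 1]) auto
  ultimately show ?thesis using K
  proof eventually_elim
    case (elim t)
    then have t: "0 < t" and Kt: "K * t < eps / 2" by auto
    interpret prob_space "gibbs f t" by (rule prob_gibbs[OF t])
    show ?case
    proof (intro allI impI)
      fix g :: "'a \<Rightarrow> real" and Dg B R assume g: "C1_gradient g Dg" and gp: "\<forall>x. 0 < g x" and gB: "\<forall>x. g x \<le> B"
        and gR: "\<forall>x. R < norm x \<longrightarrow> Dg x = 0"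
      have [measurable]: "g \<in> borel_measurable borel" using C1_gradient_measurable[OF g] by auto
      have [measurable]: "w \<in> borel_measurable borel"
      proof -
        have [measurable]: "radial_step a (r\<^sup>2/2) (r\<^sup>2/4) \<in> borel_measurable borel"
          using C1_gradient_measurable(1)[OF radial_step_C1[of "r\<^sup>2/4"]] r by auto
        show ?thesis unfolding w_def by measurable
      qed
      have w01: "0 \<le> w x" "w x \<le> 1" for x using radial_step_bounds[of a "r\<^sup>2/2" "r\<^sup>2/4" x] by (auto simp: w_def power_le_one)
      have gabs: "\<bar>g x\<bar> \<le> B" for x using gp[rule_format, of x] gB[rule_format, of x] by auto
      have B0: "0 \<le> B" using gabs[of 0] by linarith
      have g2B: "(g x)\<^sup>2 \<le> B\<^sup>2" for x using gabs[of x] B0 by (simp add: abs_le_square_iff[symmetric])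
      have r2: "0 < r\<^sup>2" using r by simp
      have W: "0 < (\<integral>x. w x \<partial>gibbs f t)"
        unfolding w_def by (rule inner_log_Sobolev(1)[OF r k(1) conv t, where g=g and Dg=Dg and B=B and R=R]) (use r2 gR g gabs in auto)
      have ig: "integrable (gibbs f t) (\<lambda>x. (g x)\<^sup>2)" by (rule integrable_gibbs[OF t, where B="B\<^sup>2"]) (auto simp: g2B)
      have iE: "integrable (gibbs f t) (\<lambda>x. (g x)\<^sup>2 * ln ((g x)\<^sup>2))"
      proof (rule integrable_gibbs[OF t])
        show "\<bar>(g x)\<^sup>2 * ln ((g x)\<^sup>2)\<bar> \<le> 2 + B\<^sup>2 * B\<^sup>2" for x by (rule abs_mult_ln_le[OF zero_le_power2 g2B])
      qed measurable
      have igw: "integrable (gibbs f t) (\<lambda>x. (g x)\<^sup>2 * w x)"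
      proof (rule integrable_gibbs[OF t])
        show "\<bar>(g x)\<^sup>2 * w x\<bar> \<le> B\<^sup>2 * 1" for x
          unfolding abs_mult using g2B[of x] w01[of x] by (intro mult_mono) auto
      qed measurable
      define S where "S = (\<integral>x. (g x)\<^sup>2 * w x \<partial>gibbs f t)"
      have S: "0 < S"
      proof -
        have "0 \<le> S" unfolding S_def by (intro integral_nonneg_AE) (simp add: w01)
        moreover have "S \<noteq> 0"
        proof
          assume "S = 0"
          then have "AE x in gibbs f t. (g x)\<^sup>2 * w x = 0"
            using integral_nonneg_eq_0_iff_AE[OF igw] w01 by (simp add: S_def)
          then have "AE x in gibbs f t. w x = 0" using gp by (auto simp: less_le)
          then have "(\<integral>x. w x \<partial>gibbs f t) = 0" by (rule integral_eq_zero_AE)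
          then show False using W by simp
        qed
        ultimately show ?thesis by simp
      qed
      define b where "b = (\<integral>x. w x \<partial>gibbs f t) / S"
      have b: "0 < b" using W S by (simp add: b_def)
      define c where "c = sqrt b"
      have c: "0 < c" "c\<^sup>2 = b" using b by (auto simp: c_def)
      define N where "N = (\<integral>x. (g x)\<^sup>2 \<partial>gibbs f t)"
      define E where "E = (\<integral>x. (g x)\<^sup>2 * ln ((g x)\<^sup>2) \<partial>gibbs f t)"
      define I where "I = (\<integral>x. (norm (Dg x))\<^sup>2 \<partial>gibbs f t)"
      have N: "0 < N"
      proof -
        have "S \<le> N" unfolding S_def N_def by (intro integral_mono igw ig) (use w01 in \<open>auto intro: mult_left_le\<close>)
        then show ?thesis using S by simp
      qed
      have cg: "C1_gradient (\<lambda>x. c * g x) (\<lambda>x. c *\<^sub>R Dg x)"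
        using C1_gradient_mult[OF C1_gradient_const g, of c] by simp
      have "(\<integral>x. (c * g x)\<^sup>2 * w x \<partial>gibbs f t) = b * S"
        unfolding S_def by (subst integral_mult_right_zero[symmetric]) (simp add: power_mult_distrib c mult.assoc)
      also have "\<dots> = (\<integral>x. w x \<partial>gibbs f t)" using S by (simp add: b_def)
      finally have n: "(\<integral>x. (c * g x)\<^sup>2 * w x \<partial>gibbs f t) = (\<integral>x. w x \<partial>gibbs f t)" .
      have main: "(\<integral>x. (c * g x)\<^sup>2 * ln ((c * g x)\<^sup>2) \<partial>gibbs f t) - (\<integral>x. (c * g x)\<^sup>2 \<partial>gibbs f t) * ln (\<integral>x. (c * g x)\<^sup>2 \<partial>gibbs f t)
       \<le> 2 * t * (max (1 / k) (C * (1 + e)\<^sup>2) + K * t) * (\<integral>x. (norm (c *\<^sub>R Dg x))\<^sup>2 \<partial>gibbs f t)"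
        by (rule elim(3)[rule_format, OF cg _ _ _ n, of "c * B" R]) (use c gp gB gR in auto)
      have Nc: "(\<integral>x. (c * g x)\<^sup>2 \<partial>gibbs f t) = b * N" unfolding N_def by (subst integral_mult_right_zero[symmetric]) (simp add: power_mult_distrib c)
      have Ic: "(\<integral>x. (norm (c *\<^sub>R Dg x))\<^sup>2 \<partial>gibbs f t) = b * I" unfolding I_def by (subst integral_mult_right_zero[symmetric]) (simp add: power_mult_distrib c)
      have Ec: "(\<integral>x. (c * g x)\<^sup>2 * ln ((c * g x)\<^sup>2) \<partial>gibbs f t) = b * E + b * ln b * N"
      proof -
        have "(c * g x)\<^sup>2 * ln ((c * g x)\<^sup>2) = b * ((g x)\<^sup>2 * ln ((g x)\<^sup>2)) + b * ln b * (g x)\<^sup>2" for x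
        proof -
          have "0 < (g x)\<^sup>2" using gp[rule_format, of x] by (simp add: zero_less_power)
          then have "ln (b * (g x)\<^sup>2) = ln b + ln ((g x)\<^sup>2)" using b by (simp add: ln_mult)
          then show ?thesis by (simp add: power_mult_distrib c algebra_simps)
        qed
        then show ?thesis using iE ig by (simp add: E_def N_def)
      qed
      have I0: "0 \<le> I" unfolding I_def by (intro integral_nonneg_AE) simp
      have "b * (E - N * ln N) = (b * E + b * ln b * N) - b * N * ln (b * N)"
        using b N by (simp add: ln_mult algebra_simps)
      also have "\<dots> \<le> 2 * t * (max (1 / k) (C * (1 + e)\<^sup>2) + K * t) * (b * I)" using main unfolding Nc Ic Ec .
      also have "\<dots> \<le> 2 * t * (C + eps) * (b * I)"
        using Ce k(3) Kt t b I0 by (intro mult_right_mono mult_left_mono) auto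
      finally have "b * (E - N * ln N) \<le> b * (2 * t * (C + eps) * I)" by (simp add: mult_ac)
      then have "E - N * ln N \<le> 2 * t * (C + eps) * I" using b by simp
      then show "(\<integral>x. (g x)\<^sup>2 * ln ((g x)\<^sup>2) \<partial>gibbs f t) - (\<integral>x. (g x)\<^sup>2 \<partial>gibbs f t) * ln (\<integral>x. (g x)\<^sup>2 \<partial>gibbs f t)
       \<le> 2 * t * (C + eps) * (\<integral>x. (norm (Dg x))\<^sup>2 \<partial>gibbs f t)" by (simp add: E_def N_def I_def)
    qed
  qed
qed

end

section \<open>From functions to admissible probability measures\<close>

lemma KL_square_density:
  fixes g :: "'a \<Rightarrow> real"
  assumes "prob_space M" and [measurable]: "g \<in> borel_measurable M"
  shows "KL (density M (\<lambda>x. ennreal ((g x)\<^sup>2))) M = (\<integral>x. (g x)\<^sup>2 * ln ((g x)\<^sup>2) \<partial>M)"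
proof -
  interpret prob_space M by fact
  show ?thesis unfolding KL_def
    by (subst KL_density) (auto simp: log_def)
qed

lemma smooth_C1_gradient: "smooth g \<Longrightarrow> C1_gradient g (gradient g)"
  unfolding smooth_def by (intro C_k_Suc_0_gradient) blast

lemma compactly_supported_bounded:
  assumes "compactly_supported g"
  obtains R where "\<And>x. R < norm x \<Longrightarrow> g x = 0"
proof -
  have "bounded (closure {x. g x \<noteq> 0})" using assms unfolding compactly_supported_def by (rule compact_imp_bounded)
  then obtain R where R: "\<forall>x\<in>closure {x. g x \<noteq> 0}. norm x \<le> R" unfolding bounded_iff by blast
  then have "g x = 0" if "R < norm x" for x
    using that closure_subset[of "{x. g x \<noteq> 0}"] by force
  then show ?thesis by (rule that)
qed

context PL_potential begin

text \<open>The square root \<open>g\<close> of an admissible density vanishes outside a compact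
  set, while the inequality so far concerns positive functions. The regularization sqrt (g^2 + d) is
  positive and constant outside the support of \<open>g\<close>, which is why only gradients were
  required to have bounded support. Its Fisher integral is at most that of \<open>g\<close>, its
  square has mass 1 + d, and \<open>d\<close> tends to 0.\<close>

lemma log_Sobolev_gibbs:
  assumes eps: "0 < eps"
  shows "\<forall>\<^sub>F t in at_right 0. 0 < t \<and> log_Sobolev (gibbs f t) (t * (C + eps))"
proof -
  have "\<forall>\<^sub>F t::real in at_right 0. 0 < t"
    unfolding eventually_at_right_field by (intro exI[of _ 1]) auto
  with log_Sobolev_positive[OF eps] show ?thesis
  proof eventually_elim
    case (elim t)
    then have t: "0 < t" by simp
    interpret prob_space "gibbs f t" by (rule prob_gibbs[OF t])
    have "log_Sobolev (gibbs f t) (t * (C + eps))"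
      unfolding log_Sobolev_def
    proof (intro allI impI, elim conjE)
      fix nu g assume nu: "prob_space nu" "sets nu = sets (gibbs f t)" "absolutely_continuous (gibbs f t) nu"
        and RN: "is_sqrt_RN_deriv (gibbs f t) nu g" and sm: "smooth g" and cs: "compactly_supported g"
      note gC = smooth_C1_gradient[OF sm]
      obtain R where R: "\<And>x. R < norm x \<Longrightarrow> g x = 0" using compactly_supported_bounded[OF cs] by blast
      obtain B where B: "0 \<le> B" "\<And>x. norm (g x) \<le> B" by (rule continuous_bounded_support_bound[OF C1_gradientD(3)[OF gC] R]) auto
      obtain BD where BD: "0 \<le> BD" "\<And>x. norm (gradient g x) \<le> BD"
        by (rule continuous_bounded_support_bound[OF C1_gradientD(2)[OF gC] C1_gradient_zero_outside[OF gC R]]) auto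
      have [measurable]: "g \<in> borel_measurable borel" "gradient g \<in> borel_measurable borel" using C1_gradient_measurable[OF gC] by auto
      have g2B: "(g x)\<^sup>2 \<le> B\<^sup>2" for x using B(2)[of x] B(1) by (simp add: abs_le_square_iff[symmetric])
      have ig: "integrable (gibbs f t) (\<lambda>x. (g x)\<^sup>2)" by (rule integrable_gibbs[OF t, where B="B\<^sup>2"]) (auto simp: g2B)
      have iI: "integrable (gibbs f t) (\<lambda>x. (norm (gradient g x))\<^sup>2)"
        by (rule integrable_gibbs[OF t, where B="BD\<^sup>2"]) (auto intro!: power_mono BD)
      have "nu = density (gibbs f t) (RN_deriv (gibbs f t) nu)" using density_RN_deriv[OF nu(3,2)] by simp
      also have "\<dots> = density (gibbs f t) (\<lambda>x. ennreal ((g x)\<^sup>2))"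
        using RN by (intro density_cong) (auto simp: is_sqrt_RN_deriv_def)
      finally have nueq: "nu = density (gibbs f t) (\<lambda>x. ennreal ((g x)\<^sup>2))" .
      have KL: "KL nu (gibbs f t) = (\<integral>x. (g x)\<^sup>2 * ln ((g x)\<^sup>2) \<partial>gibbs f t)"
        unfolding nueq by (rule KL_square_density) (auto intro: prob_gibbs[OF t])
      have N: "(\<integral>x. (g x)\<^sup>2 \<partial>gibbs f t) = 1"
      proof -
        have "emeasure nu (space nu) = 1" using nu(1) by (rule prob_space.emeasure_space_1)
        then have "(\<integral>\<^sup>+x. ennreal ((g x)\<^sup>2) \<partial>gibbs f t) = 1" unfolding nueq by (simp add: emeasure_density)
        then show ?thesis using nn_integral_eq_integral[OF ig] by (simp add: ennreal_eq_1)
      qed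
      define E where "E = (\<integral>x. (g x)\<^sup>2 * ln ((g x)\<^sup>2) \<partial>gibbs f t)"
      define I where "I = (\<integral>x. (norm (gradient g x))\<^sup>2 \<partial>gibbs f t)"
      have iE: "integrable (gibbs f t) (\<lambda>x. (g x)\<^sup>2 * ln ((g x)\<^sup>2))"
      proof (rule integrable_gibbs[OF t])
        show "\<bar>(g x)\<^sup>2 * ln ((g x)\<^sup>2)\<bar> \<le> 2 + B\<^sup>2 * B\<^sup>2" for x by (rule abs_mult_ln_le[OF zero_le_power2 g2B])
      qed measurable
      have pU: "prob UNIV = 1" using prob_space by simp
      have step: "E + (-2 * sqrt d) - (1 + d) * ln (1 + d) \<le> 2 * t * (C + eps) * I" if d: "0 < d" "d < 1" for d
      proof -
        have gd: "0 < (g x)\<^sup>2 + d" for x using d by (simp add: add_nonneg_pos)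
        define p where "p x = sqrt ((g x)\<^sup>2 + d)" for x
        define P where "P x = (g x / sqrt ((g x)\<^sup>2 + d)) *\<^sub>R gradient g x" for x
        have pC: "C1_gradient p P" unfolding p_def P_def
        proof (rule C1_gradient_compose[OF gC])
          fix x show "((\<lambda>s. sqrt (s\<^sup>2 + d)) has_real_derivative g x / sqrt ((g x)\<^sup>2 + d)) (at (g x))"
            using gd[of x] by (auto intro!: derivative_eq_intros simp: field_simps)
        next
          have "s\<^sup>2 + d \<noteq> 0" for s using d by (metis add_nonneg_pos less_irrefl zero_le_power2)
          then show "continuous_on (range g) (\<lambda>s. s / sqrt (s\<^sup>2 + d))" by (intro continuous_intros) auto
        qed
        have p2: "(p x)\<^sup>2 = (g x)\<^sup>2 + d" for x using gd[of x] by (simp add: p_def)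
        have Np: "(\<integral>x. (p x)\<^sup>2 \<partial>gibbs f t) = 1 + d" unfolding p2 using ig N pU by simp
        have ls: "(\<integral>x. (p x)\<^sup>2 * ln ((p x)\<^sup>2) \<partial>gibbs f t) - (\<integral>x. (p x)\<^sup>2 \<partial>gibbs f t) * ln (\<integral>x. (p x)\<^sup>2 \<partial>gibbs f t)
             \<le> 2 * t * (C + eps) * (\<integral>x. (norm (P x))\<^sup>2 \<partial>gibbs f t)"
        proof (rule elim(1)[rule_format, OF pC, of "sqrt (B\<^sup>2 + d)" R])
          show "0 < p x" for x using gd[of x] by (simp add: p_def)
          show "p x \<le> sqrt (B\<^sup>2 + d)" for x unfolding p_def using g2B[of x] by simp
          show "P x = 0" if "R < norm x" for x using R[OF that] by (simp add: P_def)
        qed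
        have PI: "(\<integral>x. (norm (P x))\<^sup>2 \<partial>gibbs f t) \<le> I" unfolding I_def
        proof (rule integral_mono'[OF iI])
          fix x
          have "(norm (P x))\<^sup>2 = ((g x)\<^sup>2 / ((g x)\<^sup>2 + d)) * (norm (gradient g x))\<^sup>2"
            using gd[of x] by (simp add: P_def power_mult_distrib power_divide)
          also have "\<dots> \<le> 1 * (norm (gradient g x))\<^sup>2" using gd[of x] d by (intro mult_right_mono) auto
          finally show "(norm (P x))\<^sup>2 \<le> (norm (gradient g x))\<^sup>2" by simp
        qed simp
        have "E + d * ln d = (\<integral>x. (g x)\<^sup>2 * ln ((g x)\<^sup>2) + d * ln d \<partial>gibbs f t)"
          using iE pU by (simp add: E_def)
        also have "\<dots> \<le> (\<integral>x. (p x)\<^sup>2 * ln ((p x)\<^sup>2) \<partial>gibbs f t)"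
        proof (rule integral_mono)
          show "integrable (gibbs f t) (\<lambda>x. (g x)\<^sup>2 * ln ((g x)\<^sup>2) + d * ln d)" using iE by simp
          show "integrable (gibbs f t) (\<lambda>x. (p x)\<^sup>2 * ln ((p x)\<^sup>2))"
          proof (rule integrable_gibbs[OF t])
            show "\<bar>(p x)\<^sup>2 * ln ((p x)\<^sup>2)\<bar> \<le> 2 + (B\<^sup>2 + d) * (B\<^sup>2 + d)" for x
              by (rule abs_mult_ln_le[OF zero_le_power2]) (simp add: p2 g2B)
            show "(\<lambda>x. (p x)\<^sup>2 * ln ((p x)\<^sup>2)) \<in> borel_measurable borel" unfolding p2 by measurable
          qed
          fix x
          have "(g x)\<^sup>2 * ln ((g x)\<^sup>2) \<le> (g x)\<^sup>2 * ln ((p x)\<^sup>2)"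
            using d by (cases "g x = 0") (auto simp: p2 intro!: mult_left_mono ln_mono)
          moreover have "d * ln d \<le> d * ln ((p x)\<^sup>2)" using d gd[of x] by (intro mult_left_mono ln_mono) (auto simp: p2)
          ultimately show "(g x)\<^sup>2 * ln ((g x)\<^sup>2) + d * ln d \<le> (p x)\<^sup>2 * ln ((p x)\<^sup>2)"
            unfolding p2 by (simp add: distrib_right)
        qed
        finally have "E + d * ln d \<le> (\<integral>x. (p x)\<^sup>2 * ln ((p x)\<^sup>2) \<partial>gibbs f t)" .
        moreover have "2 * t * (C + eps) * (\<integral>x. (norm (P x))\<^sup>2 \<partial>gibbs f t) \<le> 2 * t * (C + eps) * I"
          using PI t C eps by (intro mult_left_mono) auto
        moreover have "-2 * sqrt d \<le> d * ln d" using mult_ln_ge d by simp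
        ultimately show ?thesis using ls unfolding Np by linarith
      qed
      have "E + (-2 * sqrt 0) - (1 + 0) * ln (1 + 0) \<le> 2 * t * (C + eps) * I"
      proof (rule tendsto_upperbound)
        show "((\<lambda>d. E + (-2 * sqrt d) - (1 + d) * ln (1 + d)) \<longlongrightarrow> E + (-2 * sqrt 0) - (1 + 0) * ln (1 + 0)) (at_right 0)"
          by (intro tendsto_intros) auto
        show "\<forall>\<^sub>F d in at_right 0. E + (-2 * sqrt d) - (1 + d) * ln (1 + d) \<le> 2 * t * (C + eps) * I"
          unfolding eventually_at_right_field using step by (intro exI[of _ 1]) auto
      qed simp
      then show "KL nu (gibbs f t) \<le> t * (C + eps) / 2 * fisher_info g (gibbs f t)"
        by (simp add: KL E_def I_def fisher_info_def algebra_simps)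
    qed
    with t show ?case by simp
  qed
qed

lemma C_LS_upper:
  assumes eps: "0 < eps"
  shows "\<forall>\<^sub>F t in at_right 0. C_LS (gibbs f t) / ereal t \<le> ereal (C + eps)"
  using log_Sobolev_gibbs[OF eps]
proof eventually_elim
  case (elim t)
  have "C_LS (gibbs f t) \<le> ereal (t * (C + eps))"
    unfolding C_LS_def using elim C eps by (intro INF_lower) auto
  then have "C_LS (gibbs f t) / ereal t \<le> ereal (t * (C + eps)) / ereal t"
    using elim by (intro ereal_divide_right_mono) auto
  then show ?case using elim by simp
qed

end

section \<open>The lower bound\<close>

lemma partial_deriv_GDERIV_fun:
  fixes D :: "'a::euclidean_space \<Rightarrow> 'a"
  assumes "\<And>x. GDERIV g x :> D x"
  shows "partial_deriv b g = (\<lambda>x. b \<bullet> D x)"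
  using partial_deriv_eq[OF assms] by blast

text \<open>Lets an induction on the order of differentiability work with an explicit gradient in
  place of \<open>partial_deriv\<close>.\<close>

lemma C_k_SucI:
  fixes D :: "'a::euclidean_space \<Rightarrow> 'a"
  assumes "\<And>x. GDERIV g x :> D x" and "\<And>b. b \<in> Basis \<Longrightarrow> C_k k (\<lambda>x. b \<bullet> D x)"
  shows "C_k (Suc k) g"
  using assms partial_deriv_GDERIV_fun[OF assms(1)]
  by (auto simp: differentiable_def gderiv_def)

lemma C_k_const: "C_k k (\<lambda>x. c)"
proof (induction k arbitrary: c)
  case (Suc k)
  have "C_k (Suc k) (\<lambda>x::'a. c)"
    by (rule C_k_SucI[where D="\<lambda>x. 0"]) (auto intro: GDERIV_const Suc)
  then show ?case .
qed simp

lemma C_k_add: "C_k k f \<Longrightarrow> C_k k g \<Longrightarrow> C_k k (\<lambda>x. f x + g x)"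
proof (induction k arbitrary: f g)
  case 0
  then show ?case by (auto intro: continuous_intros)
next
  case (Suc k)
  have f: "GDERIV f x :> (\<Sum>b\<in>Basis. partial_deriv b f x *\<^sub>R b)" and g: "GDERIV g x :> (\<Sum>b\<in>Basis. partial_deriv b g x *\<^sub>R b)" for x
    using Suc.prems by (auto intro!: differentiable_GDERIV)
  show ?case
  proof (rule C_k_SucI)
    show "GDERIV (\<lambda>x. f x + g x) x :> (\<Sum>b\<in>Basis. partial_deriv b f x *\<^sub>R b) + (\<Sum>b\<in>Basis. partial_deriv b g x *\<^sub>R b)" for x
      by (rule GDERIV_add[OF f g])
    fix b :: 'a assume b: "b \<in> Basis"
    have "b \<bullet> ((\<Sum>b\<in>Basis. partial_deriv b f x *\<^sub>R b) + (\<Sum>b\<in>Basis. partial_deriv b g x *\<^sub>R b)) = partial_deriv b f x + partial_deriv b g x" for x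
      using b by (simp add: inner_add_right inner_sum_right inner_Basis if_distrib sum.delta' cong: if_cong)
    moreover have "C_k k (\<lambda>x. partial_deriv b f x + partial_deriv b g x)"
      by (rule Suc.IH) (use Suc.prems b in auto)
    ultimately show "C_k k (\<lambda>x. b \<bullet> ((\<Sum>b\<in>Basis. partial_deriv b f x *\<^sub>R b) + (\<Sum>b\<in>Basis. partial_deriv b g x *\<^sub>R b)))"
      by simp
  qed
qed

lemma C_k_mult: "C_k k f \<Longrightarrow> C_k k g \<Longrightarrow> C_k k (\<lambda>x. f x * g x)"
proof (induction k arbitrary: f g)
  case 0
  then show ?case by (auto intro: continuous_intros)
next
  case (Suc k)
  have f: "GDERIV f x :> (\<Sum>b\<in>Basis. partial_deriv b f x *\<^sub>R b)" and g: "GDERIV g x :> (\<Sum>b\<in>Basis. partial_deriv b g x *\<^sub>R b)" for x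
    using Suc.prems by (auto intro!: differentiable_GDERIV)
  show ?case
  proof (rule C_k_SucI)
    show "GDERIV (\<lambda>x. f x * g x) x :> f x *\<^sub>R (\<Sum>b\<in>Basis. partial_deriv b g x *\<^sub>R b) + g x *\<^sub>R (\<Sum>b\<in>Basis. partial_deriv b f x *\<^sub>R b)" for x
      by (rule GDERIV_mult[OF f g])
    fix b :: 'a assume b: "b \<in> Basis"
    have "b \<bullet> (f x *\<^sub>R (\<Sum>b\<in>Basis. partial_deriv b g x *\<^sub>R b) + g x *\<^sub>R (\<Sum>b\<in>Basis. partial_deriv b f x *\<^sub>R b)) = f x * partial_deriv b g x + g x * partial_deriv b f x" for x
      using b by (simp add: inner_add_right inner_sum_right inner_Basis if_distrib sum.delta' cong: if_cong)
    moreover have "C_k k (\<lambda>x. f x * partial_deriv b g x)"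
      by (rule Suc.IH[OF C_k_Suc_imp[OF Suc.prems(1)]]) (use Suc.prems b in auto)
    moreover have "C_k k (\<lambda>x. g x * partial_deriv b f x)"
      by (rule Suc.IH[OF C_k_Suc_imp[OF Suc.prems(2)]]) (use Suc.prems b in auto)
    ultimately show "C_k k (\<lambda>x. b \<bullet> (f x *\<^sub>R (\<Sum>b\<in>Basis. partial_deriv b g x *\<^sub>R b) + g x *\<^sub>R (\<Sum>b\<in>Basis. partial_deriv b f x *\<^sub>R b)))"
      using C_k_add[of k "\<lambda>x. f x * partial_deriv b g x" "\<lambda>x. g x * partial_deriv b f x"] by simp
  qed
qed

lemma C_k_inner: "C_k k (\<lambda>x::'a::euclidean_space. v \<bullet> x)"
proof (cases k)
  case (Suc j)
  show ?thesis unfolding Suc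
    by (rule C_k_SucI[where D="\<lambda>x. v"]) (auto simp: gderiv_def C_k_const inner_commute intro!: derivative_eq_intros)
qed (auto intro: continuous_intros)

lemma C_k_exp_affine: "C_k k (\<lambda>x::'a::euclidean_space. exp (v \<bullet> x + c))"
proof (induction k)
  case 0
  show ?case by (auto intro!: continuous_intros)
next
  case (Suc k)
  show ?case
  proof (rule C_k_SucI[where D="\<lambda>x. exp (v \<bullet> x + c) *\<^sub>R v"])
    show "GDERIV (\<lambda>x. exp (v \<bullet> x + c)) x :> exp (v \<bullet> x + c) *\<^sub>R v" for x :: 'a
      unfolding gderiv_def by (auto intro!: derivative_eq_intros simp: inner_commute)
    show "C_k k (\<lambda>x. b \<bullet> exp (v \<bullet> x + c) *\<^sub>R v)" for b
      using C_k_mult[OF Suc C_k_const, of "b \<bullet> v"] by simp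
  qed
qed

text \<open>For \<open>n = 0\<close> this is the standard function exp(-1/s) extended by 0. The
  powers of 1/s make the family closed under differentiation up to linear combinations, so that
  smoothness follows by induction on the order, for all \<open>n\<close> at once.\<close>

definition bump_profile :: "nat \<Rightarrow> real \<Rightarrow> real" where
  "bump_profile n s = (if 0 < s then (1 / s) ^ n * exp (- 1 / s) else 0)"

lemma bump_profile_tendsto_0: "(bump_profile n \<longlongrightarrow> 0) (at 0)"
proof -
  have "((\<lambda>s::real. (1 / s) ^ n * exp (- 1 / s)) \<longlongrightarrow> 0) (at_right 0)"
  proof -
    have "((\<lambda>u::real. u ^ n / exp u) \<longlongrightarrow> 0) at_top" by (rule tendsto_power_div_exp_0)
    moreover have "filterlim (\<lambda>s::real. inverse s) at_top (at_right 0)" by (rule filterlim_inverse_at_top_right)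
    ultimately have "((\<lambda>s::real. inverse s ^ n / exp (inverse s)) \<longlongrightarrow> 0) (at_right 0)" by (rule filterlim_compose)
    then show ?thesis by (simp add: exp_minus divide_inverse)
  qed
  then have "(bump_profile n \<longlongrightarrow> 0) (at_right 0)"
    by (rule Lim_transform_eventually)
       (auto simp: eventually_at_right_field bump_profile_def intro!: exI[of _ 1])
  moreover have "(bump_profile n \<longlongrightarrow> 0) (at_left 0)"
    by (rule tendsto_eventually) (auto simp: eventually_at_left_field bump_profile_def intro!: exI[of _ "-1"])
  ultimately show ?thesis by (simp add: filterlim_split_at)
qed

lemma bump_profile_DERIV: "(bump_profile n has_real_derivative (bump_profile (n + 2) s - real n * bump_profile (n + 1) s)) (at s)"
proof -
  consider "s < 0" | "s = 0" | "0 < s" by linarith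
  then show ?thesis
  proof cases
    case 1
    have "((\<lambda>s::real. 0) has_real_derivative 0) (at s)" by auto
    then have "(bump_profile n has_real_derivative 0) (at s)"
      by (rule has_field_derivative_transform_within_open[where S="{..<0}"]) (use 1 in \<open>auto simp: bump_profile_def\<close>)
    then show ?thesis using 1 by (simp add: bump_profile_def)
  next
    case 2
    \<comment> \<open>The difference quotient at 0 is the next member of the family.\<close>
    have "((\<lambda>h. bump_profile n h / h) \<longlongrightarrow> 0) (at 0)"
      using bump_profile_tendsto_0[of "Suc n"]
      by (rule Lim_transform_eventually) (auto simp: bump_profile_def eventually_at_filter)
    then show ?thesis using 2 by (simp add: DERIV_def bump_profile_def)
  next
    case 3
    define u where "u = inverse s"
    have "((\<lambda>u. u ^ n * exp (- u)) has_real_derivative (u ^ n * (exp (- u) * - 1) + real n * u ^ (n - Suc 0) * exp (- u))) (at u)"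
      by (auto intro!: derivative_eq_intros)
    then have "((\<lambda>s. inverse s ^ n * exp (- inverse s)) has_real_derivative
        (u ^ n * (exp (- u) * - 1) + real n * u ^ (n - Suc 0) * exp (- u)) * - (u ^ Suc (Suc 0))) (at s)"
      unfolding u_def using 3 by (intro DERIV_chain2[where f="\<lambda>u. u ^ n * exp (- u)"] DERIV_inverse) auto
    moreover have "(u ^ n * (exp (- u) * - 1) + real n * u ^ (n - Suc 0) * exp (- u)) * - (u ^ Suc (Suc 0))
        = u ^ (n + 2) * exp (- u) - real n * (u ^ (n + 1) * exp (- u))"
      by (cases n) (simp_all add: algebra_simps)
    ultimately have "((\<lambda>s::real. (1 / s) ^ n * exp (- 1 / s)) has_real_derivative (bump_profile (n + 2) s - real n * bump_profile (n + 1) s)) (at s)"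
      using 3 by (simp add: bump_profile_def u_def inverse_eq_divide)
    then show ?thesis
      by (rule has_field_derivative_transform_within_open[where S="{0<..}"]) (use 3 in \<open>auto simp: bump_profile_def\<close>)
  qed
qed

lemma GDERIV_bump:
  fixes x c :: "'a::euclidean_space"
  shows "GDERIV (\<lambda>x. bump_profile n (1 - m * ((x - c) \<bullet> (x - c)))) x :>
    (- 2 * m * (bump_profile (n + 2) (1 - m * ((x - c) \<bullet> (x - c))) - real n * bump_profile (n + 1) (1 - m * ((x - c) \<bullet> (x - c))))) *\<^sub>R (x - c)"
proof -
  have "GDERIV (\<lambda>x. 1 - m * ((x - c) \<bullet> (x - c))) x :> (-2 * m) *\<^sub>R (x - c)"
    unfolding gderiv_def by (auto intro!: derivative_eq_intros simp: inner_commute inner_diff_left inner_diff_right algebra_simps)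
  from GDERIV_DERIV_compose[OF this bump_profile_DERIV] show ?thesis
    by (rule GDERIV_subst) (simp only: scaleR_scaleR mult.commute[of _ "-2 * m"])
qed

lemma C_k_bump: "C_k k (\<lambda>x::'a::euclidean_space. bump_profile n (1 - m * ((x - c) \<bullet> (x - c))))"
proof (induction k arbitrary: n)
  case 0
  have "continuous_on UNIV (\<lambda>x::'a. bump_profile n (1 - m * ((x - c) \<bullet> (x - c))))"
    by (rule GDERIV_imp_continuous, rule GDERIV_bump)
  then show ?case by (simp only: C_k.simps)
next
  case (Suc k)
  show ?case
  proof (rule C_k_SucI[OF GDERIV_bump])
    fix b :: 'a
    let ?B = "\<lambda>n x. bump_profile n (1 - m * ((x - c) \<bullet> (x - c)))"
    have "C_k k (\<lambda>x. (?B (n + 2) x + (- real n) * ?B (n + 1) x) * ((-2 * m) * (b \<bullet> x + - (b \<bullet> c))))"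
      by (intro C_k_mult C_k_add C_k_const C_k_inner Suc)
    moreover have gen: "b \<bullet> ((- 2 * m * (p - real n * q)) *\<^sub>R (x - c)) = (p + (- real n) * q) * ((-2 * m) * (b \<bullet> x + - (b \<bullet> c)))" for p q x
      by (simp add: inner_diff_right algebra_simps)
    ultimately show "C_k k (\<lambda>x. b \<bullet> ((- 2 * m * (?B (n + 2) x - real n * ?B (n + 1) x)) *\<^sub>R (x - c)))"
      by (simp only: gen)
  qed
qed

text \<open>Dividing \<open>g\<close> by the square root of the mass of g^2 gives an admissible
  density, and both sides scale alike. The factor \<open>2 * c\<close> is \<open>c / 2\<close> times
  the 4 in \<open>fisher_info\<close>.\<close>

lemma log_Sobolev_unnormalized:
  fixes M :: "'a::euclidean_space measure"
  assumes M: "prob_space M" "sets M = sets borel" and LS: "log_Sobolev M c"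
    and g: "smooth g" "\<And>x. 0 \<le> g x" "\<And>x. R < norm x \<Longrightarrow> g x = 0" and N: "0 < (\<integral>x. (g x)\<^sup>2 \<partial>M)"
  shows "(\<integral>x. (g x)\<^sup>2 * ln ((g x)\<^sup>2) \<partial>M) - (\<integral>x. (g x)\<^sup>2 \<partial>M) * ln (\<integral>x. (g x)\<^sup>2 \<partial>M)
     \<le> 2 * c * (\<integral>x. (norm (gradient g x))\<^sup>2 \<partial>M)"
proof -
  interpret prob_space M by fact
  note gC = smooth_C1_gradient[OF g(1)]
  note M(2)[measurable_cong]
  have [measurable]: "g \<in> borel_measurable borel" using C1_gradient_measurable[OF gC] by auto
  obtain B where B: "0 \<le> B" "\<And>x. norm (g x) \<le> B" by (rule continuous_bounded_support_bound[OF C1_gradientD(3)[OF gC] g(3)]) auto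
  have g2B: "(g x)\<^sup>2 \<le> B\<^sup>2" for x using B(2)[of x] B(1) by (simp add: abs_le_square_iff[symmetric])
  have ig: "integrable M (\<lambda>x. (g x)\<^sup>2)" by (rule integrable_const_bound[where B="B\<^sup>2"]) (auto simp: g2B)
  have iE: "integrable M (\<lambda>x. (g x)\<^sup>2 * ln ((g x)\<^sup>2))"
    by (rule integrable_const_bound[where B="2 + B\<^sup>2 * B\<^sup>2"], rule AE_I2, unfold real_norm_def, rule abs_mult_ln_le[OF zero_le_power2 g2B], measurable)
  define N where "N = (\<integral>x. (g x)\<^sup>2 \<partial>M)"
  have N0: "0 < N" using N by (simp add: N_def)
  define b where "b = 1 / sqrt N"
  have b: "0 < b" "b\<^sup>2 = 1 / N" using N0 by (auto simp: b_def power_divide)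
  define h where "h x = b * g x" for x
  have hs: "smooth h" using g(1) unfolding smooth_def h_def by (auto intro!: C_k_mult C_k_const)
  have hD: "gradient h x = b *\<^sub>R gradient g x" for x
    using GDERIV_mult[OF GDERIV_const C1_gradientD(1)[OF gC, of x], of b] unfolding h_def by (intro gradient_eq) simp
  have hc: "compactly_supported h"
  proof -
    have "{x. h x \<noteq> 0} \<subseteq> cball 0 R" using g(3) by (auto simp: h_def not_less[symmetric])
    then have "bounded {x. h x \<noteq> 0}" by (rule bounded_subset[OF bounded_cball])
    then show ?thesis by (simp add: compactly_supported_def compact_closure)
  qed
  have [measurable]: "h \<in> borel_measurable borel" unfolding h_def by measurable
  have ih: "integrable M (\<lambda>x. (h x)\<^sup>2)" using ig by (simp add: h_def power_mult_distrib)
  have h1: "(\<integral>x. (h x)\<^sup>2 \<partial>M) = 1" using N0 by (simp add: h_def power_mult_distrib b N_def[symmetric])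
  define nu where "nu = density M (\<lambda>x. ennreal ((h x)\<^sup>2))"
  have "emeasure nu (space nu) = (\<integral>\<^sup>+x. ennreal ((h x)\<^sup>2) \<partial>M)"
    unfolding nu_def by (subst emeasure_density) (auto intro!: nn_integral_cong)
  also have "\<dots> = 1" using nn_integral_eq_integral[OF ih] h1 by simp
  finally have pn: "prob_space nu" by (rule prob_spaceI)
  have RN: "is_sqrt_RN_deriv M nu h"
  proof -
    have "AE x in M. ennreal ((h x)\<^sup>2) = RN_deriv M nu x"
      by (rule RN_deriv_unique) (auto simp: nu_def)
    then show ?thesis using g(2) b by (auto simp: is_sqrt_RN_deriv_def h_def)
  qed
  have "KL nu M \<le> c / 2 * fisher_info h M"
  proof (rule LS[unfolded log_Sobolev_def, rule_format], intro conjI)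
    show "absolutely_continuous M nu" unfolding nu_def by (rule absolutely_continuousI_density) measurable
  qed (use pn RN hs hc in \<open>auto simp: nu_def\<close>)
  moreover have "KL nu M = (\<integral>x. (h x)\<^sup>2 * ln ((h x)\<^sup>2) \<partial>M)"
    unfolding nu_def by (rule KL_square_density) (auto intro: M)
  moreover have "\<dots> = 1 / N * ((\<integral>x. (g x)\<^sup>2 * ln ((g x)\<^sup>2) \<partial>M) - N * ln N)"
  proof -
    have "(h x)\<^sup>2 * ln ((h x)\<^sup>2) = 1 / N * ((g x)\<^sup>2 * ln ((g x)\<^sup>2) - ln N * (g x)\<^sup>2)" for x
    proof (cases "g x = 0")
      case False
      then have "0 < (g x)\<^sup>2" by simp
      then have "ln ((h x)\<^sup>2) = ln ((g x)\<^sup>2) - ln N" using N0 by (simp add: h_def power_mult_distrib b ln_div)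
      moreover have "(h x)\<^sup>2 = 1 / N * (g x)\<^sup>2" by (simp add: h_def power_mult_distrib b)
      moreover have "1 / N * u * (p - q) = 1 / N * (u * p - q * u)" for u p q by (simp add: right_diff_distrib diff_divide_distrib mult.commute)
      ultimately show ?thesis by (simp only:)
    qed (simp add: h_def)
    then show ?thesis using iE ig by (simp add: N_def[symmetric] mult.commute)
  qed
  moreover have "fisher_info h M = 4 * (1 / N * (\<integral>x. (norm (gradient g x))\<^sup>2 \<partial>M))"
    unfolding fisher_info_def hD by (subst integral_mult_right_zero[symmetric]) (simp add: power_mult_distrib b)
  ultimately have "1 / N * ((\<integral>x. (g x)\<^sup>2 * ln ((g x)\<^sup>2) \<partial>M) - N * ln N) \<le> 1 / N * (2 * c * (\<integral>x. (norm (gradient g x))\<^sup>2 \<partial>M))"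
    by (simp add: mult_ac)
  then show ?thesis using N0 by (simp add: N_def[symmetric] divide_le_cancel)
qed

context gibbs_potential begin

lemma taylor_bound:
  obtains K where "0 \<le> K" "\<And>y. norm (y - x) \<le> 1 \<Longrightarrow> \<bar>f y - f x - G x \<bullet> (y - x)\<bar> \<le> K * (norm (y - x))\<^sup>2"
proof -
  obtain K where K: "0 \<le> K" "\<And>y z. norm y \<le> norm x + 1 \<Longrightarrow> norm z \<le> norm x + 1 \<Longrightarrow> norm (G y - G z) \<le> K * norm (y - z)"
    using gradient_lipschitz_on_ball[OF f2, of "norm x + 1"] by blast
  show ?thesis
  proof (rule that[OF K(1)])
    fix y assume y: "norm (y - x) \<le> 1"
    have "\<bar>f y - f x - G x \<bullet> (y - x)\<bar> \<le> (K * norm (y - x)) * norm (y - x)"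
    proof (rule GDERIV_mvt_le[OF C1_gradientD(1)[OF f_C1]])
      fix u assume "u \<in> closed_segment x y"
      then have ux: "norm (u - x) \<le> norm (y - x)" using segment_bound1 by blast
      have "norm u \<le> norm x + 1" using norm_triangle_sub[of u x] ux y by linarith
      then have "norm (G u - G x) \<le> K * norm (u - x)" by (rule K(2)) simp
      also have "\<dots> \<le> K * norm (y - x)" using K(1) ux by (intro mult_left_mono)
      finally show "norm (G u - G x) \<le> K * norm (y - x)" .
    qed
    then show "\<bar>f y - f x - G x \<bullet> (y - x)\<bar> \<le> K * (norm (y - x))\<^sup>2" by (simp add: power2_eq_square mult.assoc)
  qed
qed

text \<open>The half of Laplace's method that is used: near \<open>a\<close> the integrand is at
  least exp(-(f a + e) / t). It makes the density at a point \<open>x\<close> of order at most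
  exp(-(f x - f a - e) / t).\<close>

lemma ln_Z_lower:
  assumes e: "0 < e"
  obtains c where "\<And>t. 0 < t \<Longrightarrow> c - (f a + e) / t \<le> ln (Z t)"
proof -
  obtain r where r: "0 < r" "\<And>y. dist y a < r \<Longrightarrow> dist (f y) (f a) < e"
    using C1_gradientD(3)[OF f_C1] e unfolding continuous_on_iff by (metis UNIV_I)
  have V: "0 < measure lborel (ball a r)" using r(1) by (rule content_ball_pos)
  show ?thesis
  proof (rule that)
    fix t :: real assume t: "0 < t"
    have "exp (- (f a + e) / t) * measure lborel (ball a r) = (\<integral>y. exp (- (f a + e) / t) * indicator (ball a r) y \<partial>lborel)"
      by simp
    also have "\<dots> \<le> Z t" unfolding Z_def
    proof (rule integral_mono)
      show "integrable lborel (\<lambda>y. exp (- (f a + e) / t) * indicator (ball a r) y :: real)"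
        using emeasure_lborel_ball_finite[of a r] by (intro integrable_mult_right integrable_real_indicator) auto
      show "integrable lborel (\<lambda>x. exp (- f x / t))" by (rule exp_integrable[OF t])
      fix y
      show "exp (- (f a + e) / t) * indicator (ball a r) y \<le> exp (- f y / t)"
      proof (cases "y \<in> ball a r")
        case True
        then have "f y \<le> f a + e" using r(2)[of y] by (auto simp: dist_commute dist_real_def)
        then have "- (f a + e) / t \<le> - f y / t" using t by (intro divide_right_mono) auto
        then show ?thesis using True by simp
      qed simp
    qed
    finally have "ln (exp (- (f a + e) / t) * measure lborel (ball a r)) \<le> ln (Z t)"
      using V by (intro ln_mono) auto
    moreover have "ln (exp (- (f a + e) / t) * measure lborel (ball a r)) = - (f a + e) / t + ln (measure lborel (ball a r))"
      using V by (subst ln_mult) auto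
    moreover have "- (f a + e) / t = - ((f a + e) / t)" by (rule minus_divide_left[symmetric])
    ultimately show "ln (measure lborel (ball a r)) - (f a + e) / t \<le> ln (Z t)" by linarith
  qed
qed


text \<open>On the ball of radius sqrt t around \<open>x\<close>, the squared test function times
  the density is the constant \<open>q\<close>, the density at \<open>x\<close>, times the squared
  bump and a factor \<open>om\<close> between exp(-K) and exp K. Relative to its mass, the test
  function has entropy at least (f x - f a) / t and Fisher integral |v|^2 / (4 t^2) at most, up to
  errors of lower order and arbitrarily small multiples of the main terms. The conclusion concerns
  all \<open>c'\<close>, as needed for the infimum \<open>C_LS\<close>.\<close>

lemma C_LS_lower:
  assumes c: "0 < c" and x: "c / 2 * (norm (G x))\<^sup>2 < f x - f a"
  shows "\<forall>\<^sub>F t in at_right 0. \<forall>c'. log_Sobolev (gibbs f t) c' \<longrightarrow> c * t \<le> c'"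
proof -
  define v where "v = G x"
  \<comment> \<open>The gap in the violated PL inequality. A quarter each pays for the estimate of
    \<open>Z t\<close>, for Young's inequality and for the errors that vanish with
    \<open>t\<close>.\<close>
  define d where "d = f x - f a - c / 2 * (norm v)\<^sup>2"
  have d: "0 < d" using x by (simp add: d_def v_def)
  \<comment> \<open>The Young parameter \<open>e = d / (4 * P)\<close> keeps the loss below
    \<open>d / 4\<close>; the 1 keeps \<open>P\<close> positive when the gradient at
    \<open>x\<close> is 0.\<close>
  define P where "P = c * (norm v)\<^sup>2 / 2 + 1"
  define e where "e = d / (4 * P)"
  have pos: "0 < P" using c by (simp add: P_def add_nonneg_pos)
  have e: "0 < e" using d pos by (simp add: e_def)
  have ev: "c * e / 2 * (norm v)\<^sup>2 \<le> d / 4"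
  proof -
    have "c * e / 2 * (norm v)\<^sup>2 \<le> e * P" using e by (simp add: P_def algebra_simps)
    also have "\<dots> = d / 4" using pos by (simp add: e_def)
    finally show ?thesis .
  qed
  obtain K where K: "0 \<le> K" "\<And>y. norm (y - x) \<le> 1 \<Longrightarrow> \<bar>f y - f x - v \<bullet> (y - x)\<bar> \<le> K * (norm (y - x))\<^sup>2"
    using taylor_bound[of x] unfolding v_def by blast
  obtain cz where cz: "\<And>t. 0 < t \<Longrightarrow> cz - (f a + d / 4) / t \<le> ln (Z t)"
    using ln_Z_lower[of "d / 4"] d by auto
  define V where "V = measure lborel (ball (0::'a) 1)"
  have V: "0 < V" by (simp add: V_def content_ball_pos)
  \<comment> \<open>Compares exp K times the volume of the ball with the mass \<open>S\<close>: on
    the ball of half the radius, hence the power of 2, the squared bump is at least exp(-4) and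
    \<open>om\<close> at least exp(-K).\<close>
  define A where "A = exp (2 * K + 4) * 2 ^ DIM('a)"
  have A: "0 < A" by (simp add: A_def)
  define A2 where "A2 = 2 * A + \<bar>ln (exp K * V)\<bar> + \<bar>cz\<bar>"
  define A4 where "A4 = 2 * c * ((1 + 1 / e) * 16 * A)"
  have "\<forall>\<^sub>F t in at_right 0. A2 * t + norm v * sqrt t + A4 * t < d / 4"
    using d by (intro order_tendstoD(2)[of _ 0]) (auto intro!: tendsto_eq_intros)
  moreover have "\<forall>\<^sub>F t::real in at_right 0. 0 < t \<and> t < 1"
    unfolding eventually_at_right_field by (intro exI[of _ 1]) auto
  ultimately show ?thesis
  proof eventually_elim
    case (elim t)
    then have t: "0 < t" "t < 1" and small: "A2 * t + norm v * sqrt t + A4 * t < d / 4" by auto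
    define s where "s = sqrt t"
    have s: "0 < s" "s\<^sup>2 = t" "s \<le> 1" using t by (auto simp: s_def)
    have st: "t / s = s" "s * s = t" using s by (auto simp: power2_eq_square field_simps)

    \<comment> \<open>The tilted bump at scale sqrt t\<close>
    define be where "be y = bump_profile 0 (1 - 1 / t * ((y - x) \<bullet> (y - x)))" for y
    define bg where "bg y = (- 2 / t * bump_profile 2 (1 - 1 / t * ((y - x) \<bullet> (y - x)))) *\<^sub>R (y - x)" for y
    define ex where "ex y = exp (((1 / (2 * t)) *\<^sub>R v) \<bullet> y + (- (v \<bullet> x) / (2 * t)))" for y
    have ex2: "(ex y)\<^sup>2 = exp (v \<bullet> (y - x) / t)" for y
      unfolding ex_def exp_double[symmetric] using t by (simp add: inner_diff_right field_simps)
    define g where "g y = be y * ex y" for y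
    have bC: "GDERIV be y :> bg y" for y
      using GDERIV_bump[of 0 "1 / t" x y] unfolding be_def[abs_def] bg_def by (simp add: numeral_2_eq_2)
    have eC: "GDERIV ex y :> ex y *\<^sub>R ((1 / (2 * t)) *\<^sub>R v)" for y
      unfolding ex_def[abs_def] gderiv_def using t by (auto intro!: derivative_eq_intros simp: inner_commute)
    have gs: "smooth g" unfolding smooth_def g_def be_def ex_def by (intro allI C_k_mult C_k_bump C_k_exp_affine)
    have gD: "gradient g y = be y *\<^sub>R (ex y *\<^sub>R ((1 / (2 * t)) *\<^sub>R v)) + ex y *\<^sub>R bg y" for y
      unfolding g_def[abs_def] by (intro gradient_eq GDERIV_mult bC eC)
    have be0: "0 \<le> be y" "be y \<le> 1" for y by (auto simp: be_def bump_profile_def)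
    have arg: "1 - 1 / t * ((y - x) \<bullet> (y - x)) = 1 - (norm (y - x))\<^sup>2 / t" for y by (simp add: power2_norm_eq_inner)
    have out: "be y = 0" "bg y = 0" if "s \<le> norm (y - x)" for y
    proof -
      have "t \<le> (norm (y - x))\<^sup>2" using power_mono[OF that, of 2] s by simp
      then have "\<not> 0 < 1 - (norm (y - x))\<^sup>2 / t" using t by (simp add: le_divide_eq)
      then show "be y = 0" "bg y = 0" unfolding be_def bg_def arg by (simp_all add: bump_profile_def)
    qed
    have gR: "g y = 0" if "norm x + s < norm y" for y
    proof -
      have "s \<le> norm (y - x)" using that norm_triangle_ineq2[of y x] by linarith
      then show ?thesis by (simp add: g_def out)
    qed
    have inn: "exp (-2) \<le> be y" if "norm (y - x) < s / 2" for y
    proof -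
      have "(norm (y - x))\<^sup>2 \<le> (s / 2)\<^sup>2" using that by (intro power_mono) auto
      then have "(norm (y - x))\<^sup>2 / t \<le> 1 / 4" using s t by (simp add: power_divide divide_le_eq)
      moreover define u where "u = 1 - (norm (y - x))\<^sup>2 / t"
      ultimately have u: "1 / 2 \<le> u" by linarith
      then have "1 / u \<le> 1 / (1 / 2)" by (intro divide_left_mono) auto
      then show ?thesis unfolding be_def arg u_def[symmetric] using u by (simp add: bump_profile_def)
    qed
    have bgb: "norm (bg y) \<le> 4 / s" for y
    proof (cases "norm (y - x) < s")
      case True
      define u where "u = 1 - (norm (y - x))\<^sup>2 / t"
      have "bump_profile 2 u \<le> 2"
      proof (cases "0 < u")
        case True
        have "0 \<le> 1 / u" using True by simp
        then have "(1 / u)\<^sup>2 / 2 \<le> exp (1 / u)" using exp_lower_Taylor_quadratic[of "1 / u"] by linarith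
        then have "(1 / u)\<^sup>2 * exp (- (1 / u)) \<le> 2 * exp (1 / u) * exp (- (1 / u))" by (intro mult_right_mono) auto
        also have "\<dots> = 2" by (simp add: mult.assoc flip: exp_add)
        finally show ?thesis unfolding bump_profile_def using True by simp
      qed (simp add: bump_profile_def)
      moreover have "0 \<le> bump_profile 2 u" by (simp add: bump_profile_def)
      ultimately have "2 / t * bump_profile 2 u * norm (y - x) \<le> 2 / t * 2 * s"
        using True t by (intro mult_mono) auto
      moreover have "norm (bg y) = 2 / t * bump_profile 2 u * norm (y - x)"
        unfolding bg_def arg u_def[symmetric] using t \<open>0 \<le> bump_profile 2 u\<close> by (simp add: abs_mult)
      moreover have "2 / t * 2 * s = 4 / s" using s t by (simp add: field_simps power2_eq_square)
      ultimately show ?thesis by simp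
    qed (use out s in auto)

    \<comment> \<open>The density relative to its first-order part\<close>
    define om where "om y = exp (- (f y - f x - v \<bullet> (y - x)) / t)" for y
    have om: "exp (- K) \<le> om y" "om y \<le> exp K" if "norm (y - x) < s" for y
    proof -
      have "(norm (y - x))\<^sup>2 \<le> t" using power_mono[of "norm (y - x)" s 2] that s by simp
      then have "K * (norm (y - x))\<^sup>2 \<le> K * t" using K(1) by (rule mult_left_mono)
      then have "\<bar>f y - f x - v \<bullet> (y - x)\<bar> \<le> K * t" using K(2)[of y] that s by linarith
      then have "\<bar>- (f y - f x - v \<bullet> (y - x)) / t\<bar> \<le> K" using t by (simp add: abs_divide divide_le_eq)
      then show "exp (- K) \<le> om y" "om y \<le> exp K" unfolding om_def exp_le_cancel_iff by linarith+
    qed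
    have omp: "0 < om y" for y by (simp add: om_def)
    define q where "q = exp (- f x / t) / Z t"
    have q: "0 < q" using Z_pos[OF t(1)] by (simp add: q_def)
    have exd: "(ex y)\<^sup>2 * dens t y = q * om y" for y
    proof -
      have "v \<bullet> (y - x) / t + - f y / t = - f x / t + - (f y - f x - v \<bullet> (y - x)) / t"
        by (simp add: diff_divide_distrib)
      then have "exp (v \<bullet> (y - x) / t) * exp (- f y / t) = exp (- f x / t) * om y"
        unfolding om_def exp_add[symmetric] by (simp only:)
      then show ?thesis by (simp add: ex2 dens_def q_def)
    qed
    have contf: "continuous_on UNIV f" using C1_gradientD(3)[OF f_C1] .
    have contb: "continuous_on UNIV be" using GDERIV_imp_continuous[OF bC] .
    have conto: "continuous_on UNIV om" unfolding om_def using contf t by (intro continuous_intros) auto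
    have [measurable]: "be \<in> borel_measurable borel" "om \<in> borel_measurable borel" "g \<in> borel_measurable borel"
      using contb conto C1_gradient_measurable[OF smooth_C1_gradient[OF gs]] by (auto intro: borel_measurable_continuous_onI)
    have [measurable]: "gradient g \<in> borel_measurable borel" using C1_gradient_measurable[OF smooth_C1_gradient[OF gs]] by auto
    have outR: "be y = 0" if "norm x + s < norm y" for y
    proof -
      have "s \<le> norm (y - x)" using that norm_triangle_ineq2[of y x] by linarith
      then show ?thesis by (rule out)
    qed

    \<comment> \<open>Mass, entropy and Fisher integral of the test function\<close>
    define Bl where "Bl = ball x s"
    define mB where "mB = measure lborel Bl"
    have iB: "integrable lborel (\<lambda>y. indicator Bl y :: real)" "(\<integral>y. indicator Bl y \<partial>lborel) = mB"
      using emeasure_lborel_ball_finite[of x s] by (auto simp: Bl_def mB_def)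
    have mB: "mB = V * s ^ DIM('a)" using s by (simp add: mB_def Bl_def V_def content_ball)
    have mBV: "mB \<le> V" using s V by (simp add: mB power_le_one mult_left_le)
    define S where "S = (\<integral>y. (be y)\<^sup>2 * om y \<partial>lborel)"
    have iS: "integrable lborel (\<lambda>y. (be y)\<^sup>2 * om y)"
      using contb conto outR by (intro continuous_bounded_support_integrable[of _ "norm x + s"] continuous_intros) auto
    have Slow: "mB \<le> A * exp (- K) * S"
    proof -
      have "exp (- 4) * exp (- K) * measure lborel (ball x (s / 2)) = (\<integral>y. exp (- 4) * exp (- K) * indicator (ball x (s / 2)) y \<partial>lborel)"
        by simp
      also have "\<dots> \<le> S" unfolding S_def
      proof (rule integral_mono[OF _ iS])
        show "integrable lborel (\<lambda>y. exp (- 4) * exp (- K) * indicator (ball x (s / 2)) y :: real)"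
          using emeasure_lborel_ball_finite[of x "s / 2"] by (intro integrable_mult_right integrable_real_indicator) auto
        fix y
        show "exp (- 4) * exp (- K) * indicator (ball x (s / 2)) y \<le> (be y)\<^sup>2 * om y"
        proof (cases "y \<in> ball x (s / 2)")
          case True
          then have n: "norm (y - x) < s / 2" by (simp add: dist_norm norm_minus_commute)
          have "(exp (-2))\<^sup>2 \<le> (be y)\<^sup>2" using inn[OF n] by (intro power_mono) auto
          then have "exp (- 4) \<le> (be y)\<^sup>2" by (simp add: exp_double[symmetric])
          moreover have "exp (- K) \<le> om y" using n s by (intro om) auto
          ultimately show ?thesis using True by (auto intro!: mult_mono)
        qed (use omp[of y] in \<open>simp add: less_imp_le\<close>)
      qed
      also have "measure lborel (ball x (s / 2)) = mB / 2 ^ DIM('a)" using s by (simp add: mB V_def content_ball power_divide)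
      finally have "exp (- 4) * exp (- K) * (mB / 2 ^ DIM('a)) \<le> S" .
      then have "A * exp (- K) * (exp (- 4) * exp (- K) * (mB / 2 ^ DIM('a))) \<le> A * exp (- K) * S" using A by (intro mult_left_mono) auto
      moreover have "A * exp (- K) * (exp (- 4) * exp (- K) * (mB / 2 ^ DIM('a))) = mB"
      proof -
        have "exp (2 * K + 4) * (exp (- K) * (exp (- 4) * exp (- K))) = 1" by (simp flip: exp_add)
        then show ?thesis by (simp add: A_def mult_ac)
      qed
      ultimately show ?thesis by simp
    qed
    have mBA: "exp K * mB \<le> A * S"
    proof -
      have "exp K * mB \<le> exp K * (A * exp (- K) * S)" using Slow by (intro mult_left_mono) auto
      also have "\<dots> = A * S" by (simp add: mult_ac flip: exp_add)
      finally show ?thesis .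
    qed
    have Sup: "S \<le> exp K * mB"
    proof -
      have "S \<le> (\<integral>y. exp K * indicator Bl y \<partial>lborel)" unfolding S_def
      proof (rule integral_mono[OF iS])
        show "integrable lborel (\<lambda>y. exp K * indicator Bl y :: real)" using iB(1) by simp
        fix y
        show "(be y)\<^sup>2 * om y \<le> exp K * indicator Bl y"
        proof (cases "norm (y - x) < s")
          case True
          have "(be y)\<^sup>2 * om y \<le> 1 * exp K" using be0[of y] om[OF True] omp[of y] by (intro mult_mono) (auto simp: power_le_one less_imp_le)
          then show ?thesis using True by (simp add: Bl_def dist_norm norm_minus_commute)
        qed (simp add: out)
      qed
      also have "\<dots> = exp K * mB" using iB by simp
      finally show ?thesis .
    qed
    have mB0: "0 < mB" using V s by (simp add: mB)
    have S0: "0 < S" using mBA mB0 A by (smt (verit) exp_gt_zero mult_pos_pos zero_less_mult_pos)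
    have N: "(\<integral>y. (g y)\<^sup>2 \<partial>gibbs f t) = q * S"
    proof -
      have "(\<integral>y. (g y)\<^sup>2 \<partial>gibbs f t) = (\<integral>y. (g y)\<^sup>2 * dens t y \<partial>lborel)" by (rule integral_gibbs[OF t(1)]) measurable
      also have "\<dots> = (\<integral>y. q * ((be y)\<^sup>2 * om y) \<partial>lborel)"
        using exd by (intro Bochner_Integration.integral_cong refl) (simp add: g_def power_mult_distrib mult_ac)
      finally show ?thesis by (simp add: S_def)
    qed
    have ib: "integrable lborel (\<lambda>y. 2 * exp K * indicator Bl y + norm v / s * ((be y)\<^sup>2 * om y))" using iB iS by simp
    have E: "- (q * (2 * A * S + norm v / s * S)) \<le> (\<integral>y. (g y)\<^sup>2 * ln ((g y)\<^sup>2) \<partial>gibbs f t)"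
    proof -
      have "(\<integral>y. (g y)\<^sup>2 * ln ((g y)\<^sup>2) \<partial>gibbs f t) = (\<integral>y. (g y)\<^sup>2 * ln ((g y)\<^sup>2) * dens t y \<partial>lborel)" by (rule integral_gibbs[OF t(1)]) measurable
      also have "\<dots> = (\<integral>y. q * ((be y)\<^sup>2 * ln ((g y)\<^sup>2) * om y) \<partial>lborel)"
        using exd by (intro Bochner_Integration.integral_cong refl) (simp add: g_def power_mult_distrib mult_ac)
      finally have e1: "(\<integral>y. (g y)\<^sup>2 * ln ((g y)\<^sup>2) \<partial>gibbs f t) = q * (\<integral>y. (be y)\<^sup>2 * ln ((g y)\<^sup>2) * om y \<partial>lborel)" by simp
      \<comment> \<open>The logarithm splits into that of the bump and the tilt, whose exponent is
        of size |v| / sqrt t. The entropy of the bump is compared with the indicator of the ball,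
        because u ln u is bounded on [0,1] but is not bounded by a multiple of u.\<close>
      have pw: "\<bar>(be y)\<^sup>2 * ln ((g y)\<^sup>2) * om y\<bar> \<le> 2 * exp K * indicator Bl y + norm v / s * ((be y)\<^sup>2 * om y)" for y
      proof (cases "be y = 0")
        case False
        then have n: "norm (y - x) < s" using out(1)[of y] by force
        have b1: "0 < (be y)\<^sup>2" "(be y)\<^sup>2 \<le> 1" using False be0[of y] by (auto simp: power_le_one)
        have "ln ((g y)\<^sup>2) = ln ((be y)\<^sup>2) + v \<bullet> (y - x) / t"
          using b1 by (simp add: g_def power_mult_distrib ex2 ln_mult)
        then have split: "(be y)\<^sup>2 * ln ((g y)\<^sup>2) * om y = (be y)\<^sup>2 * ln ((be y)\<^sup>2) * om y + (v \<bullet> (y - x) / t) * ((be y)\<^sup>2 * om y)"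
          by (simp add: algebra_simps)
        have "- 2 * sqrt ((be y)\<^sup>2) \<le> (be y)\<^sup>2 * ln ((be y)\<^sup>2)" by (rule mult_ln_ge[OF b1])
        moreover have "(be y)\<^sup>2 * ln ((be y)\<^sup>2) \<le> 0" using b1 by (intro mult_nonneg_nonpos) auto
        moreover have "sqrt ((be y)\<^sup>2) \<le> 1" using b1 real_sqrt_le_1_iff by blast
        ultimately have "\<bar>(be y)\<^sup>2 * ln ((be y)\<^sup>2)\<bar> \<le> 2" by linarith
        then have p1: "\<bar>(be y)\<^sup>2 * ln ((be y)\<^sup>2) * om y\<bar> \<le> 2 * exp K"
          unfolding abs_mult[of _ "om y"] using om[OF n] omp[of y] by (intro mult_mono) auto
        have "\<bar>v \<bullet> (y - x)\<bar> \<le> norm v * s" using Cauchy_Schwarz_ineq2[of v "y - x"] n by (meson less_imp_le mult_left_mono norm_ge_zero order_trans)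
        then have "\<bar>v \<bullet> (y - x) / t\<bar> \<le> norm v * s / t" using t by (simp add: abs_divide divide_right_mono)
        also have "norm v * s / t = norm v / s" using s t by (simp add: field_simps power2_eq_square)
        finally have vb: "\<bar>v \<bullet> (y - x) / t\<bar> \<le> norm v / s" .
        have nn: "0 \<le> (be y)\<^sup>2 * om y" using omp[of y] by simp
        have p2: "\<bar>(v \<bullet> (y - x) / t) * ((be y)\<^sup>2 * om y)\<bar> \<le> norm v / s * ((be y)\<^sup>2 * om y)"
          unfolding abs_mult[of "v \<bullet> (y - x) / t"] abs_of_nonneg[OF nn] by (rule mult_right_mono[OF vb nn])
        have ind: "indicator Bl y = (1::real)" using n by (simp add: Bl_def dist_norm norm_minus_commute)
        show ?thesis unfolding split ind mult_1_right
          by (rule order_trans[OF abs_triangle_ineq add_mono[OF p1 p2]])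
      qed (use omp[of y] in simp)
      have ig: "integrable lborel (\<lambda>y. (be y)\<^sup>2 * ln ((g y)\<^sup>2) * om y)"
      proof (rule Bochner_Integration.integrable_bound[OF ib])
        show "AE y in lborel. norm ((be y)\<^sup>2 * ln ((g y)\<^sup>2) * om y) \<le> norm (2 * exp K * indicator Bl y + norm v / s * ((be y)\<^sup>2 * om y))"
          unfolding real_norm_def by (intro AE_I2 order_trans[OF pw abs_ge_self])
      qed measurable
      have "- (2 * exp K * mB + norm v / s * S) = (\<integral>y. - (2 * exp K * indicator Bl y + norm v / s * ((be y)\<^sup>2 * om y)) \<partial>lborel)"
        using iB iS by (simp add: S_def)
      also have "\<dots> \<le> (\<integral>y. (be y)\<^sup>2 * ln ((g y)\<^sup>2) * om y \<partial>lborel)"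
      proof (intro integral_mono ig integrable_minus ib)
        fix y
        show "- (2 * exp K * indicator Bl y + norm v / s * ((be y)\<^sup>2 * om y)) \<le> (be y)\<^sup>2 * ln ((g y)\<^sup>2) * om y"
          using pw[of y] unfolding abs_le_iff by linarith
      qed
      finally have "- (2 * exp K * mB + norm v / s * S) \<le> (\<integral>y. (be y)\<^sup>2 * ln ((g y)\<^sup>2) * om y \<partial>lborel)" .
      then have "- (2 * A * S + norm v / s * S) \<le> (\<integral>y. (be y)\<^sup>2 * ln ((g y)\<^sup>2) * om y \<partial>lborel)" using mBA by linarith
      then have "q * - (2 * A * S + norm v / s * S) \<le> q * (\<integral>y. (be y)\<^sup>2 * ln ((g y)\<^sup>2) * om y \<partial>lborel)"
        by (rule mult_left_mono) (use q in simp)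
      then show ?thesis unfolding e1 by (simp only: mult_minus_right)
    qed
    \<comment> \<open>Young's inequality separates the gradient of the tilt, which gives the main
      term, from the gradient of the bump, which is at most 4 / sqrt t.\<close>
    have I: "(\<integral>y. (norm (gradient g y))\<^sup>2 \<partial>gibbs f t) \<le> q * ((1 + e) * (norm v)\<^sup>2 / (4 * t\<^sup>2) * S + (1 + 1 / e) * (16 / t) * (A * S))"
    proof -
      have "(\<integral>y. (norm (gradient g y))\<^sup>2 \<partial>gibbs f t) = (\<integral>y. (norm (gradient g y))\<^sup>2 * dens t y \<partial>lborel)" by (rule integral_gibbs[OF t(1)]) measurable
      also have "\<dots> \<le> (\<integral>y. q * ((1 + e) * (norm v)\<^sup>2 / (4 * t\<^sup>2) * ((be y)\<^sup>2 * om y) + (1 + 1 / e) * (16 / t) * (exp K * indicator Bl y)) \<partial>lborel)"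
      proof (rule integral_mono')
        show "integrable lborel (\<lambda>y. q * ((1 + e) * (norm v)\<^sup>2 / (4 * t\<^sup>2) * ((be y)\<^sup>2 * om y) + (1 + 1 / e) * (16 / t) * (exp K * indicator Bl y)))"
          using iB iS by simp
        fix y
        have young: "(a + b)\<^sup>2 \<le> (1 + e) * a\<^sup>2 + (1 + 1 / e) * b\<^sup>2" for a b :: real
        proof -
          have "0 \<le> (e * a - b)\<^sup>2 / e" using e by simp
          also have "\<dots> = e * a\<^sup>2 + 1 / e * b\<^sup>2 - 2 * a * b" using e by (simp add: power2_eq_square field_simps)
          finally show ?thesis by (simp add: power2_sum algebra_simps)
        qed
        have "gradient g y = ex y *\<^sub>R ((be y / (2 * t)) *\<^sub>R v + bg y)" by (simp add: gD scaleR_add_right)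
        then have "(norm (gradient g y))\<^sup>2 * dens t y = (q * om y) * (norm ((be y / (2 * t)) *\<^sub>R v + bg y))\<^sup>2"
          by (simp add: power_mult_distrib exd[symmetric])
        also have "(norm ((be y / (2 * t)) *\<^sub>R v + bg y))\<^sup>2 \<le> (norm ((be y / (2 * t)) *\<^sub>R v) + norm (bg y))\<^sup>2"
          by (intro power_mono norm_triangle_ineq) simp
        also have "\<dots> \<le> (1 + e) * (norm ((be y / (2 * t)) *\<^sub>R v))\<^sup>2 + (1 + 1 / e) * (norm (bg y))\<^sup>2" by (rule young)
        also have "(norm ((be y / (2 * t)) *\<^sub>R v))\<^sup>2 = (norm v)\<^sup>2 / (4 * t\<^sup>2) * (be y)\<^sup>2"
          by (simp add: power_mult_distrib power_divide)
        finally have g1: "(norm (gradient g y))\<^sup>2 * dens t y \<le> (q * om y) * ((1 + e) * ((norm v)\<^sup>2 / (4 * t\<^sup>2) * (be y)\<^sup>2) + (1 + 1 / e) * (norm (bg y))\<^sup>2)"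
          using q omp[of y] by (simp add: mult_left_mono)
        have "om y * (norm (bg y))\<^sup>2 \<le> 16 / t * (exp K * indicator Bl y)"
        proof (cases "norm (y - x) < s")
          case True
          have "(norm (bg y))\<^sup>2 \<le> (4 / s)\<^sup>2" using bgb by (intro power_mono) auto
          also have "\<dots> = 16 / t" using s by (simp add: power_divide)
          finally have "om y * (norm (bg y))\<^sup>2 \<le> exp K * (16 / t)" using om[OF True] omp[of y] by (intro mult_mono) auto
          then show ?thesis using True by (simp add: Bl_def dist_norm norm_minus_commute mult.commute)
        qed (use out t in simp)
        then have "q * ((1 + 1 / e) * (om y * (norm (bg y))\<^sup>2)) \<le> q * ((1 + 1 / e) * (16 / t * (exp K * indicator Bl y)))"
          using q e by (intro mult_left_mono) auto
        then show "(norm (gradient g y))\<^sup>2 * dens t y \<le> q * ((1 + e) * (norm v)\<^sup>2 / (4 * t\<^sup>2) * ((be y)\<^sup>2 * om y) + (1 + 1 / e) * (16 / t) * (exp K * indicator Bl y))"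
          using g1 by (simp add: distrib_left mult_ac)
        show "0 \<le> q * ((1 + e) * (norm v)\<^sup>2 / (4 * t\<^sup>2) * ((be y)\<^sup>2 * om y) + (1 + 1 / e) * (16 / t) * (exp K * indicator Bl y))"
          using q e t omp[of y] by (intro mult_nonneg_nonneg add_nonneg_nonneg) auto
      qed
      also have "\<dots> = q * ((1 + e) * (norm v)\<^sup>2 / (4 * t\<^sup>2) * S + (1 + 1 / e) * (16 / t) * (exp K * mB))"
        using iB iS by (simp add: S_def)
      also have "\<dots> \<le> q * ((1 + e) * (norm v)\<^sup>2 / (4 * t\<^sup>2) * S + (1 + 1 / e) * (16 / t) * (A * S))"
        using q e t mBA by (intro mult_left_mono add_left_mono) auto
      finally show ?thesis .
    qed
    have lnN: "ln (q * S) \<le> - (f x - f a - d / 4) / t + (\<bar>ln (exp K * V)\<bar> + \<bar>cz\<bar>)"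
    proof -
      have "ln (q * S) = - f x / t - ln (Z t) + ln S" using q S0 Z_pos[OF t(1)] by (simp add: q_def ln_mult ln_div)
      moreover have "ln S \<le> ln (exp K * V)" using S0 Sup mBV by (intro ln_mono) (auto intro: order_trans)
      moreover have "cz - (f a + d / 4) / t \<le> ln (Z t)" by (rule cz[OF t(1)])
      moreover have "- (f x - f a - d / 4) / t = - f x / t + (f a + d / 4) / t" by (simp add: diff_divide_distrib add_divide_distrib)
      ultimately show ?thesis by linarith
    qed

    \<comment> \<open>Contradiction with a log-Sobolev constant below \<open>c * t\<close>\<close>
    show ?case
    proof (intro allI impI, rule ccontr)
      fix c' assume LS: "log_Sobolev (gibbs f t) c'" and "\<not> c * t \<le> c'"
      then have c': "c' \<le> c * t" by simp
      define I where "I = (\<integral>y. (norm (gradient g y))\<^sup>2 \<partial>gibbs f t)"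
      have I0: "0 \<le> I" unfolding I_def by (intro integral_nonneg_AE) simp
      have "(\<integral>y. (g y)\<^sup>2 * ln ((g y)\<^sup>2) \<partial>gibbs f t) - q * S * ln (q * S) \<le> 2 * c' * I"
        unfolding I_def N[symmetric]
        by (rule log_Sobolev_unnormalized[OF prob_gibbs[OF t(1)] sets_gibbs LS gs _ gR])
           (use be0 q S0 N in \<open>auto simp: g_def ex_def\<close>)
      also have "\<dots> \<le> 2 * (c * t) * I" using c' I0 by (intro mult_right_mono) auto
      also have "\<dots> \<le> 2 * (c * t) * (q * ((1 + e) * (norm v)\<^sup>2 / (4 * t\<^sup>2) * S + (1 + 1 / e) * (16 / t) * (A * S)))"
        using \<open>(\<integral>y. (norm (gradient g y))\<^sup>2 \<partial>gibbs f t) \<le> _\<close> c t unfolding I_def by (intro mult_left_mono) auto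
      also have "\<dots> = (q * S) * (2 * (c * t) * ((1 + e) * (norm v)\<^sup>2 / (4 * t\<^sup>2) + (1 + 1 / e) * (16 / t) * A))"
        by (simp add: algebra_simps)
      finally have "(q * S) * (- (2 * A + norm v / s)) - (q * S) * ln (q * S) \<le> (q * S) * (2 * (c * t) * ((1 + e) * (norm v)\<^sup>2 / (4 * t\<^sup>2) + (1 + 1 / e) * (16 / t) * A))"
        using E by (simp add: algebra_simps)
      then have "(q * S) * (- (2 * A + norm v / s) - ln (q * S)) \<le> (q * S) * (2 * (c * t) * ((1 + e) * (norm v)\<^sup>2 / (4 * t\<^sup>2) + (1 + 1 / e) * (16 / t) * A))"
        by (simp only: right_diff_distrib)
      then have "- (2 * A + norm v / s) - ln (q * S) \<le> 2 * (c * t) * ((1 + e) * (norm v)\<^sup>2 / (4 * t\<^sup>2) + (1 + 1 / e) * (16 / t) * A)"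
        using q S0 by (subst (asm) mult_le_cancel_left_pos) auto
      moreover have "- (f x - f a - d / 4) / t = - ((f x - f a - d / 4) / t)" by (rule minus_divide_left[symmetric])
      ultimately have "(f x - f a - d / 4) / t \<le> A2 + norm v / s + 2 * (c * t) * ((1 + e) * (norm v)\<^sup>2 / (4 * t\<^sup>2) + (1 + 1 / e) * (16 / t) * A)"
        unfolding A2_def using lnN by linarith
      then have "t * ((f x - f a - d / 4) / t) \<le> t * (A2 + norm v / s + 2 * (c * t) * ((1 + e) * (norm v)\<^sup>2 / (4 * t\<^sup>2) + (1 + 1 / e) * (16 / t) * A))"
        using t by (intro mult_left_mono) auto
      also have "\<dots> = A2 * t + norm v * (t / s) + (c * (1 + e) / 2 * (norm v)\<^sup>2 + A4 * t)"
      proof -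
        have "t * (2 * (c * t) * (X / (4 * t\<^sup>2) + Y * (16 / t) * A)) = c * X / 2 + 2 * c * (Y * 16 * A) * t" for X Y :: real
          using t by (simp add: power2_eq_square distrib_left)
        from this[of "(1 + e) * (norm v)\<^sup>2" "1 + 1 / e"] show ?thesis by (simp add: A4_def distrib_left mult_ac)
      qed
      finally have "f x - f a - d / 4 \<le> A2 * t + norm v * s + (c * (1 + e) / 2 * (norm v)\<^sup>2 + A4 * t)"
        using t st by simp
      moreover have "c * (1 + e) / 2 * (norm v)\<^sup>2 = c / 2 * (norm v)\<^sup>2 + c * e / 2 * (norm v)\<^sup>2" by (simp add: algebra_simps add_divide_distrib)
      moreover have "f x - f a = d + c / 2 * (norm v)\<^sup>2" by (simp add: d_def)
      ultimately show False using small[folded s_def] ev d by linarith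
    qed
  qed
qed

end

section \<open>The limit\<close>

lemma C_LS_nonneg: "0 \<le> C_LS M"
  unfolding C_LS_def by (intro INF_greatest) auto

lemma C_PL_nonneg: "0 \<le> C_PL f"
  unfolding C_PL_def by (intro INF_greatest) auto

theorem theorem1:
  fixes f :: "'a::euclidean_space \<Rightarrow> real" and L :: real
  assumes "C_k 2 f"
    and "\<exists>!x. \<forall>y. f x \<le> f y"
    and "0 < L"
    and "\<And>x. laplacian f x \<le> L * (1 + (norm (gradient f x))\<^sup>2)"
    and "\<And>t. 0 < t \<Longrightarrow> integrable lborel (\<lambda>x. exp (- f x / t))"
  shows "((\<exists>c::real. ((\<lambda>t. C_LS (gibbs f t) / ereal t) \<longlongrightarrow> ereal c) (at_right 0))
            \<longleftrightarrow> C_PL f < \<infinity>)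
         \<and> (C_PL f < \<infinity> \<longrightarrow> C_bLS f = C_PL f)"
proof -
  obtain a where a: "\<And>y. f a \<le> f y" and uniq: "\<And>x. (\<forall>y. f x \<le> f y) \<Longrightarrow> x = a"
    using assms(2) by metis
  have min: "f a < f x" if "x \<noteq> a" for x
    using a uniq[of x] that by (meson less_le_trans not_less order_trans)
  have inf: "(INF y. f y) = f a" by (rule cInf_eq_minimum) (auto simp: a)
  interpret gibbs_potential f a
    by unfold_locales (use assms min in auto)
  define Q where "Q t = C_LS (gibbs f t) / ereal t" for t
  have Q0: "\<forall>\<^sub>F t in at_right 0. 0 \<le> Q t"
  proof -
    have "0 \<le> Q t" if "0 < t" for t
      unfolding Q_def using ereal_divide_right_mono[OF C_LS_nonneg, of "ereal t" "gibbs f t"] that by simp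
    then show ?thesis unfolding eventually_at_right_field by (intro exI[of _ 1]) auto
  qed
  \<comment> \<open>A positive number below the infimum is not a PL constant, so some point violates
    the inequality with it. For \<open>C_PL f = \<infinity>\<close> this covers every positive
    \<open>c\<close>.\<close>
  have lower: "\<forall>\<^sub>F t in at_right 0. ereal c \<le> Q t" if c: "0 < c" "ereal c < C_PL f" for c
  proof -
    have "\<not> PL_inequality f c"
    proof
      assume "PL_inequality f c"
      then have "C_PL f \<le> ereal c" unfolding C_PL_def using c by (intro INF_lower) auto
      then show False using c by simp
    qed
    then obtain x where "c / 2 * (norm (gradient f x))\<^sup>2 < f x - f a"
      unfolding PL_inequality_def inf by (auto simp: not_le)
    from C_LS_lower[OF c(1) this] show ?thesis
      using eventually_at_right_less[of "0::real"]
    proof eventually_elim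
      case (elim t)
      have "ereal (c * t) \<le> C_LS (gibbs f t)" unfolding C_LS_def using elim by (intro INF_greatest) auto
      then have "ereal (c * t) / ereal t \<le> Q t" unfolding Q_def using elim by (intro ereal_divide_right_mono) auto
      then show ?case using elim by simp
    qed
  qed
  \<comment> \<open>The locale is interpreted anew for each PL constant; the infimum is only
    approached, so it need not be positive here.\<close>
  have upper: "\<forall>\<^sub>F t in at_right 0. Q t \<le> ereal (C + eps)" if C: "0 < C" "PL_inequality f C" and eps: "0 < eps" for C eps
  proof -
    interpret PL_potential f a L C
      by unfold_locales (use assms C in \<open>auto simp: PL_inequality_def inf\<close>)
    show ?thesis unfolding Q_def by (rule C_LS_upper[OF eps])
  qed
  have lim: "(Q \<longlongrightarrow> C_PL f) (at_right 0)" if fin: "C_PL f < \<infinity>"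
  proof (rule order_tendstoI)
    fix l assume l: "l < C_PL f"
    show "\<forall>\<^sub>F t in at_right 0. l < Q t"
    \<comment> \<open>The lower bound speaks of positive constants only; negative levels are covered
      by \<open>Q t \<ge> 0\<close>.\<close>
    proof (cases "l < 0")
      case True
      then show ?thesis using Q0 by (auto elim!: eventually_mono)
    next
      case False
      obtain c where c: "l < ereal c" "ereal c < C_PL f" using ereal_dense2[OF l] by auto
      then have "0 < c" using False by (metis ereal_less(2) le_less_trans not_less)
      from lower[OF this c(2)] show ?thesis using c(1) by (auto elim!: eventually_mono)
    qed
  next
    fix u assume u: "C_PL f < u"
    then obtain C where C: "0 < C" "PL_inequality f C" "ereal C < u"
      unfolding C_PL_def INF_less_iff by auto
    obtain c where c: "ereal C < ereal c" "ereal c < u" using ereal_dense2[OF C(3)] by auto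
    from upper[OF C(1,2), of "c - C"] c show "\<forall>\<^sub>F t in at_right 0. Q t < u" by (auto elim!: eventually_mono)
  qed
  \<comment> \<open>Without a PL constant the lower bound holds with the number
    \<open>\<bar>c\<bar> + 1\<close>, which exceeds the alleged limit.\<close>
  have "C_PL f < \<infinity>" if c: "(Q \<longlongrightarrow> ereal c) (at_right 0)" for c
  proof (rule ccontr)
    assume "\<not> C_PL f < \<infinity>"
    then have "\<forall>\<^sub>F t in at_right 0. ereal (\<bar>c\<bar> + 1) \<le> Q t" by (intro lower) auto
    then have "ereal (\<bar>c\<bar> + 1) \<le> ereal c" by (intro tendsto_lowerbound[OF c]) auto
    then show False by simp
  qed
  moreover have "\<exists>c. (Q \<longlongrightarrow> ereal c) (at_right 0)" if fin: "C_PL f < \<infinity>"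
  proof -
    obtain c where "C_PL f = ereal c" using fin C_PL_nonneg[of f] by (cases "C_PL f") auto
    then show ?thesis using lim[OF fin] by metis
  qed
  moreover have "C_bLS f = C_PL f" if fin: "C_PL f < \<infinity>"
    unfolding C_bLS_def using tendsto_Lim[OF _ lim[OF fin]] by (simp add: Q_def[abs_def])
  ultimately show ?thesis unfolding Q_def[abs_def] by blast
qed

end
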